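(* Let $k\in\{4,6,8,10,14\}$, let $L$ be a number field and $C/L$ an elliptic curve. Let $\mathfrak{p}$ be a prime of $L$ of good reduction for $C$ with $\mathfrak{p}\nmid6$ and $v_{\mathfrak p}(j(C))=0=v_{\mathfrak p}(j(C)-1728)$. Write $F_{k,C}:=\frac{E_k}{j-j(C)}=\sum_{n\ge1}a_n(F_{k,C})q^n$. Then for all $n\in\mathbb{Z}^+$, \[ a_{n\cdot\mathrm{N}(\mathfrak p)}(F_{k,C})\equiv a_{\mathfrak p}(C)^{k-2}\,a_n(F_{k,C})\pmod{\mathfrak p}. \]
   Context: $q=e^{2\pi i z}$; $E_k$ is the normalized Eisenstein series of weight $k$ (constant term $1$) and $j=q^{-1}+744+\cdots$ the modular $j$-invariant. The $q$-expansion of $E_k/(j-c)$ is the formal expansion $\sum_{m\ge0}c^mE_kj^{-m-1}$ in powers of $q$ (using $j^{-1}=q+O(q^2)$); its $n$-th coefficient is a polynomial in $c$ with integer coefficients. $\mathbb{F}_{\mathfrak p}$ is the residue field of $\mathfrak p$, $\mathrm{N}(\mathfrak p)=|\mathbb{F}_{\mathfrak p}|$, and for a good prime $\mathfrak p$, $a_{\mathfrak p}(C):=\mathrm{N}(\mathfrak p)+1-|C(\mathbb{F}_{\mathfrak p})|$ (points of the reduction). *)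

theory Defs
  imports
    Complex_Main
    "HOL-Algebra.QuotRing"
    "HOL-Computational_Algebra.Formal_Laurent_Series"
begin

section \<open>Number fields and their primes\<close>

class number_field = field_char_0 +
  assumes finite_degree:
    "\<exists>B. finite B \<and> (\<forall>x. \<exists>r :: 'a \<Rightarrow> rat. x = (\<Sum>b\<in>B. of_rat (r b) * b))"

definition ring_of_integers :: "'a::number_field ring" where
  "ring_of_integers =
     \<lparr>carrier = {x. algebraic_int x}, monoid.mult = (*), one = 1, zero = 0, add = (+)\<rparr>"

definition nf_prime :: "'a::number_field set \<Rightarrow> bool" where
  "nf_prime P \<longleftrightarrow> primeideal P ring_of_integers \<and> P \<noteq> {0}"

definition residue_field :: "'a::number_field set \<Rightarrow> 'a set ring" where
  "residue_field P = ring_of_integers Quot P"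

definition prime_norm :: "'a::number_field set \<Rightarrow> nat" where
  "prime_norm P = card (carrier (residue_field P))"

definition local_ring :: "'a::number_field set \<Rightarrow> 'a set" where
  "local_ring P = {a / s | a s. algebraic_int a \<and> algebraic_int s \<and> s \<notin> P}"

definition local_max_ideal :: "'a::number_field set \<Rightarrow> 'a set" where
  "local_max_ideal P = {a / s | a s. a \<in> P \<and> algebraic_int s \<and> s \<notin> P}"

definition uniformizer :: "'a::number_field set \<Rightarrow> 'a \<Rightarrow> bool" where
  "uniformizer P \<pi> \<longleftrightarrow> local_max_ideal P = {\<pi> * x | x. x \<in> local_ring P}"

definition local_unit :: "'a::number_field set \<Rightarrow> 'a \<Rightarrow> bool" where
  "local_unit P u \<longleftrightarrow> u \<in> local_ring P \<and> u \<noteq> 0 \<and> inverse u \<in> local_ring P"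

text \<open>
  \<open>has_valuation P x n\<close> says that the normalized \<open>P\<close>-adic valuation of \<open>x\<close> equals the integer \<open>n\<close>.
  As the localization at \<open>P\<close> is a discrete valuation ring, every nonzero \<open>x\<close> has exactly one such
  \<open>n\<close>, while \<open>x = 0\<close> (of infinite valuation) has none.
\<close>
definition has_valuation :: "'a::number_field set \<Rightarrow> 'a \<Rightarrow> int \<Rightarrow> bool" where
  "has_valuation P x n \<longleftrightarrow> (\<exists>\<pi> u. uniformizer P \<pi> \<and> local_unit P u \<and> x = u * \<pi> powi n)"

text \<open>
  Congruence modulo \<open>P\<close> for \<open>P\<close>-integral elements, which need not be algebraic integers.
\<close>
definition cong_mod_prime :: "'a::number_field set \<Rightarrow> 'a \<Rightarrow> 'a \<Rightarrow> bool" where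
  "cong_mod_prime P x y \<longleftrightarrow>
     x \<in> local_ring P \<and> y \<in> local_ring P \<and> x - y \<in> local_max_ideal P"

text \<open>
  For \<open>P\<close>-integral \<open>x\<close> this is the coset of \<open>P\<close> in the ring of integers that corresponds to the
  class of \<open>x\<close> under the isomorphism between the residue field of the localization and that of \<open>P\<close>.
\<close>
definition reduce_mod :: "'a::number_field set \<Rightarrow> 'a \<Rightarrow> 'a set" where
  "reduce_mod P x = {z. algebraic_int z \<and> z - x \<in> local_max_ideal P}"


section \<open>Elliptic curves\<close>

text \<open>
  The equation \<open>y\<^sup>2 + a1 x y + a3 y = x\<^sup>3 + a2 x\<^sup>2 + a4 x + a6\<close>.
\<close>
datatype 'a weierstrass = Weierstrass (a1: 'a) (a2: 'a) (a3: 'a) (a4: 'a) (a6: 'a)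

definition b2 :: "'a::comm_ring_1 weierstrass \<Rightarrow> 'a" where
  "b2 W = a1 W ^ 2 + 4 * a2 W"

definition b4 :: "'a::comm_ring_1 weierstrass \<Rightarrow> 'a" where
  "b4 W = 2 * a4 W + a1 W * a3 W"

definition b6 :: "'a::comm_ring_1 weierstrass \<Rightarrow> 'a" where
  "b6 W = a3 W ^ 2 + 4 * a6 W"

definition b8 :: "'a::comm_ring_1 weierstrass \<Rightarrow> 'a" where
  "b8 W = a1 W ^ 2 * a6 W + 4 * a2 W * a6 W - a1 W * a3 W * a4 W + a2 W * a3 W ^ 2 - a4 W ^ 2"

definition c4 :: "'a::comm_ring_1 weierstrass \<Rightarrow> 'a" where
  "c4 W = b2 W ^ 2 - 24 * b4 W"

definition discriminant :: "'a::comm_ring_1 weierstrass \<Rightarrow> 'a" where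
  "discriminant W =
     - (b2 W ^ 2 * b8 W) - 8 * b4 W ^ 3 - 27 * b6 W ^ 2 + 9 * b2 W * b4 W * b6 W"

definition elliptic_curve :: "'a::field weierstrass \<Rightarrow> bool" where
  "elliptic_curve W \<longleftrightarrow> discriminant W \<noteq> 0"

definition j_invariant :: "'a::field weierstrass \<Rightarrow> 'a" where
  "j_invariant W = c4 W ^ 3 / discriminant W"

text \<open>
  The curves are isomorphic over the base field: \<open>W'\<close> arises from \<open>W\<close> by the admissible change of
  variables \<open>x = u\<^sup>2 x' + r\<close>, \<open>y = u\<^sup>3 y' + u\<^sup>2 s x' + t\<close>.
\<close>
definition weierstrass_iso :: "'a::field weierstrass \<Rightarrow> 'a weierstrass \<Rightarrow> bool" where
  "weierstrass_iso W W' \<longleftrightarrow> (\<exists>u r s t. u \<noteq> 0 \<and>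
     u * a1 W' = a1 W + 2 * s \<and>
     u ^ 2 * a2 W' = a2 W - s * a1 W + 3 * r - s ^ 2 \<and>
     u ^ 3 * a3 W' = a3 W + r * a1 W + 2 * t \<and>
     u ^ 4 * a4 W' = a4 W - s * a3 W + 2 * r * a2 W - (t + r * s) * a1 W + 3 * r ^ 2 - 2 * s * t \<and>
     u ^ 6 * a6 W' = a6 W + r * a4 W + r ^ 2 * a2 W + r ^ 3 - t * a3 W - t ^ 2 - r * t * a1 W)"

text \<open>
  Projective points over a ring with explicit carrier; \<open>None\<close> is the point at infinity.
\<close>
definition curve_points :: "('a, 'm) ring_scheme \<Rightarrow> 'a weierstrass \<Rightarrow> ('a \<times> 'a) option set" where
  "curve_points R W = insert None (Some ` {(x, y). x \<in> carrier R \<and> y \<in> carrier R \<and>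
     y [^]\<^bsub>R\<^esub> (2::nat) \<oplus>\<^bsub>R\<^esub> a1 W \<otimes>\<^bsub>R\<^esub> x \<otimes>\<^bsub>R\<^esub> y \<oplus>\<^bsub>R\<^esub> a3 W \<otimes>\<^bsub>R\<^esub> y =
     x [^]\<^bsub>R\<^esub> (3::nat) \<oplus>\<^bsub>R\<^esub> a2 W \<otimes>\<^bsub>R\<^esub> x [^]\<^bsub>R\<^esub> (2::nat) \<oplus>\<^bsub>R\<^esub> a4 W \<otimes>\<^bsub>R\<^esub> x \<oplus>\<^bsub>R\<^esub> a6 W})"

definition good_model ::
    "'a::number_field set \<Rightarrow> 'a weierstrass \<Rightarrow> 'a weierstrass \<Rightarrow> bool" where
  "good_model P C W \<longleftrightarrow> weierstrass_iso C W \<and> set_weierstrass W \<subseteq> local_ring P \<and>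
     has_valuation P (discriminant W) 0"

definition good_reduction :: "'a::number_field set \<Rightarrow> 'a weierstrass \<Rightarrow> bool" where
  "good_reduction P C \<longleftrightarrow> (\<exists>W. good_model P C W)"

text \<open>
  Any two good models have isomorphic reductions, so the choice does not affect the point count.
\<close>
definition reduction :: "'a::number_field set \<Rightarrow> 'a weierstrass \<Rightarrow> 'a set weierstrass" where
  "reduction P C = map_weierstrass (reduce_mod P) (SOME W. good_model P C W)"

definition frobenius_trace :: "'a::number_field set \<Rightarrow> 'a weierstrass \<Rightarrow> int" where
  "frobenius_trace P C =
     int (prime_norm P) + 1 - int (card (curve_points (residue_field P) (reduction P C)))"


section \<open>Expansions of modular forms\<close>

text \<open>Bernoulli numbers, the coefficients of \<open>t / (exp t - 1)\<close>.\<close>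
fun bernoulli :: "nat \<Rightarrow> rat" where
  "bernoulli 0 = 1"
| "bernoulli (Suc n) =
     - (\<Sum>i\<le>n. of_nat ((n + 2) choose i) * bernoulli i) / of_nat (n + 2)"

definition divisor_sigma :: "nat \<Rightarrow> nat \<Rightarrow> nat" where
  "divisor_sigma k n = (\<Sum>d | d dvd n. d ^ k)"

text \<open>
  The expansion in \<open>q = exp (2 \<pi> i z)\<close> of the normalized Eisenstein series of even weight \<open>k \<ge> 4\<close>.
\<close>
definition eisenstein :: "nat \<Rightarrow> 'a::field_char_0 fps" where
  "eisenstein k = Abs_fps (\<lambda>n. if n = 0 then 1
     else of_rat (- 2 * of_nat k / bernoulli k) * of_nat (divisor_sigma (k - 1) n))"

text \<open>The modular invariant \<open>q\<^sup>-\<^sup>1 + 744 + \<dots>\<close>.\<close>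
definition modular_j :: "'a::field_char_0 fls" where
  "modular_j = 1728 * fps_to_fls (eisenstein 4 ^ 3) /
     fps_to_fls (eisenstein 4 ^ 3 - eisenstein 6 ^ 2)"

text \<open>
  The formal expansion of \<open>E\<^sub>k / (j - c)\<close> as the sum over all \<open>m\<close> of \<open>c\<^sup>m E\<^sub>k j\<^sup>-\<^sup>m\<^sup>-\<^sup>1\<close>.
  As \<open>j\<^sup>-\<^sup>1 = q + O(q\<^sup>2)\<close>, only the terms with \<open>m < n\<close> contribute to the \<open>n\<close>-th coefficient.
\<close>
definition eisenstein_over_j :: "nat \<Rightarrow> 'a::field_char_0 \<Rightarrow> 'a fps" where
  "eisenstein_over_j k c = Abs_fps (\<lambda>n. \<Sum>m<n. c ^ m *
     fls_nth (fps_to_fls (eisenstein k) * inverse modular_j ^ (m + 1)) (int n))"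

lemma bernoulli_4_6: "bernoulli 4 = -1/30" "bernoulli 6 = 1/42"
  by (simp_all add: eval_nat_numeral)

lemma eisenstein_4_6_nth:
  "fps_nth (eisenstein 4 :: 'a::field_char_0 fps) 0 = 1"
  "fps_nth (eisenstein 4 :: 'a fps) (Suc 0) = 240"
  "fps_nth (eisenstein 6 :: 'a fps) 0 = 1" "fps_nth (eisenstein 6 :: 'a fps) (Suc 0) = -504"
  by (simp_all add: eisenstein_def divisor_sigma_def bernoulli_4_6)

lemma eisenstein_diff_nth:
  "fps_nth (eisenstein 4 ^ 3 - eisenstein 6 ^ 2 :: 'a::field_char_0 fps) 0 = 0"
  "fps_nth (eisenstein 4 ^ 3 - eisenstein 6 ^ 2 :: 'a::field_char_0 fps) (Suc 0) = 1728"
  by (simp_all add: power2_eq_square power3_eq_cube fps_mult_nth eisenstein_4_6_nth)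

lemma inverse_modular_j:
  obtains g :: "'a::field_char_0 fps" where "inverse modular_j = fps_to_fls g"
    "fps_nth g 0 = 0" "fps_nth g 1 = 1"
proof -
  define e :: "'a fps" where "e = eisenstein 4 ^ 3"
  define d :: "'a fps" where "d = eisenstein 4 ^ 3 - eisenstein 6 ^ 2"
  define g where "g = fps_const (1/1728) * d * inverse e"
  have e0: "fps_nth e 0 = 1" by (simp add: e_def fps_power_zeroth eisenstein_4_6_nth)
  have d: "fps_nth d 0 = 0" "fps_nth d (Suc 0) = 1728" using eisenstein_diff_nth by (auto simp: d_def)
  have g: "fps_nth g 0 = 0" "fps_nth g (Suc 0) = 1"
    by (simp_all add: g_def fps_mult_nth d e0)
  have "g * e = fps_const (1/1728) * d * (inverse e * e)" by (simp add: g_def mult_ac)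
  also have "inverse e * e = 1" using e0 by (simp add: inverse_mult_eq_1)
  finally have "g * e = fps_const (1/1728) * d" by simp
  hence "1728 * (g * e) = 1728 * fps_const (1/1728) * d" by (simp add: mult_ac)
  also have "1728 * fps_const (1/1728) = (1 :: 'a fps)"
    by (simp flip: fps_const_1_eq_1 add: numeral_fps_const)
  finally have "fps_to_fls (1728 * (g * e)) = fps_to_fls d" by simp
  hence *: "1728 * fps_to_fls g * fps_to_fls e = fps_to_fls d"
    by (simp add: fls_times_fps_to_fls mult_ac)
  have "fps_to_fls e \<noteq> 0" "fps_to_fls d \<noteq> 0" using e0 d by auto
  moreover have "modular_j = 1728 * fps_to_fls e / fps_to_fls d"
    by (simp add: modular_j_def e_def d_def)
  ultimately have "modular_j = inverse (fps_to_fls g)"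
    by (simp flip: * add: inverse_eq_divide)
  hence "inverse modular_j = fps_to_fls g" by (metis inverse_inverse_eq)
  thus ?thesis using that[of g] g by simp
qed

text \<open>The formal expansion is the quotient in the field of formal Laurent series.\<close>
lemma eisenstein_over_j_eq:
  "fps_to_fls (eisenstein_over_j k c) =
     fps_to_fls (eisenstein k) / (modular_j - fls_const (c :: 'a::field_char_0))"
proof -
  obtain g :: "'a fps" where g: "inverse modular_j = fps_to_fls g"
    "fps_nth g 0 = 0" "fps_nth g 1 = 1" by (rule inverse_modular_j)
  define E F :: "'a fps" where "E = eisenstein k" and "F = eisenstein_over_j k c"
  have low: "fps_nth (A * g ^ m) n = 0" if "n < m" for A :: "'a fps" and n m
  proof -
    have "fps_nth (g ^ m) i = 0" if "i < m" for i
      using that g(2) by (rule startsby_zero_power_prefix[rule_format, rotated])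
    thus ?thesis using that unfolding fps_mult_nth by (intro sum.neutral) auto
  qed
  have F: "fps_nth F n = (\<Sum>m<N. c ^ m * fps_nth (E * g ^ (m + 1)) n)" if "n \<le> N" for n N
  proof -
    have "fps_nth F n = (\<Sum>m<n. c ^ m * fps_nth (E * g ^ (m + 1)) n)"
      by (simp add: F_def E_def eisenstein_over_j_def g(1) flip: fps_to_fls_power fls_times_fps_to_fls
          del: power_Suc)
    also have "\<dots> = (\<Sum>m<N. c ^ m * fps_nth (E * g ^ (m + 1)) n)"
      using that by (intro sum.mono_neutral_left) (auto simp: low simp del: power_Suc)
    finally show ?thesis .
  qed
  have "F - fps_const c * g * F = E * g"
  proof (rule fps_ext)
    fix n
    define S where "S = (\<Sum>m<n. fps_const (c ^ m) * (E * g ^ (m + 1)))"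
    have S: "fps_nth F i = fps_nth S i" if "i \<le> n" for i
      using F[OF that] by (simp add: S_def fps_sum_nth del: power_Suc)
    have "fps_nth (fps_const c * g * F) n = fps_nth (fps_const c * g * S) n"
      unfolding fps_mult_nth[of "fps_const c * g"] by (intro sum.cong) (auto simp: S)
    hence "fps_nth (F - fps_const c * g * F) n = fps_nth (S - fps_const c * g * S) n"
      by (simp add: S)
    also have "S - fps_const c * g * S = E * g - fps_const (c ^ n) * (E * g ^ (n + 1))"
    proof -
      define h where "h = fps_const c * g"
      have pw: "fps_const (c ^ m) * (E * g ^ (m + 1)) = E * g * h ^ m" for m
        by (simp add: h_def power_mult_distrib fps_const_power mult_ac)
      have "S = E * g * (\<Sum>m<n. h ^ m)"
        unfolding S_def pw by (simp add: sum_distrib_left)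
      hence "S - h * S = E * g * ((1 - h) * (\<Sum>m<n. h ^ m))"
        by (simp add: algebra_simps)
      also have "\<dots> = E * g * (1 - h ^ n)"
        by (simp only: one_diff_power_eq)
      finally show ?thesis
        by (simp only: pw h_def[symmetric] right_diff_distrib mult_1_right)
    qed
    also have "fps_nth \<dots> n = fps_nth (E * g) n"
      using low[of n "n + 1" E] by (simp del: power_Suc)
    finally show "fps_nth (F - fps_const c * g * F) n = fps_nth (E * g) n" .
  qed
  hence "fps_to_fls F = fps_to_fls (E * g + fps_const c * g * F)"
    by (simp add: algebra_simps)
  hence 1: "fps_to_fls F = fps_to_fls E * inverse modular_j + fls_const c * inverse modular_j * fps_to_fls F"
    by (simp add: g(1) fls_times_fps_to_fls)
  have nz: "modular_j \<noteq> (0 :: 'a fls)" using g by auto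
  have "fps_to_fls F * (modular_j - fls_const c) = fps_to_fls E"
  proof -
    have "fps_to_fls F * modular_j =
        (fps_to_fls E * inverse modular_j + fls_const c * inverse modular_j * fps_to_fls F) * modular_j"
      using 1 by simp
    also have "\<dots> = fps_to_fls E * (inverse modular_j * modular_j) +
        fls_const c * fps_to_fls F * (inverse modular_j * modular_j)"
      by (simp only: algebra_simps)
    also have "inverse modular_j * modular_j = (1 :: 'a fls)"
      using nz by (rule left_inverse)
    finally show ?thesis by (simp add: algebra_simps)
  qed
  moreover have "modular_j \<noteq> fls_const c"
  proof
    assume "modular_j = fls_const c"
    hence "fps_to_fls g = fls_const (inverse c)"
      by (metis g(1) fls_inverse_const)
    hence "fls_nth (fps_to_fls g) 1 = fls_nth (fls_const (inverse c)) 1" by simp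
    thus False using g(3) by simp
  qed
  ultimately show ?thesis by (simp add: F_def E_def field_simps)
qed

end

theory Submission
  imports
    Defs
    "HOL-Computational_Algebra.Primes"
    "HOL-Algebra.Multiplicative_Group"
begin

text \<open>
  Let \<open>N = p\<^sup>r\<close> be the norm of the prime and \<open>U\<close> the operator \<open>\<Sum> a\<^sub>n q\<^sup>n \<mapsto> \<Sum> a\<^bsub>n N\<^esub> q\<^sup>n\<close>. With \<open>a = c4\<close>, \<open>b = - c6\<close>
  and \<open>V = a\<^sup>3 E6\<^sup>2 - b\<^sup>2 E4\<^sup>3\<close>, the series \<open>F = E\<^sub>k / (j - j(C))\<close> satisfies
  \<open>V F = disc(C) E\<^sub>k (E4\<^sup>3 - E6\<^sup>2)\<close>. As \<open>V\<^sup>N\<close> is congruent to \<open>V(q\<^sup>N)\<close>, the product \<open>V \<cdot> U F\<close> is congruent to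
  \<open>U (V\<^bsup>N-1\<^esup> V F)\<close>, and \<open>V\<^bsup>N-1\<^esup>\<close> to the sum of all \<open>(a\<^sup>3 E6\<^sup>2)\<^sup>i (b\<^sup>2 E4\<^sup>3)\<^bsup>N-1-i\<^esup>\<close>. Hence \<open>U\<close> is needed only on
  the series \<open>E\<^sub>k (E4\<^sup>3 - E6\<^sup>2) E6\<^bsup>2i\<^esup> E4\<^bsup>3(N-1-i)\<^esup>\<close>.

  The Hasse polynomial \<open>H\<close>, the coefficient of \<open>x\<^bsup>N-1\<^esup>\<close> in \<open>(x\<^sup>3 - 27 a x + 54 b)\<^bsup>(N-1)/2\<^esup>\<close>, takes the value 1
  modulo \<open>p\<close> at \<open>(E4, E6)\<close>, by the Cartier operator on the Tate curve. After multiplication by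
  \<open>H(E4, E6)\<^bsup>k-2\<^esup>\<close> these series are, up to \<open>N\<close>-th powers, combinations of logarithmic forms \<open>t\<^bsup>m-1\<^esup> \<theta>t\<close> with
  \<open>t = E6\<^sup>2 / E4\<^sup>3\<close>; \<open>U\<close> kills those with \<open>m \<noteq> N\<close> in the range that occurs. Reassembling the
  coefficients shows that \<open>F\<close> is an eigenvector of \<open>U\<close> with eigenvalue \<open>H(a, b)\<^bsup>k-2\<^esup>\<close>, and \<open>H(a, b)\<close> is the trace
  of Frobenius, by counting points with \<open>y \<mapsto> 1 - y\<^bsup>N-1\<^esup>\<close>.
\<close>

text \<open>The list of weights and the exponent k - 2 come from one weight count. For these k the
  series E_k is a monomial \<open>e\<close> in \<open>E4\<close>, \<open>E6\<close> with a
  complementary monomial \<open>e'\<close> such that e e' = E4^2 E6, and E4^2 E6 (E4^3 - E6^2) is,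
  up to sign, the numerator of the logarithmic derivative of t. With \<open>a\<close>,
  \<open>b\<close> of weights 2 and 3 the polynomial H^(k-2) e'^(N-1) has weight 6 (N - 1), so it is
  a polynomial in a^3 and b^2, and its N coefficients match the N series to which U is applied.
  These integers are read twice. At (E4, E6), where H becomes 1, they give the action of U; at (c4,
  - c6) they sum to H^(k-2) e'^(N-1). There Fermat removes e'^(N-1), because the conditions on j(C)
  and j(C) - 1728 make c4 and c6 units.

  The second obstacle is integrality: in L everything is divisible by p. Congruences are therefore
  kept over the integers or in the localization, and an error term p f is discarded only after f is
  seen to be integral.

  All facts about Eisenstein series are formal identities of q-series drawn from the Tate curve;
  dimensions of spaces of modular forms do not enter.\<close>

unbundle fps_syntax
notation fls_nth (infixl \<open>$$\<close> 75)

section \<open>The Tate curve\<close>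

text \<open>
  The expansion at \<open>q = 0\<close> of \<open>1 / (1 - q\<^sup>n)\<close>, which for \<open>n < 0\<close> is \<open>- q\<^bsup>-n\<^esup> / (1 - q\<^bsup>-n\<^esup>)\<close>;
  \<open>geo 0 = 0\<close> is a convention.
\<close>
definition geo :: "int \<Rightarrow> int fps" where
  "geo n = Abs_fps (\<lambda>d. if n > 0 then (if n dvd int d then 1 else 0)
     else if n < 0 \<and> d > 0 \<and> n dvd int d then - 1 else 0)"

lemma geo_0 [simp]: "geo 0 = 0"
  by (simp add: geo_def fps_ext)

lemma geo_nth: "geo n $ d = (if n = 0 then 0 else if d = 0 then (if n > 0 then 1 else 0)
    else if n dvd int d then sgn n else 0)"
  by (auto simp: geo_def)

lemma geo_uminus: "n \<noteq> 0 \<Longrightarrow> geo (- n) = 1 - geo n"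
  by (rule fps_ext) (auto simp: geo_nth)

lemma one_minus_X_power_mult_nth:
  fixes f :: "'a::comm_ring_1 fps"
  shows "((1 - fps_X ^ m) * f) $ d = f $ d - (if d < m then 0 else f $ (d - m))"
  by (simp add: left_diff_distrib fps_X_power_mult_nth)

lemma geo_pos: "m > 0 \<Longrightarrow> (1 - fps_X ^ m) * geo (int m) = 1"
proof (rule fps_ext)
  fix d assume m: "m > 0"
  have nth: "geo (int m) $ e = (if m dvd e then 1 else 0)" for e
    using m by (simp add: geo_def)
  consider "d < m" | "d \<ge> m" by linarith
  thus "((1 - fps_X ^ m) * geo (int m)) $ d = 1 $ d"
  proof cases
    case 1
    hence "m dvd d \<longleftrightarrow> d = 0" by (auto dest: dvd_imp_le)
    thus ?thesis using 1 by (simp only: one_minus_X_power_mult_nth nth if_True) simp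
  next
    case 2
    hence "m dvd d - m \<longleftrightarrow> m dvd d" by (metis dvd_minus_self not_less)
    thus ?thesis using 2 m by (simp only: one_minus_X_power_mult_nth nth) simp
  qed
qed

text \<open>Division of 1 - AB = (1 - A) + (1 - B) - (1 - A)(1 - B) by (1 - A)(1 - B)(1 - AB), where
  A = q^a and B = q^b.\<close>

lemma geo_mult_pos:
  assumes "a > 0" "b > 0"
  shows "geo a * geo b = geo (a + b) * (geo a + geo b - 1)"
proof -
  obtain m n where mn: "a = int m" "b = int n" "m > 0" "n > 0"
    using assms by (metis zero_less_imp_eq_int)
  define A B :: "int fps" where "A = fps_X ^ m" and "B = fps_X ^ n"
  have g: "(1 - A) * geo a = 1" "(1 - B) * geo b = 1" "(1 - A * B) * geo (a + b) = 1"
    using geo_pos[of m] geo_pos[of n] geo_pos[of "m + n"] mn by (simp_all add: A_def B_def power_add)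
  have "geo a * geo b = (1 - A * B) * geo (a + b) * (geo a * geo b)" by (simp add: g)
  also have "1 - A * B = (1 - A) + (1 - B) - (1 - A) * (1 - B)" by (simp add: algebra_simps)
  also have "\<dots> * geo (a + b) * (geo a * geo b) = geo (a + b) *
     (((1 - A) * geo a) * geo b + ((1 - B) * geo b) * geo a - ((1 - A) * geo a) * ((1 - B) * geo b))"
    by (simp only: algebra_simps)
  finally show ?thesis by (simp add: g add.commute)
qed

text \<open>This makes the squares of \<open>wp\<close> and \<open>wzeta\<close> computable: in the
  convolution over \<open>a\<close> the factor \<open>geo n\<close> splits off, and a sum linear in
  \<open>geo\<close> remains. The reflection \<open>geo (- n) = 1 - geo n\<close> reduces every sign
  pattern to the positive one.\<close>

lemma geo_mult:
  assumes "n \<noteq> 0" "a \<noteq> 0" "n \<noteq> a"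
  shows "geo a * geo (n - a) = geo n * (geo a + geo (n - a) - 1)"
proof -
  have pos: "geo a * geo (n - a) = geo n * (geo a + geo (n - a) - 1)"
    if n: "n > 0" "a \<noteq> 0" "n \<noteq> a" for n a
  proof -
    consider "a > 0 \<and> n - a > 0" | "a < 0" | "n - a < 0" using n by linarith
    thus ?thesis
    proof cases
      case 1 thus ?thesis using geo_mult_pos[of a "n - a"] by simp
    next
      case 2
      have "geo n * geo (-a) = geo (n - a) * (geo n + geo (- a) - 1)"
        using geo_mult_pos[of n "-a"] 2 n by simp
      thus ?thesis using 2 by (simp add: geo_uminus algebra_simps)
    next
      case 3
      have "geo n * geo (a - n) = geo a * (geo n + geo (a - n) - 1)"
        using geo_mult_pos[of n "a - n"] 3 n by simp
      moreover have "geo (a - n) = 1 - geo (n - a)" using geo_uminus[of "n - a"] 3 by simp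
      ultimately show ?thesis by (simp add: algebra_simps)
    qed
  qed
  show ?thesis
  proof (cases "n > 0")
    case True thus ?thesis using pos assms by blast
  next
    case False
    hence "geo (-a) * geo (-n - (-a)) = geo (-n) * (geo (-a) + geo (-n - (-a)) - 1)"
      using assms by (intro pos) auto
    moreover have "geo (a - n) = 1 - geo (n - a)" using geo_uminus[of "n - a"] assms by simp
    ultimately show ?thesis using assms by (simp add: geo_uminus algebra_simps)
  qed
qed

definition theta :: "'a::comm_ring_1 fps \<Rightarrow> 'a fps" where
  "theta f = fps_X * fps_deriv f"

lemma theta_nth [simp]: "theta f $ n = of_nat n * f $ n"
  by (cases n) (simp_all add: theta_def)

lemma theta_add [simp]: "theta (f + g) = theta f + theta g"
  and theta_diff [simp]: "theta (f - g) = theta f - theta g"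
  and theta_mult: "theta (f * g) = theta f * g + f * theta g"
  and theta_1 [simp]: "theta 1 = 0"
  and theta_0 [simp]: "theta 0 = 0"
  by (simp_all add: theta_def algebra_simps)

lemma theta_power: "theta (f ^ n) = of_nat n * f ^ (n - 1) * theta f"
  by (simp add: theta_def fps_deriv_power mult_ac fps_of_nat)

text \<open>Differentiation of (1 - q^m) geo m = 1. The shape persists for negative \<open>n\<close>
  because g^2 - g is invariant under g -> 1 - g. Later this trades squares of \<open>geo\<close> for
  derivatives in q.\<close>

lemma theta_geo: "theta (geo n) = of_int n * (geo n ^ 2 - geo n)"
proof -
  have pos: "theta (geo (int m)) = of_nat m * (geo (int m) ^ 2 - geo (int m))" if "m > 0" for m
  proof -
    let ?A = "fps_X ^ m :: int fps" and ?g = "geo (int m)"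
    have tA: "theta ?A = of_nat m * ?A"
      by (rule fps_ext) (simp add: fps_mult_of_nat_nth)
    have g: "(1 - ?A) * ?g = 1" by (rule geo_pos[OF that])
    hence Ag: "?A * ?g = ?g - 1" by (simp add: algebra_simps)
    have "theta ((1 - ?A) * ?g) = 0" using g by simp
    hence "(1 - ?A) * theta ?g = of_nat m * (?A * ?g)"
      by (simp add: theta_mult tA algebra_simps)
    hence "(?g * (1 - ?A)) * theta ?g = ?g * (of_nat m * (?g - 1))"
      unfolding Ag by (simp add: mult.assoc)
    moreover have "?g * (1 - ?A) = 1" using g by (simp add: mult.commute)
    ultimately have "theta ?g = ?g * (of_nat m * (?g - 1))" by (simp only: mult_1_left)
    thus ?thesis by (simp add: algebra_simps power2_eq_square)
  qed
  consider "n = 0" | "n > 0" | "n < 0" by linarith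
  thus ?thesis
  proof cases
    case 2
    thus ?thesis using pos[of "nat n"] by simp
  next
    case 3
    hence "geo n = 1 - geo (- n)" using geo_uminus[of "- n"] by simp
    moreover have "theta (geo (- n)) = of_int (- n) * (geo (- n) ^ 2 - geo (- n))"
      using 3 pos[of "nat (- n)"] by simp
    ultimately show ?thesis
      by (simp only: theta_diff theta_1) (simp add: power2_eq_square algebra_simps)
  qed simp
qed

section \<open>Series in q over Laurent series in u, and their rows\<close>

lemma fls_mult_nth_range:
  fixes f g :: "'a::comm_ring_1 fls"
  assumes "\<And>a. a < - K \<Longrightarrow> f $$ a = 0" "\<And>a. a < - K \<Longrightarrow> g $$ a = 0"
  shows "(f * g) $$ n = (\<Sum>a=-K..n+K. f $$ a * g $$ (n - a))"
proof -
  have "(f * g) $$ n = (\<Sum>i=fls_subdegree f..n - fls_subdegree g. f $$ i * g $$ (n - i))"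
    by (rule fls_times_nth(2))
  also have "\<dots> = (\<Sum>a=-K..n+K. f $$ a * g $$ (n - a))"
  proof (rule sum.mono_neutral_cong)
    fix i assume "i \<in> {-K..n+K} - {fls_subdegree f..n - fls_subdegree g}"
    hence "i < fls_subdegree f \<or> n - i < fls_subdegree g" by auto
    thus "f $$ i * g $$ (n - i) = 0" by (auto simp: fls_eq0_below_subdegree)
  next
    fix i assume "i \<in> {fls_subdegree f..n - fls_subdegree g} - {-K..n+K}"
    hence "i < -K \<or> n - i < -K" by auto
    thus "f $$ i * g $$ (n - i) = 0" using assms by auto
  qed auto
  finally show ?thesis .
qed

lemma fls_nth_sum: "(\<Sum>i\<in>S. f i) $$ n = (\<Sum>i\<in>S. f i $$ n)"
  by (induction S rule: infinite_finite_induct) auto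

text \<open>
  A series in \<open>q\<close> whose coefficients are Laurent series in \<open>u\<close>; \<open>row n\<close> is the coefficient of
  \<open>u\<^sup>n\<close> as a series in \<open>q\<close>.
\<close>
definition row :: "int \<Rightarrow> 'a::zero fls fps \<Rightarrow> 'a fps" where
  "row n F = Abs_fps (\<lambda>d. F $ d $$ n)"

definition of_rows :: "(int \<Rightarrow> 'a::zero fps) \<Rightarrow> 'a fls fps" where
  "of_rows c = Abs_fps (\<lambda>d. Abs_fls (\<lambda>n. c n $ d))"

text \<open>
  The growth of the poles that keeps the convolution of rows finite in each degree; it holds for
  expansions in \<open>\<bar>q\<bar> < \<bar>u\<bar> < 1\<close>.
\<close>
definition tame :: "'a::zero fls fps \<Rightarrow> bool" where
  "tame F \<longleftrightarrow> (\<forall>d n. n < - int d \<longrightarrow> F $ d $$ n = 0)"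

definition dlog_u :: "'a::comm_ring_1 fls fps \<Rightarrow> 'a fls fps" where
  "dlog_u F = Abs_fps (\<lambda>d. fls_X * fls_deriv (F $ d))"

definition emb :: "'a::comm_ring_1 fps \<Rightarrow> 'a fls fps" where
  "emb c = Abs_fps (\<lambda>d. fls_const (c $ d))"

lemma row_nth [simp]: "row n F $ d = F $ d $$ n"
  by (simp add: row_def)

lemma row_eqI: "(\<And>n. row n F = row n G) \<Longrightarrow> F = G"
  by (rule fps_ext, rule fls_eqI) (metis row_nth)

text \<open>\<open>Abs_fls\<close> recovers a function only if it vanishes far to the left; the
  hypothesis ensures this with the bound that defines \<open>tame\<close>.\<close>

lemma row_of_rows:
  assumes "\<And>n d. n < - int d \<Longrightarrow> c n $ d = 0"
  shows "row n (of_rows c) = c n" and "tame (of_rows c)"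
proof -
  have "Abs_fls (\<lambda>n. c n $ d) $$ n = c n $ d" for n d
    by (rule nth_Abs_fls_lower_bound[of "- int d"]) (use assms in auto)
  thus "row n (of_rows c) = c n" "tame (of_rows c)" using assms
    by (auto intro: fps_ext simp: of_rows_def tame_def)
qed

lemma row_add [simp]: "row n (F + G) = row n F + row n G"
  and row_diff [simp]: "row n (F - G) = row n F - row n G"
  and row_zero [simp]: "row n 0 = 0"
  for F G :: "'a::comm_ring_1 fls fps"
  by (auto intro: fps_ext)

lemma row_sum: "row n (\<Sum>i\<in>S. F i) = (\<Sum>i\<in>S. row n (F i))"
  for F :: "_ \<Rightarrow> 'a::comm_ring_1 fls fps"
  by (induction S rule: infinite_finite_induct) auto

lemma row_dlog_u: "row n (dlog_u F) = of_int n * row n F"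
  by (rule fps_ext) (simp add: dlog_u_def fls_X_times_conv_shift fps_mult_of_int_nth)

lemma row_emb_mult: "row n (emb c * F) = c * row n F"
  by (rule fps_ext) (simp add: fps_mult_nth emb_def fls_nth_sum)

lemma emb_mult: "emb (a * b) = emb a * emb b"
  by (rule row_eqI) (auto simp: row_emb_mult intro!: fps_ext, simp add: emb_def fps_mult_nth)

lemma row_emb: "row n (emb c) = (if n = 0 then c else 0)"
  by (rule fps_ext) (simp add: emb_def)

lemma emb_add: "emb (a + b) = emb a + emb b"
  by (rule row_eqI) (simp add: row_emb)

lemma emb_1: "emb 1 = 1"
  by (rule fps_ext) (simp add: emb_def)

lemma emb_0 [simp]: "emb 0 = 0"
  by (rule fps_ext) (simp add: emb_def)

lemma emb_numeral: "emb (numeral k) = numeral k"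
  by (rule fps_ext) (simp add: emb_def fps_numeral_nth)

lemma dlog_u_mult: "dlog_u (F * G) = dlog_u F * G + F * dlog_u G"
  by (rule fps_ext)
    (simp add: dlog_u_def fps_mult_nth fls_deriv_sum sum_distrib_left sum.distrib distrib_left
      mult.assoc mult.left_commute)

lemma dlog_u_add: "dlog_u (F + G) = dlog_u F + dlog_u G"
  and dlog_u_diff: "dlog_u (F - G) = dlog_u F - dlog_u G"
  by (auto intro: fps_ext simp: dlog_u_def algebra_simps)

lemma dlog_u_emb [simp]: "dlog_u (emb c) = 0"
  by (rule row_eqI) (simp add: row_dlog_u row_emb)

lemma dlog_u_power: "dlog_u (F ^ Suc m) = of_nat (Suc m) * F ^ m * dlog_u F"
  by (induction m) (simp_all add: dlog_u_mult algebra_simps)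

lemma tame_dlog_u: "tame F \<Longrightarrow> tame (dlog_u F)"
  by (auto simp: tame_def dlog_u_def fls_X_times_conv_shift)

text \<open>Tameness makes the convolution over all integers finite in each degree. \<open>K\<close>
  may be any bound from \<open>d\<close> on, so that the window can be enlarged to suit the
  evaluation of the inner sums.\<close>

lemma row_mult_nth:
  fixes F G :: "'a::comm_ring_1 fls fps"
  assumes "tame F" "tame G" "K \<ge> int d"
  shows "row n (F * G) $ d = (\<Sum>a=-K..n+K. row a F * row (n - a) G) $ d"
proof -
  have "row n (F * G) $ d = (\<Sum>i=0..d. \<Sum>a=-K..n+K. F $ i $$ a * G $ (d - i) $$ (n - a))"
    unfolding row_nth fps_mult_nth fls_nth_sum
    by (intro sum.cong refl fls_mult_nth_range) (use assms in \<open>auto simp: tame_def\<close>)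
  also have "\<dots> = (\<Sum>a=-K..n+K. row a F * row (n - a) G) $ d"
    by (subst sum.swap) (simp add: fps_sum_nth fps_mult_nth)
  finally show ?thesis .
qed

lemma fps_numeral_mult_nth: "(numeral k * f) $ n = numeral k * f $ n"
  for f :: "'a::comm_ring_1 fps"
  by (simp add: numeral_fps_const)

section \<open>Eisenstein series and sums of \<open>geo\<close> over the windows from -K to n +
  K\<close>

definition eis :: "int \<Rightarrow> nat \<Rightarrow> int fps" where
  "eis c k = Abs_fps (\<lambda>n. if n = 0 then 1 else c * int (divisor_sigma k n))"

text \<open>The second argument is the exponent of the divisor sum, one below the weight in the
  name.\<close>

abbreviation "E2 \<equiv> eis (- 24) 1"
abbreviation "E4 \<equiv> eis 240 3"
abbreviation "E6 \<equiv> eis (- 504) 5"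

lemma eis_nth: "eis c k $ d = (if d = 0 then 1 else c * int (divisor_sigma k d))"
  by (simp add: eis_def)

lemma geo_nth_below: "n < - int d \<Longrightarrow> geo n $ d = 0"
  using dvd_imp_le_int[of "int d" n] by (auto simp: geo_nth)

lemma geo_nth_0: "geo n $ 0 = (if n > 0 then 1 else 0)"
  by (auto simp: geo_nth)

text \<open>In degree \<open>d > 0\<close> only the divisors of \<open>d\<close> of either sign
  contribute, with their sign. Hence every window containing [-d, d] gives the same value, and only
  the odd part of \<open>f\<close> counts.\<close>

lemma sum_geo_nth:
  fixes f :: "int \<Rightarrow> int"
  assumes "d > 0" "finite S" "{- int d..int d} \<subseteq> S"
  shows "(\<Sum>a\<in>S. f a * geo a $ d) = (\<Sum>m | m dvd d. f (int m) - f (- int m))"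
proof -
  define D where "D = {m. m dvd d}"
  have D: "finite D" "\<And>m. m \<in> D \<Longrightarrow> m > 0" "\<And>m. m \<in> D \<Longrightarrow> m \<le> d"
    using assms(1) by (auto simp: D_def dest: dvd_imp_le intro: Nat.gr0I)
  have gD: "geo (int m) $ d = 1" "geo (- int m) $ d = - 1" if "m \<in> D" for m
    using that D(2)[OF that] assms(1) by (simp_all add: geo_nth D_def)
  have "(\<Sum>a\<in>S. f a * geo a $ d) = (\<Sum>a\<in>int ` D \<union> (\<lambda>m. - int m) ` D. f a * geo a $ d)"
  proof (rule sum.mono_neutral_right)
    show "int ` D \<union> (\<lambda>m. - int m) ` D \<subseteq> S" using D assms(3) by fastforce
    show "\<forall>a\<in>S - (int ` D \<union> (\<lambda>m. - int m) ` D). f a * geo a $ d = 0"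
    proof
      fix a assume a: "a \<in> S - (int ` D \<union> (\<lambda>m. - int m) ` D)"
      have "\<not> a dvd int d"
      proof
        assume "a dvd int d"
        hence "nat \<bar>a\<bar> \<in> D" by (simp add: D_def nat_abs_dvd_iff)
        moreover have "a = int (nat \<bar>a\<bar>) \<or> a = - int (nat \<bar>a\<bar>)" by linarith
        ultimately have "a \<in> int ` D \<union> (\<lambda>m. - int m) ` D" by (metis UnI1 UnI2 image_eqI)
        thus False using a by blast
      qed
      thus "f a * geo a $ d = 0" using assms(1) by (simp add: geo_nth)
    qed
  qed (use assms in auto)
  also have "\<dots> = (\<Sum>a\<in>int ` D. f a * geo a $ d) + (\<Sum>a\<in>(\<lambda>m. - int m) ` D. f a * geo a $ d)"
    using D by (intro sum.union_disjoint) force+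
  also have "(\<Sum>a\<in>int ` D. f a * geo a $ d) = (\<Sum>m\<in>D. f (int m))"
    by (subst sum.reindex) (auto simp: gD inj_on_def intro!: sum.cong)
  also have "(\<Sum>a\<in>(\<lambda>m. - int m) ` D. f a * geo a $ d) = (\<Sum>m\<in>D. - f (- int m))"
    by (subst sum.reindex) (auto simp: gD inj_on_def intro!: sum.cong)
  finally show ?thesis by (simp add: D_def sum_subtractf sum_negf)
qed

lemma sum_reflect_int:
  fixes g :: "int \<Rightarrow> 'a::comm_monoid_add"
  shows "(\<Sum>a=-K..n+K. g (n - a)) = (\<Sum>a=-K..n+K. g a)"
  by (rule sum.reindex_bij_witness[of _ "\<lambda>a. n - a" "\<lambda>a. n - a"]) auto

lemma sum_weight_geo_nth:
  fixes w :: "int \<Rightarrow> int"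
  assumes "\<And>a. w (n - a) = w a"
  shows "(\<Sum>a=-K..n+K. of_int (w a) * (geo a + geo (n - a) - 1)) $ d =
    2 * (\<Sum>a=-K..n+K. w a * geo a $ d) - (if d = 0 then \<Sum>a=-K..n+K. w a else 0)"
proof -
  have "(\<Sum>a=-K..n+K. w (n - a) * geo (n - a) $ d) = (\<Sum>a=-K..n+K. w a * geo a $ d)"
    by (rule sum_reflect_int)
  thus ?thesis
    by (auto simp: fps_sum_nth fps_mult_of_int_nth assms distrib_left right_diff_distrib sum.distrib
        sum_subtractf)
qed

lemma sum_int_split:
  fixes f :: "int \<Rightarrow> int"
  assumes "K \<ge> 0" "n + K \<ge> 0"
  shows "(\<Sum>a=-K..n+K. f a) = (\<Sum>a=-K..0. f a) + (\<Sum>a=1..n+K. f a)"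
proof -
  have "{-K..n+K} = {-K..0} \<union> {1..n+K}" using assms by auto
  thus ?thesis by (simp add: sum.union_disjoint)
qed

lemma six_sum_quadratic:
  fixes m n :: int
  assumes "m \<ge> 0"
  shows "6 * (\<Sum>a=1..m. a * (n - a)) = m * (m + 1) * (3 * n - 2 * m - 1)"
    and "6 * (\<Sum>a=-m..0. a * (n - a)) = - m * (m + 1) * (3 * n + 2 * m + 1)"
proof -
  show "6 * (\<Sum>a=1..m. a * (n - a)) = m * (m + 1) * (3 * n - 2 * m - 1)" using assms
  proof (induction m rule: int_ge_induct)
    case (step i)
    have "{1..i+1} = insert (i + 1) {1..i}" using step by auto
    thus ?case using step by (simp add: algebra_simps)
  qed simp
  show "6 * (\<Sum>a=-m..0. a * (n - a)) = - m * (m + 1) * (3 * n + 2 * m + 1)" using assms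
  proof (induction m rule: int_ge_induct)
    case (step i)
    have "{-(i+1)..0} = insert (-(i+1)) {-i..0}" using step by auto
    thus ?case using step by (simp add: algebra_simps)
  qed simp
qed

text \<open>A divergent sum regularized by the window. In degree 0 the parts
  \<open>a \<ge> 1\<close> and \<open>a \<le> 0\<close> cancel up to n^3 - n, whatever
  \<open>K\<close> is; in degree \<open>d > 0\<close> the odd part of a (n - a) is n a, which
  produces the divisor sum of \<open>E2\<close>. The slack in \<open>K\<close> lets one window serve
  all lower degrees as well.\<close>

lemma sum_quadratic_geo:
  assumes "K \<ge> int d + \<bar>n\<bar>"
  shows "6 * (\<Sum>a=-K..n+K. of_int (a * (n - a)) * (geo a + geo (n - a) - 1)) $ d =
    (of_int (n ^ 3) - of_int n * E2) $ d"
proof (cases "d = 0")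
  case True
  define w where "w = (\<lambda>a. a * (n - a))"
  have K: "K \<ge> 0" "n + K \<ge> 0" using assms True by auto
  have "(\<Sum>a=-K..n+K. w a * geo a $ 0) = (\<Sum>a=1..n+K. w a)"
    unfolding sum_int_split[OF K] by (simp add: geo_nth_0)
  hence "6 * (\<Sum>a=-K..n+K. of_int (w a) * (geo a + geo (n - a) - 1)) $ 0 =
     6 * (\<Sum>a=1..n+K. w a) - 6 * (\<Sum>a=-K..0. w a)"
    by (subst sum_weight_geo_nth) (use sum_int_split[OF K, of w] in \<open>auto simp: w_def mult.commute\<close>)
  also have "\<dots> = (n + K) * (n + K + 1) * (3 * n - 2 * (n + K) - 1) - (- K * (K + 1) * (3 * n + 2 * K + 1))"
    unfolding w_def using six_sum_quadratic K by presburger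
  also have "\<dots> = n ^ 3 - n" by (simp add: algebra_simps power3_eq_cube)
  finally show ?thesis using True
    by (simp add: w_def eis_nth del: of_int_power of_int_mult of_int_diff)
next
  case False
  define w where "w = (\<lambda>a. a * (n - a))"
  have "(\<Sum>a=-K..n+K. w a * geo a $ d) = (\<Sum>m | m dvd d. w (int m) - w (- int m))"
    using assms False by (intro sum_geo_nth) auto
  also have "\<dots> = (\<Sum>m | m dvd d. 2 * n * int m)" by (simp add: w_def algebra_simps)
  also have "\<dots> = 2 * n * int (divisor_sigma 1 d)" by (simp add: divisor_sigma_def sum_distrib_left)
  finally have "6 * (\<Sum>a=-K..n+K. of_int (w a) * (geo a + geo (n - a) - 1)) $ d =
     24 * n * int (divisor_sigma 1 d)"
    by (subst sum_weight_geo_nth) (use False in \<open>auto simp: w_def mult.commute\<close>)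
  thus ?thesis using False
    by (simp add: w_def eis_nth fps_mult_of_int_nth del: of_int_power of_int_mult of_int_diff)
qed

text \<open>A constant weight has no odd part, so only degree 0 contributes: the window has n + K
  positive and K + 1 nonpositive members.\<close>

lemma sum_const_geo:
  assumes "K \<ge> int d + \<bar>n\<bar>"
  shows "(\<Sum>a=-K..n+K. geo a + geo (n - a) - 1) $ d = (of_int (n - 1) :: int fps) $ d"
proof (cases "d = 0")
  case True
  have K: "K \<ge> 0" "n + K \<ge> 0" using assms True by auto
  have "(\<Sum>a=-K..n+K. 1 * geo a $ 0) = n + K"
    unfolding sum_int_split[OF K] using K by (simp add: geo_nth_0)
  thus ?thesis using sum_weight_geo_nth[of "\<lambda>_. 1" n K 0] K True by simp
next
  case False
  have "(\<Sum>a=-K..n+K. 1 * geo a $ d) = 0"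
  proof -
    have "int d \<le> K" "int d \<le> n + K" using assms by linarith+
    thus ?thesis using sum_geo_nth[of d "{-K..n+K}" "\<lambda>_. 1"] False by simp
  qed
  thus ?thesis using sum_weight_geo_nth[of "\<lambda>_. 1" n K d] False by simp
qed

text \<open>
  With \<open>D = u d/du\<close>, these are the expansions in \<open>\<bar>q\<bar> < \<bar>u\<bar> < 1\<close> of \<open>36 \<wp> / (2 \<pi> i)\<^sup>2\<close> and of the function
  \<open>1 + 2 \<Sum>\<^bsub>n\<noteq>0\<^esub> u\<^sup>n / (1 - q\<^sup>n)\<close>, whose \<open>D\<close>-derivative is \<open>(wp - 3 E2) / 18\<close>.
\<close>
definition wp :: "int fls fps" where
  "wp = of_rows (\<lambda>n. if n = 0 then 3 * E2 else 36 * of_int n * geo n)"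

definition wzeta :: "int fls fps" where
  "wzeta = of_rows (\<lambda>n. if n = 0 then 1 else 2 * geo n)"

lemma row_wp: "row n wp = (if n = 0 then 3 * E2 else 36 * of_int n * geo n)"
  and tame_wp: "tame wp"
proof -
  have "(36 * of_int n * geo n) $ d = 0" if "n < - int d" for n d
  proof -
    have "(36 * of_int n * geo n) $ d = 36 * (n * geo n $ d)"
      by (simp add: mult.assoc fps_mult_of_int_nth fps_numeral_mult_nth)
    thus ?thesis using geo_nth_below[OF that] by simp
  qed
  thus "row n wp = (if n = 0 then 3 * E2 else 36 * of_int n * geo n)" "tame wp"
    unfolding wp_def by (subst row_of_rows; auto)+
qed

lemma row_wzeta: "row n wzeta = (if n = 0 then 1 else 2 * geo n)"
  and tame_wzeta: "tame wzeta"
proof -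
  have "(2 * geo n) $ d = 0" if "n < - int d" for n d
    using geo_nth_below[OF that] by (simp add: fps_numeral_mult_nth)
  thus "row n wzeta = (if n = 0 then 1 else 2 * geo n)" "tame wzeta"
    unfolding wzeta_def by (subst row_of_rows; auto)+
qed

text \<open>The terms \<open>a = 0\<close> and \<open>a = n\<close>, to which
  \<open>geo_mult\<close> does not apply, contribute 216 n E2 geo n. This cancels the
  \<open>E2\<close> term of \<open>sum_quadratic_geo\<close>; what remains is 6 n^2 times row
  \<open>n\<close> of \<open>wp\<close>.\<close>

lemma row_wp_square:
  assumes n: "n \<noteq> 0"
  shows "row n (wp * wp) = 216 * of_int (n ^ 3) * geo n"
proof (rule fps_ext)
  fix d
  define K where "K = int d + \<bar>n\<bar>"
  define S where "S = {-K..n+K}"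
  define B where "B = (\<Sum>a\<in>S. of_int (a * (n - a)) * (geo a + geo (n - a) - 1))"
  have S: "finite S" "0 \<in> S" "n \<in> S" by (auto simp: S_def K_def)
  have "(\<Sum>a\<in>S. row a wp * row (n - a) wp) =
      (\<Sum>a\<in>{0, n}. row a wp * row (n - a) wp) + (\<Sum>a\<in>S - {0, n}. row a wp * row (n - a) wp)"
    using S by (subst sum.subset_diff[of "{0, n}" S]) (simp_all add: add.commute)
  also have "(\<Sum>a\<in>{0, n}. row a wp * row (n - a) wp) = 216 * of_int n * E2 * geo n"
    using n by (simp add: row_wp algebra_simps)
  also have "(\<Sum>a\<in>S - {0, n}. row a wp * row (n - a) wp) =
      (\<Sum>a\<in>S - {0, n}. 1296 * geo n * (of_int (a * (n - a)) * (geo a + geo (n - a) - 1)))"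
  proof (rule sum.cong)
    fix a assume "a \<in> S - {0, n}"
    hence a: "a \<noteq> 0" "n \<noteq> a" by auto
    have "row a wp * row (n - a) wp = 1296 * of_int (a * (n - a)) * (geo a * geo (n - a))"
      using a by (simp add: row_wp algebra_simps)
    thus "row a wp * row (n - a) wp = 1296 * geo n * (of_int (a * (n - a)) * (geo a + geo (n - a) - 1))"
      unfolding geo_mult[OF n a] by (simp only: mult_ac)
  qed simp
  \<comment> \<open>The weight a (n - a) vanishes at the two excluded indices, so they may be put
    back.\<close>
  also have "\<dots> = (\<Sum>a\<in>S. 1296 * geo n * (of_int (a * (n - a)) * (geo a + geo (n - a) - 1)))"
    using S by (intro sum.mono_neutral_left) auto
  also have "\<dots> = 1296 * geo n * B" unfolding B_def by (simp only: sum_distrib_left)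
  also have "\<dots> = 216 * (geo n * (6 * B))" by simp
  finally have "row n (wp * wp) $ d = (216 * of_int n * E2 * geo n + 216 * (geo n * (6 * B))) $ d"
    using row_mult_nth[OF tame_wp tame_wp, of d K n] by (simp add: K_def S_def)
  moreover have "(geo n * (6 * B)) $ d = (geo n * (of_int (n ^ 3) - of_int n * E2)) $ d"
    unfolding fps_mult_nth[of "geo n"]
  proof (intro sum.cong refl)
    fix i assume "i \<in> {0..d}"
    thus "geo n $ i * (6 * B) $ (d - i) = geo n $ i * (of_int (n ^ 3) - of_int n * E2) $ (d - i)"
      using sum_quadratic_geo[of "d - i" n K] by (simp add: B_def S_def K_def fps_numeral_mult_nth)
  qed
  ultimately have "row n (wp * wp) $ d =
      (216 * of_int n * E2 * geo n + 216 * (geo n * (of_int (n ^ 3) - of_int n * E2))) $ d"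
    by (simp only: fps_add_nth fps_numeral_mult_nth)
  also have "216 * of_int n * E2 * geo n + 216 * (geo n * (of_int (n ^ 3) - of_int n * E2)) =
      216 * of_int (n ^ 3) * geo n"
    by (simp add: algebra_simps)
  finally show "row n (wp * wp) $ d = (216 * of_int (n ^ 3) * geo n) $ d" .
qed

lemma row_wzeta_square:
  assumes n: "n \<noteq> 0"
  shows "row n (wzeta * wzeta) = 4 * of_int n * geo n + 8 * (geo n - geo n ^ 2)"
proof (rule fps_ext)
  fix d
  define K where "K = int d + \<bar>n\<bar>"
  define S where "S = {-K..n+K}"
  define B where "B = (\<Sum>a\<in>S. geo a + geo (n - a) - 1)"
  have S: "finite S" "0 \<in> S" "n \<in> S" by (auto simp: S_def K_def)
  have split: "(\<Sum>a\<in>S. h a) = h 0 + h n + (\<Sum>a\<in>S - {0, n}. h a)" for h :: "int \<Rightarrow> int fps"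
    using S n by (simp add: sum.remove[of S 0] sum.remove[of "S - {0}" n] Diff_insert2[symmetric]
        insert_commute add.assoc)
  have "(\<Sum>a\<in>S - {0, n}. row a wzeta * row (n - a) wzeta) =
      (\<Sum>a\<in>S - {0, n}. 4 * geo n * (geo a + geo (n - a) - 1))"
  proof (rule sum.cong)
    fix a assume "a \<in> S - {0, n}"
    hence a: "a \<noteq> 0" "n \<noteq> a" by auto
    have "row a wzeta * row (n - a) wzeta = 4 * (geo a * geo (n - a))"
      using a by (simp add: row_wzeta algebra_simps)
    thus "row a wzeta * row (n - a) wzeta = 4 * geo n * (geo a + geo (n - a) - 1)"
      unfolding geo_mult[OF n a] by (simp only: mult_ac)
  qed simp
  \<comment> \<open>Here the weight does not vanish at the excluded indices: with the convention
    \<open>geo 0 = 0\<close> the summands at 0 and at \<open>n\<close> both equal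
    \<open>geo n - 1\<close>.\<close>
  also have "\<dots> = 4 * geo n * (B - 2 * (geo n - 1))"
    using split[of "\<lambda>a. geo a + geo (n - a) - 1"] unfolding B_def
    by (simp add: sum_distrib_left algebra_simps)
  finally have "(\<Sum>a\<in>S. row a wzeta * row (n - a) wzeta) = 4 * geo n + 4 * geo n * (B - 2 * (geo n - 1))"
    using n by (subst split) (simp add: row_wzeta)
  also have "\<dots> = 12 * geo n - 8 * geo n ^ 2 + 4 * (geo n * B)"
    by (simp add: algebra_simps power2_eq_square)
  finally have "row n (wzeta * wzeta) $ d = (12 * geo n - 8 * geo n ^ 2 + 4 * (geo n * B)) $ d"
    using row_mult_nth[OF tame_wzeta tame_wzeta, of d K n] by (simp only: S_def) (simp add: K_def)
  moreover have "(geo n * B) $ d = (geo n * of_int (n - 1)) $ d"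
    unfolding fps_mult_nth[of "geo n"]
  proof (intro sum.cong refl)
    fix i assume "i \<in> {0..d}"
    thus "geo n $ i * B $ (d - i) = geo n $ i * of_int (n - 1) $ (d - i)"
      using sum_const_geo[where d = "d - i" and n = n and K = K]
      by (simp add: B_def S_def K_def del: of_int_diff)
  qed
  ultimately have "row n (wzeta * wzeta) $ d =
      (12 * geo n - 8 * geo n ^ 2 + 4 * (geo n * of_int (n - 1))) $ d"
    by (simp add: fps_numeral_mult_nth)
  thus "row n (wzeta * wzeta) $ d = (4 * of_int n * geo n + 8 * (geo n - geo n ^ 2)) $ d"
    by (simp add: algebra_simps)
qed

text \<open>After multiplication by \<open>n\<close> the square of \<open>geo n\<close> becomes a
  derivative by \<open>theta_geo\<close>, and \<open>theta\<close> acts in degree \<open>d\<close>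
  as the factor \<open>d\<close>. This factor is the source of the derivatives in the relations for
  E4 and E6.\<close>

lemma row_wzeta_square_nth:
  "n * row n (wzeta * wzeta) $ d = (4 * n ^ 2 - 8 * int d) * geo n $ d"
proof (cases "n = 0")
  case False
  have "of_int n * row n (wzeta * wzeta) = 4 * (of_int (n ^ 2) * geo n) - 8 * theta (geo n)"
    unfolding row_wzeta_square[OF False] theta_geo by (simp add: algebra_simps power2_eq_square)
  hence "(of_int n * row n (wzeta * wzeta)) $ d = (4 * (of_int (n ^ 2) * geo n) - 8 * theta (geo n)) $ d"
    by simp
  thus ?thesis
    unfolding fps_mult_of_int_nth fps_sub_nth fps_numeral_mult_nth theta_nth
    by (simp add: algebra_simps)
qed simp

text \<open>Rows \<open>a\<close> and \<open>-a\<close> multiply to 1296 a^4 geo a (1 - geo a),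
  which \<open>theta_geo\<close> turns into -1296 a^3 theta (geo a). The value fixes the constant of
  integration in the Weierstrass equation.\<close>

lemma row_0_dlog_u_wp_square:
  "row 0 (dlog_u wp * dlog_u wp) $ d = - 2592 * int d * int (divisor_sigma 3 d)"
proof -
  have "row 0 (dlog_u wp * dlog_u wp) $ d =
      (\<Sum>a=-int d..int d. row a (dlog_u wp) * row (- a) (dlog_u wp)) $ d"
    using row_mult_nth[of "dlog_u wp" "dlog_u wp" d "int d" 0] tame_dlog_u[OF tame_wp] by simp
  also have "\<dots> = (\<Sum>a=-int d..int d. of_int (- 1296 * a ^ 3) * theta (geo a)) $ d"
  proof (intro arg_cong[where f = "\<lambda>f. f $ d"] sum.cong refl)
    fix a
    show "row a (dlog_u wp) * row (- a) (dlog_u wp) = of_int (- 1296 * a ^ 3) * theta (geo a)"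
      by (cases "a = 0")
        (simp_all add: row_dlog_u row_wp theta_geo geo_uminus algebra_simps power2_eq_square power3_eq_cube)
  qed
  also have "\<dots> = - 1296 * int d * (\<Sum>a=-int d..int d. a ^ 3 * geo a $ d)"
    unfolding fps_sum_nth fps_mult_of_int_nth theta_nth sum_distrib_left
    by (intro sum.cong) (simp_all add: mult_ac)
  also have "\<dots> = - 2592 * int d * int (divisor_sigma 3 d)"
  proof (cases "d = 0")
    case False
    thus ?thesis
      using sum_geo_nth[of d "{-int d..int d}" "\<lambda>a. a ^ 3"]
      by (simp add: divisor_sigma_def sum.distrib sum_distrib_left mult.assoc)
  qed simp
  finally show ?thesis .
qed

text \<open>
  For a Laurent polynomial \<open>f = \<Sum> f\<^sub>n u\<^sup>n\<close> and \<open>h n = n\<^sup>s\<close> this is the \<open>s\<close>-th Taylor coefficient, up to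
  \<open>s!\<close>, of \<open>f (exp t)\<close> at \<open>t = 0\<close>. Taking moments of the squares of \<open>wp\<close> and \<open>wzeta\<close> yields the
  convolution identities between divisor sums that express the relations among \<open>E2\<close>, \<open>E4\<close> and \<open>E6\<close>.
\<close>
definition moment :: "int \<Rightarrow> (int \<Rightarrow> int) \<Rightarrow> int fls \<Rightarrow> int" where
  "moment B h f = (\<Sum>n=-B..B. h n * f $$ n)"

definition upow :: "int \<Rightarrow> int fls" where "upow j = fls_X_intpow j"

lemma upow_nth: "upow j $$ n = (if n = j then 1 else 0)"
  by (auto simp: upow_def)

lemma mult_upow_nth: "(f * upow j) $$ n = f $$ (n - j)"
  by (simp add: upow_def fls_X_intpow_times_conv_shift)

lemma upow_mult_upow: "upow i * upow j = upow (i + j)"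
  unfolding upow_def by (rule fls_X_intpow_times_fls_X_intpow)

lemma moment_add: "moment B h (f + g) = moment B h f + moment B h g"
  and moment_diff: "moment B h (f - g) = moment B h f - moment B h g"
  and moment_of_int_mult: "moment B h (of_int c * f) = c * moment B h f"
  and moment_sum: "moment B h (\<Sum>i\<in>S. F i) = (\<Sum>i\<in>S. moment B h (F i))"
proof -
  show "moment B h (of_int c * f) = c * moment B h f"
    by (simp add: moment_def sum_distrib_left mult_ac fls_of_int)
  show "moment B h (\<Sum>i\<in>S. F i) = (\<Sum>i\<in>S. moment B h (F i))"
    unfolding moment_def fls_nth_sum sum_distrib_left by (rule sum.swap)
qed (simp_all add: moment_def distrib_left right_diff_distrib sum.distrib sum_subtractf)

lemma moment_numeral_mult: "moment B h (numeral k * f) = numeral k * moment B h f"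
  using moment_of_int_mult[of B h "numeral k" f] by simp

lemma moment_upow:
  assumes "\<bar>j\<bar> \<le> B"
  shows "moment B h (upow j) = h j"
proof -
  have "moment B h (upow j) = (\<Sum>n=-B..B. if n = j then h n else 0)"
    unfolding moment_def upow_nth by (intro sum.cong) auto
  thus ?thesis using assms by (auto simp: abs_le_iff)
qed

text \<open>The building blocks of the coefficients of \<open>wp\<close> and \<open>wzeta\<close> at
  q^d for \<open>d > 0\<close>. At u = 1 they vanish to order 2 and 1, enough to cancel the poles
  there of 3 + 36 u / (1 - u)^2 and (1 + u) / (1 - u), whose expansions are \<open>wp $ 0\<close>
  and \<open>wzeta $ 0\<close>.\<close>

definition bump :: "int \<Rightarrow> int fls" where "bump m = upow m + upow (- m) - 2 * upow 0"
definition odd_bump :: "int \<Rightarrow> int fls" where "odd_bump m = upow m - upow (- m)"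

lemma moment_bump:
  assumes "\<bar>m\<bar> \<le> B" "\<And>n. h (- n) = h n"
  shows "moment B h (bump m) = 2 * h m - 2 * h 0"
  using assms by (simp add: bump_def moment_add moment_diff moment_numeral_mult moment_upow)

lemma moment_bump_mult:
  assumes "\<bar>m\<bar> + \<bar>l\<bar> \<le> B" "\<And>n. h (- n) = h n"
  shows "moment B h (bump m * bump l) = 2 * h (m + l) + 2 * h (m - l) - 4 * h m - 4 * h l + 4 * h 0"
proof -
  have "bump m * bump l = upow m * upow l + upow m * upow (-l) + upow (-m) * upow l + upow (-m) * upow (-l)
     - 2 * (upow m * upow 0 + upow (-m) * upow 0 + upow 0 * upow l + upow 0 * upow (-l))
     + 4 * (upow 0 * upow 0)"
    unfolding bump_def by (simp only: algebra_simps) simp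
  also have "\<dots> = upow (m + l) + upow (m - l) + upow (-m + l) + upow (-m - l)
     - 2 * (upow m + upow (-m) + upow l + upow (-l)) + 4 * upow 0"
    unfolding upow_mult_upow by (simp)
  finally have "moment B h (bump m * bump l) = h (m + l) + h (m - l) + h (- m + l) + h (- m - l)
     - 2 * (h m + h (-m) + h l + h (-l)) + 4 * h 0"
    using assms(1)
    by (simp add: moment_add moment_diff moment_numeral_mult moment_upow)
  moreover have "h (- m + l) = h (m - l)" "h (- m - l) = h (m + l)"
    using assms(2)[of "m - l"] assms(2)[of "m + l"] by simp_all
  ultimately show ?thesis using assms(2) by simp
qed

lemma moment_odd_bump_mult:
  assumes "\<bar>m\<bar> + \<bar>l\<bar> \<le> B" "\<And>n. h (- n) = h n"
  shows "moment B h (odd_bump m * odd_bump l) = 2 * h (m + l) - 2 * h (m - l)"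
proof -
  have "odd_bump m * odd_bump l =
      upow m * upow l - upow m * upow (-l) - upow (-m) * upow l + upow (-m) * upow (-l)"
    unfolding odd_bump_def by (simp only: algebra_simps)
  also have "\<dots> = upow (m + l) - upow (m - l) - upow (-m + l) + upow (-m - l)"
    unfolding upow_mult_upow by simp
  finally have "moment B h (odd_bump m * odd_bump l) = h (m + l) - h (m - l) - h (- m + l) + h (- m - l)"
    using assms(1) by (simp add: moment_add moment_diff moment_upow)
  moreover have "h (- m + l) = h (m - l)" "h (- m - l) = h (m + l)"
    using assms(2)[of "m - l"] assms(2)[of "m + l"] by simp_all
  ultimately show ?thesis by simp
qed

lemma sum_divisor_delta:
  fixes c :: "nat \<Rightarrow> int"
  assumes "d > 0"
  shows "(\<Sum>m | m dvd d. c m * (if n = int m then 1 else 0)) = (if n > 0 \<and> n dvd int d then c (nat n) else 0)"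
proof -
  have fin: "finite {m. m dvd d}" using assms by simp
  have "(\<Sum>m | m dvd d. c m * (if n = int m then 1 else 0)) =
      (\<Sum>m | m dvd d. if m = nat n \<and> n > 0 then c m else 0)"
    using assms by (intro sum.cong) (auto intro: Nat.gr0I)
  also have "\<dots> = (if n > 0 \<and> n dvd int d then c (nat n) else 0)"
    using fin by (cases "n > 0") (auto simp: nat_dvd_iff)
  finally show ?thesis .
qed

lemma wp_nth_pos:
  assumes "d > 0"
  shows "wp $ d = (\<Sum>m | m dvd d. of_int (36 * int m) * bump (int m))"
proof (rule fls_eqI)
  fix n
  have "(\<Sum>m | m dvd d. of_int (36 * int m) * bump (int m)) $$ n =
     (\<Sum>m | m dvd d. 36 * int m * (if n = int m then 1 else 0)) +
     (\<Sum>m | m dvd d. 36 * int m * (if - n = int m then 1 else 0)) -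
     (\<Sum>m | m dvd d. 72 * int m * (if n = 0 then 1 else 0))"
    unfolding fls_nth_sum sum.distrib[symmetric] sum_subtractf[symmetric]
    by (intro sum.cong) (auto simp: bump_def fls_of_int upow_nth simp del: of_int_mult)
  also have "\<dots> = row n wp $ d"
    using assms unfolding sum_divisor_delta[OF assms]
    by (auto simp: row_wp eis_nth geo_nth divisor_sigma_def sum_distrib_left fps_numeral_mult_nth
        mult.assoc sum_negf)
  finally show "wp $ d $$ n = (\<Sum>m | m dvd d. of_int (36 * int m) * bump (int m)) $$ n" by simp
qed

lemma wzeta_nth_pos:
  assumes "d > 0"
  shows "wzeta $ d = (\<Sum>m | m dvd d. 2 * odd_bump (int m))"
proof (rule fls_eqI)
  fix n
  have "(\<Sum>m | m dvd d. 2 * odd_bump (int m)) $$ n =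
     (\<Sum>m | m dvd d. 2 * (if n = int m then 1 else 0)) -
     (\<Sum>m | m dvd d. 2 * (if - n = int m then 1 else 0))"
    unfolding fls_nth_sum sum_subtractf[symmetric]
    by (intro sum.cong) (auto simp: odd_bump_def upow_nth)
  also have "\<dots> = row n wzeta $ d"
    using assms unfolding sum_divisor_delta[OF assms, of "\<lambda>_. 2"]
    by (auto simp: row_wzeta geo_nth fps_numeral_mult_nth)
  finally show "wzeta $ d $$ n = (\<Sum>m | m dvd d. 2 * odd_bump (int m)) $$ n" by simp
qed

lemma wp_0_nth: "wp $ 0 $$ n = (if n = 0 then 3 else if n > 0 then 36 * n else 0)"
proof -
  have "wp $ 0 $$ n = row n wp $ 0" by simp
  also have "\<dots> = (if n = 0 then 3 else if n > 0 then 36 * n else 0)"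
    unfolding row_wp by (simp add: eis_nth geo_nth_0 fps_numeral_mult_nth mult.assoc)
  finally show ?thesis .
qed

lemma wzeta_0_nth: "wzeta $ 0 $$ n = (if n = 0 then 1 else if n > 0 then 2 else 0)"
proof -
  have "wzeta $ 0 $$ n = row n wzeta $ 0" by simp
  also have "\<dots> = (if n = 0 then 1 else if n > 0 then 2 else 0)"
    unfolding row_wzeta by (simp add: geo_nth_0 fps_numeral_mult_nth)
  finally show ?thesis .
qed

lemma sum_upow_nth: "(\<Sum>j=-m..m. of_int (c j) * upow j) $$ n = (if \<bar>n\<bar> \<le> m then c n else 0)"
proof -
  have "(\<Sum>j=-m..m. of_int (c j) * upow j) $$ n = (\<Sum>j=-m..m. if j = n then c j else 0)"
    unfolding fls_nth_sum by (intro sum.cong) (auto simp: fls_of_int upow_nth)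
  thus ?thesis by auto
qed

text \<open>Since \<open>bump m\<close> is u^(-m) (1 - u^m)^2, its product with u / (1 - u)^2 is the
  Fejer kernel.\<close>

lemma wp_0_bump:
  assumes "m \<ge> 0"
  shows "wp $ 0 * bump m = 3 * bump m + 36 * (\<Sum>j=-m..m. of_int (m - \<bar>j\<bar>) * upow j)"
proof (rule fls_eqI)
  fix n
  have "(wp $ 0 * bump m) $$ n = wp $ 0 $$ (n - m) + wp $ 0 $$ (n + m) - 2 * (wp $ 0 $$ n)"
    unfolding bump_def distrib_left right_diff_distrib mult.left_commute[of _ 2]
    by (simp add: mult_upow_nth)
  thus "(wp $ 0 * bump m) $$ n =
      (3 * bump m + 36 * (\<Sum>j=-m..m. of_int (m - \<bar>j\<bar>) * upow j)) $$ n"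
    using assms
    by (auto simp: wp_0_nth sum_upow_nth bump_def upow_nth simp del: of_int_diff)
qed

text \<open>The product of (1 + u) / (1 - u) with u^m - u^(-m) is minus twice the Dirichlet kernel,
  with halved end terms.\<close>

lemma wzeta_0_odd_bump:
  assumes "m \<ge> 0"
  shows "wzeta $ 0 * odd_bump m = - (2 * (\<Sum>j=-m..m. upow j)) + upow m + upow (- m)"
proof (rule fls_eqI)
  fix n
  have "(wzeta $ 0 * odd_bump m) $$ n = wzeta $ 0 $$ (n - m) - wzeta $ 0 $$ (n + m)"
    unfolding odd_bump_def right_diff_distrib by (simp add: mult_upow_nth)
  thus "(wzeta $ 0 * odd_bump m) $$ n = (- (2 * (\<Sum>j=-m..m. upow j)) + upow m + upow (- m)) $$ n"
    using assms sum_upow_nth[of "\<lambda>_. 1" m n] by (auto simp: wzeta_0_nth upow_nth)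
qed

lemma square_nth:
  fixes F :: "'a::comm_ring_1 fps"
  assumes "d > 0"
  shows "(F * F) $ d = 2 * (F $ 0 * F $ d) + (\<Sum>i=1..<d. F $ i * F $ (d - i))"
proof -
  have "{0..d} = insert 0 (insert d {1..<d})" using assms by auto
  thus ?thesis using assms by (simp add: fps_mult_nth algebra_simps)
qed

lemma dvd_imp_int_le: "m dvd (d :: nat) \<Longrightarrow> d > 0 \<Longrightarrow> int m \<le> int d"
  by (simp add: dvd_imp_le)

definition pair_sum :: "(nat \<Rightarrow> nat \<Rightarrow> int) \<Rightarrow> nat \<Rightarrow> int" where
  "pair_sum g d = (\<Sum>i=1..<d. \<Sum>m | m dvd i. \<Sum>l | l dvd d - i. g m l)"

text \<open>The moment of the coefficient of q^d in the square of \<open>wp\<close>, computed twice: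
  on the left by convolution in q, on the right from the rows. Row 0 stays as an unknown; it is
  found from the weight \<open>h = 1\<close> and drops out when \<open>h 0 = 0\<close>.\<close>

lemma moment_wp_square:
  assumes d: "d > 0" and h: "\<And>n. h (- n) = h n"
  shows "432 * (\<Sum>m | m dvd d. int m * (h (int m) - h 0))
     + 2592 * (\<Sum>m | m dvd d. int m * (\<Sum>j=-int m..int m. (int m - \<bar>j\<bar>) * h j))
     + 1296 * pair_sum (\<lambda>m l. int m * int l * (2 * h (int m + int l) + 2 * h (int m - int l)
          - 4 * h (int m) - 4 * h (int l) + 4 * h 0)) d
   = h 0 * row 0 (wp * wp) $ d + 432 * (\<Sum>m | m dvd d. int m ^ 3 * h (int m))" (is "?L = ?R")
proof -
  define B where "B = int d"
  have le: "int m \<le> B" if "m dvd d" for m using dvd_imp_int_le[OF that d] by (simp add: B_def)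
  have "moment B h (wp $ 0 * wp $ d) =
      (\<Sum>m | m dvd d. 36 * int m * moment B h (wp $ 0 * bump (int m)))"
    unfolding wp_nth_pos[OF d] sum_distrib_left moment_sum mult.left_commute[of _ "of_int _"]
      moment_of_int_mult ..
  also have "\<dots> = (\<Sum>m | m dvd d. 36 * int m * (3 * (2 * h (int m) - 2 * h 0) +
      36 * (\<Sum>j=-int m..int m. (int m - \<bar>j\<bar>) * h j)))"
  proof (intro sum.cong refl)
    fix m assume "m \<in> {m. m dvd d}"
    hence m: "int m \<le> B" using le by simp
    have "moment B h (\<Sum>j=-int m..int m. of_int (int m - \<bar>j\<bar>) * upow j) =
        (\<Sum>j=-int m..int m. (int m - \<bar>j\<bar>) * h j)"
      unfolding moment_sum moment_of_int_mult using m by (intro sum.cong refl) (auto simp: moment_upow abs_le_iff)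
    thus "36 * int m * moment B h (wp $ 0 * bump (int m)) = 36 * int m * (3 * (2 * h (int m) - 2 * h 0) +
      36 * (\<Sum>j=-int m..int m. (int m - \<bar>j\<bar>) * h j))"
      using m h by (simp only: wp_0_bump of_nat_0_le_iff moment_add moment_numeral_mult) (simp add: moment_bump)
  qed
  finally have 1: "moment B h (wp $ 0 * wp $ d) = 216 * (\<Sum>m | m dvd d. int m * (h (int m) - h 0))
     + 1296 * (\<Sum>m | m dvd d. int m * (\<Sum>j=-int m..int m. (int m - \<bar>j\<bar>) * h j))"
    by (simp add: sum_distrib_left sum.distrib[symmetric] algebra_simps)
  have "moment B h (\<Sum>i=1..<d. wp $ i * wp $ (d - i)) =
     (\<Sum>i=1..<d. moment B h (wp $ i * wp $ (d - i)))" by (rule moment_sum)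
  also have "\<dots> = (\<Sum>i=1..<d. \<Sum>m | m dvd i. \<Sum>l | l dvd d - i. 1296 * (int m * int l *
     (2 * h (int m + int l) + 2 * h (int m - int l) - 4 * h (int m) - 4 * h (int l) + 4 * h 0)))"
  proof (intro sum.cong refl)
    fix i assume "i \<in> {1..<d}"
    hence i: "i > 0" "d - i > 0" "i < d" by auto
    have "wp $ i * wp $ (d - i) = (\<Sum>m | m dvd i. \<Sum>l | l dvd d - i.
        of_int (1296 * int m * int l) * (bump (int m) * bump (int l)))"
      unfolding wp_nth_pos[OF i(1)] wp_nth_pos[OF i(2)] sum_product
      by (intro sum.cong refl) (simp add: mult_ac)
    hence "moment B h (wp $ i * wp $ (d - i)) = (\<Sum>m | m dvd i. \<Sum>l | l dvd d - i.
        1296 * int m * int l * moment B h (bump (int m) * bump (int l)))"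
      by (simp only: moment_sum moment_of_int_mult)
    also have "\<dots> = (\<Sum>m | m dvd i. \<Sum>l | l dvd d - i. 1296 * (int m * int l *
       (2 * h (int m + int l) + 2 * h (int m - int l) - 4 * h (int m) - 4 * h (int l) + 4 * h 0)))"
    proof (intro sum.cong refl)
      fix m l assume "m \<in> {m. m dvd i}" "l \<in> {l. l dvd d - i}"
      hence "m \<le> i" "l \<le> d - i" using i by (auto dest: dvd_imp_le)
      hence "\<bar>int m\<bar> + \<bar>int l\<bar> \<le> B" using i by (simp add: B_def)
      thus "1296 * int m * int l * moment B h (bump (int m) * bump (int l)) = 1296 * (int m * int l *
         (2 * h (int m + int l) + 2 * h (int m - int l) - 4 * h (int m) - 4 * h (int l) + 4 * h 0))"
        using h by (simp only: moment_bump_mult mult.assoc)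
    qed
    finally show "moment B h (wp $ i * wp $ (d - i)) = \<dots>" .
  qed
  also have "\<dots> = 1296 * pair_sum (\<lambda>m l. int m * int l * (2 * h (int m + int l) + 2 * h (int m - int l)
          - 4 * h (int m) - 4 * h (int l) + 4 * h 0)) d"
    unfolding pair_sum_def sum_distrib_left ..
  finally have "?L = moment B h ((wp * wp) $ d)"
    using 1 by (simp add: square_nth[OF d] moment_add moment_numeral_mult)
  also have "\<dots> = (\<Sum>n=-B..B. (if n = 0 then h 0 * row 0 (wp * wp) $ d else 0) + 216 * n ^ 3 * h n * geo n $ d)"
    unfolding moment_def
  proof (intro sum.cong refl)
    fix n
    show "h n * (wp * wp) $ d $$ n =
       (if n = 0 then h 0 * row 0 (wp * wp) $ d else 0) + 216 * n ^ 3 * h n * geo n $ d"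
    proof (cases "n = 0")
      case False
      have "(wp * wp) $ d $$ n = row n (wp * wp) $ d" by simp
      also have "\<dots> = 216 * (n ^ 3 * geo n $ d)"
        unfolding row_wp_square[OF False] mult.assoc fps_numeral_mult_nth fps_mult_of_int_nth by simp
      finally show ?thesis using False by simp
    qed simp
  qed
  also have "\<dots> = h 0 * row 0 (wp * wp) $ d + (\<Sum>n=-B..B. 216 * n ^ 3 * h n * geo n $ d)"
    unfolding sum.distrib by (simp add: B_def)
  also have "(\<Sum>n=-B..B. 216 * n ^ 3 * h n * geo n $ d) = 432 * (\<Sum>m | m dvd d. int m ^ 3 * h (int m))"
    using sum_geo_nth[of d "{-B..B}" "\<lambda>n. 216 * n ^ 3 * h n"] d h
    by (simp add: B_def sum_distrib_left mult_ac)
  finally show ?thesis .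
qed

text \<open>The same double computation for \<open>wzeta\<close>. The weight has the form n g(n)
  because \<open>row_wzeta_square_nth\<close> gives the rows only after multiplication by
  \<open>n\<close>; row 0 then never appears.\<close>

lemma moment_wzeta_square:
  assumes d: "d > 0" and g: "\<And>n. g (- n) = - g n"
  defines "h \<equiv> \<lambda>n. n * g n"
  shows "8 * (\<Sum>m | m dvd d. h (int m) - (\<Sum>j=-int m..int m. h j))
     + 4 * pair_sum (\<lambda>m l. 2 * h (int m + int l) - 2 * h (int m - int l)) d
   = 8 * (\<Sum>m | m dvd d. g (int m) * (int m ^ 2 - 2 * int d))" (is "?L = ?R")
proof -
  define B where "B = int d"
  have h: "h (- n) = h n" for n by (simp add: h_def g)
  have le: "int m \<le> B" if "m dvd d" for m using dvd_imp_int_le[OF that d] by (simp add: B_def)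
  have "moment B h (wzeta $ 0 * wzeta $ d) = (\<Sum>m | m dvd d. 2 * moment B h (wzeta $ 0 * odd_bump (int m)))"
    unfolding wzeta_nth_pos[OF d] sum_distrib_left moment_sum mult.left_commute[of _ 2]
      moment_numeral_mult ..
  also have "\<dots> = (\<Sum>m | m dvd d. 4 * (h (int m) - (\<Sum>j=-int m..int m. h j)))"
  proof (intro sum.cong refl)
    fix m assume "m \<in> {m. m dvd d}"
    hence m: "int m \<le> B" using le by simp
    have "moment B h (\<Sum>j=-int m..int m. upow j) = (\<Sum>j=-int m..int m. h j)"
      unfolding moment_sum using m by (intro sum.cong refl) (auto simp: moment_upow abs_le_iff)
    moreover have "wzeta $ 0 * odd_bump (int m) =
        upow (int m) + upow (- int m) - 2 * (\<Sum>j=-int m..int m. upow j)"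
      by (simp add: wzeta_0_odd_bump)
    ultimately show "2 * moment B h (wzeta $ 0 * odd_bump (int m)) = 4 * (h (int m) - (\<Sum>j=-int m..int m. h j))"
      using m h by (simp add: moment_add moment_diff moment_numeral_mult moment_upow)
  qed
  finally have 1: "moment B h (wzeta $ 0 * wzeta $ d) = 4 * (\<Sum>m | m dvd d. h (int m) - (\<Sum>j=-int m..int m. h j))"
    by (simp only: sum_distrib_left)
  have "moment B h (\<Sum>i=1..<d. wzeta $ i * wzeta $ (d - i)) =
     (\<Sum>i=1..<d. moment B h (wzeta $ i * wzeta $ (d - i)))" by (rule moment_sum)
  also have "\<dots> = (\<Sum>i=1..<d. \<Sum>m | m dvd i. \<Sum>l | l dvd d - i.
      4 * (2 * h (int m + int l) - 2 * h (int m - int l)))"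
  proof (intro sum.cong refl)
    fix i assume "i \<in> {1..<d}"
    hence i: "i > 0" "d - i > 0" "i < d" by auto
    have "wzeta $ i * wzeta $ (d - i) = (\<Sum>m | m dvd i. \<Sum>l | l dvd d - i.
        4 * (odd_bump (int m) * odd_bump (int l)))"
      unfolding wzeta_nth_pos[OF i(1)] wzeta_nth_pos[OF i(2)] sum_product
      by (intro sum.cong refl) (simp add: mult_ac)
    hence "moment B h (wzeta $ i * wzeta $ (d - i)) = (\<Sum>m | m dvd i. \<Sum>l | l dvd d - i.
        4 * moment B h (odd_bump (int m) * odd_bump (int l)))"
      by (simp only: moment_sum moment_numeral_mult)
    also have "\<dots> = (\<Sum>m | m dvd i. \<Sum>l | l dvd d - i. 4 * (2 * h (int m + int l) - 2 * h (int m - int l)))"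
    proof (intro sum.cong refl)
      fix m l assume "m \<in> {m. m dvd i}" "l \<in> {l. l dvd d - i}"
      hence "m \<le> i" "l \<le> d - i" using i by (auto dest: dvd_imp_le)
      hence "\<bar>int m\<bar> + \<bar>int l\<bar> \<le> B" using i by (simp add: B_def)
      thus "4 * moment B h (odd_bump (int m) * odd_bump (int l)) =
          4 * (2 * h (int m + int l) - 2 * h (int m - int l))"
        using h by (simp only: moment_odd_bump_mult)
    qed
    finally show "moment B h (wzeta $ i * wzeta $ (d - i)) = \<dots>" .
  qed
  also have "\<dots> = 4 * pair_sum (\<lambda>m l. 2 * h (int m + int l) - 2 * h (int m - int l)) d"
    unfolding pair_sum_def sum_distrib_left ..
  finally have "?L = moment B h ((wzeta * wzeta) $ d)"
    using 1 by (simp add: square_nth[OF d] moment_add moment_numeral_mult)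
  also have "\<dots> = (\<Sum>n=-B..B. g n * (4 * n ^ 2 - 8 * int d) * geo n $ d)"
    unfolding moment_def
  proof (intro sum.cong refl)
    fix n
    have "h n * (wzeta * wzeta) $ d $$ n = g n * (n * row n (wzeta * wzeta) $ d)"
      by (simp add: h_def)
    thus "h n * (wzeta * wzeta) $ d $$ n = g n * (4 * n ^ 2 - 8 * int d) * geo n $ d"
      unfolding row_wzeta_square_nth by simp
  qed
  also have "\<dots> = ?R"
    using sum_geo_nth[of d "{-B..B}" "\<lambda>n. g n * (4 * n ^ 2 - 8 * int d)"] d g
    by (simp add: B_def sum_distrib_left algebra_simps)
  finally show ?thesis .
qed

section \<open>Relations between Eisenstein series\<close>

definition sigma_conv :: "nat \<Rightarrow> nat \<Rightarrow> nat \<Rightarrow> int" where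
  "sigma_conv k l d = (\<Sum>i=1..<d. int (divisor_sigma k i) * int (divisor_sigma l (d - i)))"

lemma sigma_conv_commute: "sigma_conv k l d = sigma_conv l k d"
  unfolding sigma_conv_def by (rule sum.reindex_bij_witness[of _ "\<lambda>i. d - i" "\<lambda>i. d - i"]) auto

lemma pair_sum_monomial: "pair_sum (\<lambda>m l. int m ^ a * int l ^ b) d = sigma_conv a b d"
  by (simp add: pair_sum_def sigma_conv_def divisor_sigma_def sum_product)

lemma pair_sum_add: "pair_sum (\<lambda>m l. f m l + g m l) d = pair_sum f d + pair_sum g d"
  and pair_sum_scale: "pair_sum (\<lambda>m l. c * f m l) d = c * pair_sum f d"
  by (simp_all add: pair_sum_def sum.distrib sum_distrib_left)

lemma eis_mult_nth:
  assumes "d > 0"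
  shows "(eis c k * eis c' l) $ d =
    c * int (divisor_sigma k d) + c' * int (divisor_sigma l d) + c * c' * sigma_conv k l d"
proof -
  have "(eis c k * eis c' l) $ d = (\<Sum>i=0..d. eis c k $ i * eis c' l $ (d - i))"
    by (rule fps_mult_nth)
  also have "{0..d} = insert 0 (insert d {1..<d})" using assms by auto
  finally have "(eis c k * eis c' l) $ d = eis c' l $ d + eis c k $ d +
     (\<Sum>i=1..<d. eis c k $ i * eis c' l $ (d - i))"
    using assms by (simp add: eis_nth)
  also have "(\<Sum>i=1..<d. eis c k $ i * eis c' l $ (d - i)) = c * c' * sigma_conv k l d"
    unfolding sigma_conv_def sum_distrib_left by (intro sum.cong) (auto simp: eis_nth)
  finally show ?thesis using assms by (simp add: eis_nth)
qed

lemma sum_symmetric_Suc: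
  fixes h :: "int \<Rightarrow> int"
  shows "(\<Sum>j=-int (Suc m)..int (Suc m). h j) = (\<Sum>j=-int m..int m. h j) + h (int m + 1) + h (- (int m + 1))"
proof -
  have "{-int (Suc m)..int (Suc m)} = insert (int m + 1) (insert (- (int m + 1)) {-int m..int m})"
    by auto
  thus ?thesis by simp
qed

lemma sum_tent_Suc:
  fixes h :: "int \<Rightarrow> int"
  shows "(\<Sum>j=-int (Suc m)..int (Suc m). (int (Suc m) - \<bar>j\<bar>) * h j) =
    (\<Sum>j=-int m..int m. (int m - \<bar>j\<bar>) * h j) + (\<Sum>j=-int m..int m. h j)"
  unfolding sum_symmetric_Suc by (simp add: sum.distrib[symmetric] algebra_simps)

lemma sum_symmetric_powers:
  "15 * (\<Sum>j=-int m..int m. j ^ 4) = 6 * int m ^ 5 + 15 * int m ^ 4 + 10 * int m ^ 3 - int m"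
  "21 * (\<Sum>j=-int m..int m. j ^ 6) =
     6 * int m ^ 7 + 21 * int m ^ 6 + 21 * int m ^ 5 - 7 * int m ^ 3 + int m"
  "33 * (\<Sum>j=-int m..int m. j ^ 10) =
     6 * int m ^ 11 + 33 * int m ^ 10 + 55 * int m ^ 9 - 66 * int m ^ 7 + 66 * int m ^ 5 - 33 * int m ^ 3 + 5 * int m"
proof (induction m)
  case (Suc m)
  define x where "x = int m"
  have x: "int (Suc m) = x + 1" by (simp add: x_def)
  {
    case 1
    show ?case using Suc.IH(1) unfolding sum_symmetric_Suc unfolding distrib_left x x_def[symmetric]
      by (simp add: eval_nat_numeral algebra_simps)
  next
    case 2
    show ?case using Suc.IH(2) unfolding sum_symmetric_Suc unfolding distrib_left x x_def[symmetric]
      by (simp add: eval_nat_numeral algebra_simps)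
  next
    case 3
    show ?case using Suc.IH(3) unfolding sum_symmetric_Suc unfolding distrib_left x x_def[symmetric]
      by (simp add: eval_nat_numeral algebra_simps)
  }
qed simp_all

lemma sum_tent_powers:
  "(\<Sum>j=-int m..int m. int m - \<bar>j\<bar>) = int m ^ 2"
  "30 * (\<Sum>j=-int m..int m. (int m - \<bar>j\<bar>) * j ^ 4) = 2 * int m ^ 6 - 5 * int m ^ 4 + 3 * int m ^ 2"
  "84 * (\<Sum>j=-int m..int m. (int m - \<bar>j\<bar>) * j ^ 6) =
     3 * int m ^ 8 - 14 * int m ^ 6 + 21 * int m ^ 4 - 10 * int m ^ 2"
  "132 * (\<Sum>j=-int m..int m. (int m - \<bar>j\<bar>) * j ^ 10) =
     2 * int m ^ 12 - 22 * int m ^ 10 + 99 * int m ^ 8 - 220 * int m ^ 6 + 231 * int m ^ 4 - 90 * int m ^ 2"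
proof (induction m)
  case (Suc m)
  define x where "x = int m"
  have x: "int (Suc m) = x + 1" by (simp add: x_def)
  {
    case 1
    show ?case using Suc.IH(1) sum_tent_Suc[of m "\<lambda>_. 1"] by (simp add: power2_eq_square algebra_simps)
  next
    case 2
    show ?case using Suc.IH(2) sum_symmetric_powers(1)[of m]
      unfolding sum_tent_Suc unfolding distrib_left x x_def[symmetric]
      by (simp add: eval_nat_numeral algebra_simps)
  next
    case 3
    show ?case using Suc.IH(3) sum_symmetric_powers(2)[of m]
      unfolding sum_tent_Suc unfolding distrib_left x x_def[symmetric]
      by (simp add: eval_nat_numeral algebra_simps)
  next
    case 4
    show ?case using Suc.IH(4) sum_symmetric_powers(3)[of m]
      unfolding sum_tent_Suc unfolding distrib_left x x_def[symmetric]
      by (simp add: eval_nat_numeral algebra_simps)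
  }
qed simp_all

abbreviation sg :: "nat \<Rightarrow> nat \<Rightarrow> int" where "sg k d \<equiv> int (divisor_sigma k d)"

lemma sg_eq: "sg k d = (\<Sum>m | m dvd d. int m ^ k)"
  by (simp add: divisor_sigma_def)

text \<open>For the weight n^4 the second difference leaves only 24 m^2 l^2, hence a single
  convolution. This is the identity behind E4^2 = E8; the weight n^6 gives E4 E6 = E10 in the same
  way.\<close>

lemma sigma_conv_3_3: "d > 0 \<Longrightarrow> 120 * sigma_conv 3 3 d = sg 7 d - sg 3 d"
proof -
  assume d: "d > 0"
  have "30 * (\<Sum>m | m dvd d. int m * (\<Sum>j=-int m..int m. (int m - \<bar>j\<bar>) * j ^ 4)) =
      (\<Sum>m | m dvd d. int m * (30 * (\<Sum>j=-int m..int m. (int m - \<bar>j\<bar>) * j ^ 4)))"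
    by (simp only: sum_distrib_left mult.left_commute)
  also have "\<dots> = 2 * sg 7 d - 5 * sg 5 d + 3 * sg 3 d"
    unfolding sum_tent_powers unfolding sg_eq sum_distrib_left sum_subtractf[symmetric] sum.distrib[symmetric]
    by (intro sum.cong refl) (simp add: eval_nat_numeral algebra_simps)
  finally have T: "30 * (\<Sum>m | m dvd d. int m * (\<Sum>j=-int m..int m. (int m - \<bar>j\<bar>) * j ^ 4)) = \<dots>" .
  have C: "pair_sum (\<lambda>m l. int m * int l * (2 * (int m + int l) ^ 4 + 2 * (int m - int l) ^ 4
      - 4 * int m ^ 4 - 4 * int l ^ 4 + 4 * 0 ^ 4)) d = 24 * sigma_conv 3 3 d"
    unfolding pair_sum_monomial[symmetric] pair_sum_scale[symmetric]
    by (intro arg_cong2[where f = pair_sum] ext refl) (simp add: eval_nat_numeral algebra_simps)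
  have "(\<Sum>m | m dvd d. int m * (int m ^ 4 - 0 ^ 4)) = sg 5 d" "(\<Sum>m | m dvd d. int m ^ 3 * int m ^ 4) = sg 7 d"
    unfolding sg_eq by (intro sum.cong refl, simp add: eval_nat_numeral algebra_simps)+
  thus ?thesis using moment_wp_square[OF d, of "\<lambda>n. n ^ 4"] T C by simp
qed

lemma sigma_conv_3_5: "d > 0 \<Longrightarrow> 5040 * sigma_conv 3 5 d = 11 * sg 9 d - 21 * sg 5 d + 10 * sg 3 d"
proof -
  assume d: "d > 0"
  have "84 * (\<Sum>m | m dvd d. int m * (\<Sum>j=-int m..int m. (int m - \<bar>j\<bar>) * j ^ 6)) =
      (\<Sum>m | m dvd d. int m * (84 * (\<Sum>j=-int m..int m. (int m - \<bar>j\<bar>) * j ^ 6)))"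
    by (simp only: sum_distrib_left mult.left_commute)
  also have "\<dots> = 3 * sg 9 d - 14 * sg 7 d + 21 * sg 5 d - 10 * sg 3 d"
    unfolding sum_tent_powers unfolding sg_eq sum_distrib_left sum_subtractf[symmetric] sum.distrib[symmetric]
    by (intro sum.cong refl) (simp add: eval_nat_numeral algebra_simps)
  finally have T: "84 * (\<Sum>m | m dvd d. int m * (\<Sum>j=-int m..int m. (int m - \<bar>j\<bar>) * j ^ 6)) = \<dots>" .
  have "pair_sum (\<lambda>m l. int m * int l * (2 * (int m + int l) ^ 6 + 2 * (int m - int l) ^ 6
      - 4 * int m ^ 6 - 4 * int l ^ 6 + 4 * 0 ^ 6)) d = 60 * sigma_conv 3 5 d + 60 * sigma_conv 5 3 d"
    unfolding pair_sum_monomial[symmetric] pair_sum_scale[symmetric] pair_sum_add[symmetric]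
    by (intro arg_cong2[where f = pair_sum] ext refl) (simp add: eval_nat_numeral algebra_simps)
  hence C: "pair_sum (\<lambda>m l. int m * int l * (2 * (int m + int l) ^ 6 + 2 * (int m - int l) ^ 6
      - 4 * int m ^ 6 - 4 * int l ^ 6 + 4 * 0 ^ 6)) d = 120 * sigma_conv 3 5 d" by (simp add: sigma_conv_commute)
  have "(\<Sum>m | m dvd d. int m * (int m ^ 6 - 0 ^ 6)) = sg 7 d" "(\<Sum>m | m dvd d. int m ^ 3 * int m ^ 6) = sg 9 d"
    unfolding sg_eq by (intro sum.cong refl, simp add: eval_nat_numeral algebra_simps)+
  thus ?thesis using moment_wp_square[OF d, of "\<lambda>n. n ^ 6"] T C by simp
qed

text \<open>The weight n^8 is skipped: it leads to weight 12, where E4^3 and E6^2 differ by a cusp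
  form. The weight n^10 leads to weight 14 but mixes two convolutions, so it yields only one linear
  relation between them.\<close>

lemma wp_moment_10: "d > 0 \<Longrightarrow>
  22 * sg 11 d + (2 * sg 13 d - 22 * sg 11 d + 99 * sg 9 d - 220 * sg 7 d + 231 * sg 5 d - 90 * sg 3 d)
   + 23760 * sigma_conv 3 9 d + 110880 * sigma_conv 5 7 d = 22 * sg 13 d"
proof -
  assume d: "d > 0"
  have "132 * (\<Sum>m | m dvd d. int m * (\<Sum>j=-int m..int m. (int m - \<bar>j\<bar>) * j ^ 10)) =
      (\<Sum>m | m dvd d. int m * (132 * (\<Sum>j=-int m..int m. (int m - \<bar>j\<bar>) * j ^ 10)))"
    by (simp only: sum_distrib_left mult.left_commute)
  also have "\<dots> = 2 * sg 13 d - 22 * sg 11 d + 99 * sg 9 d - 220 * sg 7 d + 231 * sg 5 d - 90 * sg 3 d"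
    unfolding sum_tent_powers unfolding sg_eq sum_distrib_left sum_subtractf[symmetric] sum.distrib[symmetric]
    by (intro sum.cong refl) (simp add: eval_nat_numeral algebra_simps)
  finally have T: "132 * (\<Sum>m | m dvd d. int m * (\<Sum>j=-int m..int m. (int m - \<bar>j\<bar>) * j ^ 10)) = \<dots>" .
  have "pair_sum (\<lambda>m l. int m * int l * (2 * (int m + int l) ^ 10 + 2 * (int m - int l) ^ 10
      - 4 * int m ^ 10 - 4 * int l ^ 10 + 4 * 0 ^ 10)) d =
      180 * sigma_conv 9 3 d + 840 * sigma_conv 7 5 d + 840 * sigma_conv 5 7 d + 180 * sigma_conv 3 9 d"
    unfolding pair_sum_monomial[symmetric] pair_sum_scale[symmetric] pair_sum_add[symmetric]
    by (intro arg_cong2[where f = pair_sum] ext refl) (simp add: eval_nat_numeral algebra_simps)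
  hence C: "pair_sum (\<lambda>m l. int m * int l * (2 * (int m + int l) ^ 10 + 2 * (int m - int l) ^ 10
      - 4 * int m ^ 10 - 4 * int l ^ 10 + 4 * 0 ^ 10)) d = 360 * sigma_conv 3 9 d + 1680 * sigma_conv 5 7 d"
    by (simp add: sigma_conv_commute)
  have "(\<Sum>m | m dvd d. int m * (int m ^ 10 - 0 ^ 10)) = sg 11 d"
    "(\<Sum>m | m dvd d. int m ^ 3 * int m ^ 10) = sg 13 d"
    unfolding sg_eq by (intro sum.cong refl, simp add: eval_nat_numeral algebra_simps)+
  thus ?thesis using moment_wp_square[OF d, of "\<lambda>n. n ^ 10"] T C by simp
qed

text \<open>The weight n n^3 in the square of \<open>wzeta\<close>. The term with 30 d comes from
  the derivative of E4; this is the coefficient form of a Ramanujan equation, as is the next lemma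
  for E6.\<close>

lemma sigma_conv_1_3: "d > 0 \<Longrightarrow> 240 * sigma_conv 1 3 d = 21 * sg 5 d + (10 - 30 * int d) * sg 3 d - sg 1 d"
proof -
  assume d: "d > 0"
  have "15 * (\<Sum>m | m dvd d. int m ^ 4 - (\<Sum>j=-int m..int m. j ^ 4)) =
      (\<Sum>m | m dvd d. 15 * int m ^ 4 - 15 * (\<Sum>j=-int m..int m. j ^ 4))"
    by (simp only: sum_distrib_left right_diff_distrib)
  also have "\<dots> = sg 1 d - 6 * sg 5 d - 10 * sg 3 d"
    unfolding sum_symmetric_powers unfolding sg_eq sum_distrib_left sum_subtractf[symmetric] sum.distrib[symmetric]
    by (intro sum.cong refl) (simp add: eval_nat_numeral algebra_simps)
  finally have S: "15 * (\<Sum>m | m dvd d. int m ^ 4 - (\<Sum>j=-int m..int m. j ^ 4)) = \<dots>" .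
  have "pair_sum (\<lambda>m l. 2 * (int m + int l) ^ 4 - 2 * (int m - int l) ^ 4) d = 16 * sigma_conv 3 1 d + 16 * sigma_conv 1 3 d"
    unfolding pair_sum_monomial[symmetric] pair_sum_scale[symmetric] pair_sum_add[symmetric]
    by (intro arg_cong2[where f = pair_sum] ext refl) (simp add: eval_nat_numeral algebra_simps)
  hence C: "pair_sum (\<lambda>m l. 2 * (int m + int l) ^ 4 - 2 * (int m - int l) ^ 4) d = 32 * sigma_conv 1 3 d"
    by (simp add: sigma_conv_commute)
  have "(\<Sum>m | m dvd d. int m ^ 3 * (int m ^ 2 - 2 * int d)) = sg 5 d - 2 * int d * sg 3 d"
    unfolding sg_eq sum_distrib_left sum_subtractf[symmetric] by (intro sum.cong refl) (simp add: eval_nat_numeral algebra_simps)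
  moreover have p: "n * n ^ 3 = n ^ 4" for n :: int by (simp add: eval_nat_numeral algebra_simps)
  ultimately show ?thesis using moment_wzeta_square[OF d, of "\<lambda>n. n ^ 3"] S C
    unfolding p by (simp add: algebra_simps)
qed

lemma sigma_conv_1_5: "d > 0 \<Longrightarrow>
  504 * sigma_conv 1 5 d + 840 * sigma_conv 3 3 d = 27 * sg 7 d + (21 - 42 * int d) * sg 5 d - 7 * sg 3 d + sg 1 d"
proof -
  assume d: "d > 0"
  have "21 * (\<Sum>m | m dvd d. int m ^ 6 - (\<Sum>j=-int m..int m. j ^ 6)) =
      (\<Sum>m | m dvd d. 21 * int m ^ 6 - 21 * (\<Sum>j=-int m..int m. j ^ 6))"
    by (simp only: sum_distrib_left right_diff_distrib)
  also have "\<dots> = 7 * sg 3 d - 6 * sg 7 d - 21 * sg 5 d - sg 1 d"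
    unfolding sum_symmetric_powers unfolding sg_eq sum_distrib_left sum_subtractf[symmetric] sum.distrib[symmetric]
    by (intro sum.cong refl) (simp add: eval_nat_numeral algebra_simps)
  finally have S: "21 * (\<Sum>m | m dvd d. int m ^ 6 - (\<Sum>j=-int m..int m. j ^ 6)) = \<dots>" .
  have "pair_sum (\<lambda>m l. 2 * (int m + int l) ^ 6 - 2 * (int m - int l) ^ 6) d =
      24 * sigma_conv 5 1 d + 80 * sigma_conv 3 3 d + 24 * sigma_conv 1 5 d"
    unfolding pair_sum_monomial[symmetric] pair_sum_scale[symmetric] pair_sum_add[symmetric]
    by (intro arg_cong2[where f = pair_sum] ext refl) (simp add: eval_nat_numeral algebra_simps)
  hence C: "pair_sum (\<lambda>m l. 2 * (int m + int l) ^ 6 - 2 * (int m - int l) ^ 6) d = 48 * sigma_conv 1 5 d + 80 * sigma_conv 3 3 d"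
    by (simp add: sigma_conv_commute)
  have "(\<Sum>m | m dvd d. int m ^ 5 * (int m ^ 2 - 2 * int d)) = sg 7 d - 2 * int d * sg 5 d"
    unfolding sg_eq sum_distrib_left sum_subtractf[symmetric] by (intro sum.cong refl) (simp add: eval_nat_numeral algebra_simps)
  moreover have p: "n * n ^ 5 = n ^ 6" for n :: int by (simp add: eval_nat_numeral algebra_simps)
  ultimately show ?thesis using moment_wzeta_square[OF d, of "\<lambda>n. n ^ 5"] S C
    unfolding p by (simp add: algebra_simps)
qed

text \<open>The weight 1 evaluates Laurent polynomials at u = 1, where every \<open>bump\<close>
  vanishes; hence the pair sum drops out.\<close>

lemma row_0_wp_square: "row 0 (wp * wp) = 9 * E4"
proof (rule fps_ext)
  fix d show "row 0 (wp * wp) $ d = (9 * E4) $ d"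
  proof (cases "d = 0")
    case True
    have "row 0 (wp * wp) $ 0 = (row 0 wp * row 0 wp) $ 0"
      using row_mult_nth[OF tame_wp tame_wp, of 0 0 0] by simp
    thus ?thesis using True by (simp add: row_wp eis_nth fps_numeral_mult_nth)
  next
    case False
    have "(\<Sum>m | m dvd d. int m * int m ^ 2) = sg 3 d"
      unfolding sg_eq by (simp add: power2_eq_square power3_eq_cube mult.assoc)
    moreover have "pair_sum (\<lambda>m l. 0) d = 0" by (simp add: pair_sum_def)
    ultimately show ?thesis
      using moment_wp_square[of d "\<lambda>_. 1"] False
      by (simp add: sum_tent_powers sg_eq[symmetric] fps_numeral_mult_nth eis_nth)
  qed
qed

lemma fps_eq_posI:
  assumes "f $ 0 = g $ 0" "\<And>d. d > 0 \<Longrightarrow> f $ d = g $ d"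
  shows "f = g"
  using assms by (metis fps_ext gr0I)

lemma E4_square: "E4 * E4 = eis 480 7"
proof (rule fps_eq_posI)
  fix d :: nat assume "d > 0"
  thus "(E4 * E4) $ d = eis 480 7 $ d" using sigma_conv_3_3[of d] by (simp add: eis_mult_nth) (simp add: eis_nth)
qed (simp add: eis_nth)

lemma E4_E6: "E4 * E6 = eis (- 264) 9"
proof (rule fps_eq_posI)
  fix d :: nat assume "d > 0"
  thus "(E4 * E6) $ d = eis (- 264) 9 $ d" using sigma_conv_3_5[of d] by (simp add: eis_mult_nth) (simp add: eis_nth)
qed (simp add: eis_nth)

text \<open>E4 E10 and E6 E8 express the same coefficient through the two convolutions;
  \<open>wp_moment_10\<close> is the third linear equation, which eliminates both.\<close>

lemma E4_square_E6: "E4 * E4 * E6 = eis (- 24) 13"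
proof (rule fps_eq_posI)
  fix d :: nat assume d: "d > 0"
  have "(E4 * E4 * E6) $ d = (E4 * eis (- 264) 9) $ d" by (simp only: E4_E6[symmetric] mult.assoc)
  hence 1: "(E4 * E4 * E6) $ d = 240 * sg 3 d - 264 * sg 9 d - 63360 * sigma_conv 3 9 d"
    using d by (simp add: eis_mult_nth)
  have "(E4 * E4 * E6) $ d = (E6 * eis 480 7) $ d" by (simp only: E4_square[symmetric] mult_ac)
  hence 2: "(E4 * E4 * E6) $ d = 480 * sg 7 d - 504 * sg 5 d - 241920 * sigma_conv 5 7 d"
    using d by (simp add: eis_mult_nth)
  show "(E4 * E4 * E6) $ d = eis (- 24) 13 $ d"
    using 1 2 wp_moment_10[OF d] d unfolding eis_nth by simp
qed (simp add: eis_nth)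

lemma theta_E4: "3 * theta E4 = E2 * E4 - E6"
proof (rule fps_eq_posI)
  fix d :: nat assume d: "d > 0"
  show "(3 * theta E4) $ d = (E2 * E4 - E6) $ d"
    using sigma_conv_1_3[OF d] d
    by (simp add: eis_mult_nth eis_nth fps_numeral_mult_nth algebra_simps)
qed (simp add: eis_nth fps_numeral_mult_nth)

lemma theta_E6: "2 * theta E6 = E2 * E6 - E4 * E4"
proof (rule fps_eq_posI)
  fix d :: nat assume d: "d > 0"
  show "(2 * theta E6) $ d = (E2 * E6 - E4 * E4) $ d"
    using sigma_conv_1_5[OF d] sigma_conv_3_3[OF d] d
    by (simp add: eis_mult_nth eis_nth fps_numeral_mult_nth algebra_simps)
qed (simp add: eis_nth fps_numeral_mult_nth)

text \<open>The Rankin-Cohen bracket of E4 and E6: the \<open>E2\<close> terms of the two Ramanujan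
  equations cancel.\<close>

lemma theta_E4_E6: "3 * E6 * theta E4 - 2 * E4 * theta E6 = E4 ^ 3 - E6 ^ 2"
proof -
  have "3 * E6 * theta E4 - 2 * E4 * theta E6 = E6 * (3 * theta E4) - E4 * (2 * theta E6)"
    by (simp add: mult_ac)
  thus ?thesis unfolding theta_E4 theta_E6 by (simp add: algebra_simps power2_eq_square power3_eq_cube)
qed

lemma wp_second_order: "wp * wp = 6 * dlog_u (dlog_u wp) + 9 * emb E4"
proof (rule row_eqI)
  fix n
  have 6: "row n (6 * F) = 6 * row n F" "row n (9 * F) = 9 * row n F" for F :: "int fls fps"
    using row_emb_mult[of n 6 F] row_emb_mult[of n 9 F] by (simp_all add: emb_numeral)
  show "row n (wp * wp) = row n (6 * dlog_u (dlog_u wp) + 9 * emb E4)"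
    unfolding row_add 6 row_dlog_u row_emb
    by (cases "n = 0") (simp_all add: row_0_wp_square row_wp_square row_wp power3_eq_cube mult_ac)
qed

text \<open>Integration of \<open>wp_second_order\<close>: the difference \<open>X\<close> of the
  two sides is killed by D = u d/du, so all its rows but row 0 vanish. Row 0 follows by integration
  by parts and the Ramanujan equation for E4.\<close>

lemma wp_weierstrass: "9 * (dlog_u wp) ^ 2 = wp ^ 3 - 27 * emb E4 * wp + 54 * emb E6"
proof -
  let ?z = wp and ?z' = "dlog_u wp" and ?z'' = "dlog_u (dlog_u wp)"
  define X where "X = 9 * ?z' ^ 2 - ?z ^ 3 + 27 * emb E4 * ?z - 54 * emb E6"
  have num: "dlog_u (numeral k) = (0 :: int fls fps)" for k
    by (simp add: emb_numeral[symmetric])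
  have rnum: "row n (numeral k * F) = numeral k * row n F" for n k and F :: "int fls fps"
    using row_emb_mult[of n "numeral k" F] by (simp add: emb_numeral)
  have sq: "?z * ?z = 6 * ?z'' + 9 * emb E4" by (rule wp_second_order)
  have "dlog_u X = 18 * ?z' * ?z'' - 3 * ?z * ?z * ?z' + 27 * emb E4 * ?z'"
    unfolding X_def
    by (simp add: dlog_u_add dlog_u_diff num power2_eq_square power3_eq_cube dlog_u_mult mult.assoc
      algebra_simps)
  also have "\<dots> = 3 * ?z' * (6 * ?z'' + 9 * emb E4 - ?z * ?z)" by (simp add: algebra_simps)
  also have "\<dots> = 0" by (simp add: sq)
  finally have D: "of_int n * row n X = 0" for n by (metis row_dlog_u row_zero)
  have "row n X = 0" for n
  proof (cases "n = 0")
    case False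
    have "n * row n X $ d = 0" for d
      using arg_cong[OF D[of n], of "\<lambda>f. f $ d"] by simp
    thus ?thesis using False by (intro fps_ext) simp
  next
    case True
    \<comment> \<open>Integration by parts: row 0 of a D-derivative is zero.\<close>
    have "row 0 (dlog_u (?z * ?z')) = 0" by (simp add: row_dlog_u)
    hence p: "row 0 (?z * ?z'') = - row 0 (?z' * ?z')"
      by (simp add: dlog_u_mult eq_neg_iff_add_eq_0 add.commute)
    have r0: "row 0 ?z = 3 * E2" by (simp add: row_wp)
    have "?z ^ 3 = 6 * (?z * ?z'') + 9 * (emb E4 * ?z)"
      by (simp add: power3_eq_cube sq algebra_simps)
    hence c: "row 0 (?z ^ 3) = - 6 * row 0 (?z' * ?z') + 27 * (E4 * E2)"
      by (simp add: rnum p row_emb_mult r0)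
    have r: "10 * row 0 (?z' * ?z') = - 108 * theta E4"
      by (rule fps_ext) (simp add: neg_numeral_fps_const numeral_fps_const row_0_dlog_u_wp_square eis_nth del: row_nth)
    have "row n X = 15 * row 0 (?z' * ?z') + 54 * (E2 * E4 - E6)"
      unfolding X_def True row_add row_diff mult.assoc power2_eq_square rnum row_emb_mult r0 row_emb c
      by (simp add: algebra_simps)
    hence "2 * row n X = 3 * (10 * row 0 (?z' * ?z')) + 108 * (3 * theta E4)"
      unfolding theta_E4 by simp
    thus ?thesis unfolding r by simp
  qed
  hence "X = 0" by (intro row_eqI) simp
  thus ?thesis unfolding X_def by (simp add: algebra_simps)
qed

section \<open>The Hasse polynomial at the Eisenstein series\<close>

definition congp :: "nat \<Rightarrow> 'a::comm_ring_1 \<Rightarrow> 'a \<Rightarrow> bool" where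
  "congp p x y \<longleftrightarrow> of_nat p dvd x - y"

lemma congp_refl [simp]: "congp p x x"
  by (simp add: congp_def)

lemma congp_sym: "congp p x y \<Longrightarrow> congp p y x"
  unfolding congp_def by (subst minus_diff_eq[symmetric], subst dvd_minus_iff)

lemma congp_trans [trans]: "congp p x y \<Longrightarrow> congp p y z \<Longrightarrow> congp p x z"
  unfolding congp_def using dvd_add[of "of_nat p" "x - y" "y - z"] by simp

lemma congp_add: "congp p x y \<Longrightarrow> congp p x' y' \<Longrightarrow> congp p (x + x') (y + y')"
  unfolding congp_def using dvd_add[of "of_nat p" "x - y" "x' - y'"] by (simp add: algebra_simps)

lemma congp_diff: "congp p x y \<Longrightarrow> congp p x' y' \<Longrightarrow> congp p (x - x') (y - y')"
  unfolding congp_def using dvd_diff[of "of_nat p" "x - y" "x' - y'"] by (simp add: algebra_simps)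

lemma congp_mult_left: "congp p x y \<Longrightarrow> congp p (z * x) (z * y)"
  unfolding congp_def by (metis dvd_mult right_diff_distrib)

lemma congp_mult: "congp p x y \<Longrightarrow> congp p x' y' \<Longrightarrow> congp p (x * x') (y * y')"
  by (metis congp_mult_left congp_trans mult.commute)

lemma congp_power: "congp p x y \<Longrightarrow> congp p (x ^ n) (y ^ n)"
  by (induction n) (auto intro: congp_mult)

lemma congp_sum: "(\<And>i. i \<in> S \<Longrightarrow> congp p (f i) (g i)) \<Longrightarrow> congp p (\<Sum>i\<in>S. f i) (\<Sum>i\<in>S. g i)"
  by (induction S rule: infinite_finite_induct) (auto intro: congp_add)

lemma congp_frobenius_prime:
  fixes a b :: "'a::comm_ring_1"
  assumes "prime p"
  shows "congp p ((a + b) ^ p) (a ^ p + b ^ p)"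
proof -
  have p: "p > 0" using assms by (simp add: prime_gt_0_nat)
  have "{..p} = insert 0 (insert p {0<..<p})" using p by auto
  hence "(a + b) ^ p = a ^ p + b ^ p + (\<Sum>k\<in>{0<..<p}. of_nat (p choose k) * a ^ k * b ^ (p - k))"
    unfolding binomial_ring using p by (simp add: add_ac)
  moreover have "of_nat p dvd (\<Sum>k\<in>{0<..<p}. of_nat (p choose k) * a ^ k * b ^ (p - k))"
  proof (intro dvd_sum)
    fix k assume "k \<in> {0<..<p}"
    hence "p dvd p choose k" using assms by (intro dvd_choose_prime) auto
    then obtain c where "p choose k = p * c" by (elim dvdE)
    thus "of_nat p dvd of_nat (p choose k) * a ^ k * b ^ (p - k)" by (simp add: mult.assoc)
  qed
  ultimately show ?thesis by (simp add: congp_def)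
qed

lemma congp_frobenius:
  fixes a b :: "'a::comm_ring_1"
  assumes "prime p"
  shows "congp p ((a + b) ^ (p ^ r)) (a ^ (p ^ r) + b ^ (p ^ r))"
proof (induction r)
  case (Suc r)
  have "(a + b) ^ (p ^ Suc r) = ((a + b) ^ (p ^ r)) ^ p" by (simp add: power_mult[symmetric] mult.commute)
  also have "congp p \<dots> ((a ^ (p ^ r) + b ^ (p ^ r)) ^ p)" by (rule congp_power[OF Suc])
  also have "congp p \<dots> ((a ^ (p ^ r)) ^ p + (b ^ (p ^ r)) ^ p)" by (rule congp_frobenius_prime[OF assms])
  finally show ?case by (simp add: power_mult[symmetric] mult.commute)
qed simp

lemma congp_int_fermat:
  fixes a :: int
  assumes "prime p"
  shows "congp p (a ^ (p ^ r)) a"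
proof (induction a rule: int_induct[of _ 0])
  case base
  show ?case using assms by (simp add: zero_power prime_gt_0_nat)
next
  case (step1 i)
  have "congp p ((i + 1) ^ (p ^ r)) (i ^ (p ^ r) + 1 ^ (p ^ r))" by (rule congp_frobenius[OF assms])
  also have "congp p \<dots> (i + 1)" using step1 by (simp add: congp_add)
  finally show ?case .
next
  case (step2 i)
  have "congp p (((i - 1) + 1) ^ (p ^ r)) ((i - 1) ^ (p ^ r) + 1 ^ (p ^ r))" by (rule congp_frobenius[OF assms])
  hence "congp p ((i - 1) ^ (p ^ r) + 1) (i ^ (p ^ r))" by (simp add: congp_sym)
  also have "congp p \<dots> i" by (rule step2)
  finally have "congp p ((i - 1) ^ (p ^ r) + 1 - 1) (i - 1)" by (rule congp_diff) simp
  thus ?case by simp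
qed

lemma congp_fps_nth: "congp p f g \<Longrightarrow> congp p (f $ n) (g $ n)"
  unfolding congp_def dvd_def by (auto simp: fps_of_nat[symmetric] simp flip: fps_sub_nth)

lemma congp_fpsI:
  fixes f g :: "'a::comm_ring_1 fps"
  assumes "\<And>n. congp p (f $ n) (g $ n)"
  shows "congp p f g"
proof -
  have "\<forall>n. \<exists>c. f $ n - g $ n = of_nat p * c" using assms by (auto simp: congp_def dvd_def)
  then obtain c where c: "\<And>n. f $ n - g $ n = of_nat p * c n" by metis
  have "f - g = of_nat p * Abs_fps c"
    by (rule fps_ext) (simp add: c fps_of_nat[symmetric])
  thus ?thesis by (simp add: congp_def)
qed

lemma congp_fls_nth: "congp p f g \<Longrightarrow> congp p (f $$ n) (g $$ n)"
  for f g :: "'a::comm_ring_1 fls"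
  unfolding congp_def dvd_def by (auto simp: fls_of_nat simp flip: fls_minus_nth)

text \<open>Frobenius applied to f = f_0 + q g, with induction on the degree. The coefficients stay
  raised to the power \<open>N\<close> because they may be Laurent series in u; for integers Fermat
  removes the power.\<close>

lemma congp_power_fps_nth:
  fixes f :: "'a::comm_ring_1 fps"
  assumes "prime p" and N: "N = p ^ r"
  shows "congp p ((f ^ N) $ n) (if N dvd n then (f $ (n div N)) ^ N else 0)"
proof (induction n arbitrary: f rule: less_induct)
  case (less n f)
  have N0: "N > 0" using assms by (simp add: prime_gt_0_nat)
  show ?case
  proof (cases "n = 0")
    case False
    define g where "g = fps_shift 1 f"
    have f: "f = fps_const (f $ 0) + fps_X * g"
      unfolding g_def by (rule fps_ext) (simp add: fps_X_mult_nth split: nat.splits)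
    have "congp p (f ^ N) (fps_const (f $ 0) ^ N + (fps_X * g) ^ N)"
      by (subst f, unfold N, rule congp_frobenius[OF assms(1)])
    hence "congp p ((f ^ N) $ n) ((fps_const (f $ 0) ^ N + (fps_X * g) ^ N) $ n)"
      by (rule congp_fps_nth)
    also have "(fps_const (f $ 0) ^ N + (fps_X * g) ^ N) $ n = (if n < N then 0 else (g ^ N) $ (n - N))"
      using False by (simp add: power_mult_distrib fps_X_power_mult_nth fps_const_power)
    also have "congp p \<dots> (if N dvd n then (f $ (n div N)) ^ N else 0)"
    proof (cases "n < N")
      case True
      thus ?thesis using False by (auto dest: dvd_imp_le)
    next
      case ge: False
      have "congp p ((g ^ N) $ (n - N)) (if N dvd n - N then (g $ ((n - N) div N)) ^ N else 0)"
        using N0 ge by (intro less) auto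
      moreover have "N dvd n - N \<longleftrightarrow> N dvd n" using ge by (metis dvd_minus_self)
      moreover have "g $ ((n - N) div N) = f $ (n div N)"
        using ge N0 by (simp add: g_def le_div_geq)
      ultimately show ?thesis using ge by (cases "N dvd n") simp_all
    qed
    finally show ?thesis .
  qed (simp add: fps_power_zeroth)
qed

lemma congp_power_int_fps_nth:
  fixes f :: "int fps"
  assumes "prime p" and N: "N = p ^ r"
  shows "congp p ((f ^ N) $ n) (if N dvd n then f $ (n div N) else 0)"
  using congp_power_fps_nth[OF assms, of f n] congp_int_fermat[OF assms(1), of "f $ (n div N)" r]
  by (auto simp: N intro: congp_trans)

lemma congp_power_int_fls_nth:
  fixes g :: "int fls"
  assumes "prime p" and N: "N = p ^ r"
  shows "congp p ((g ^ N) $$ (m * int N)) (g $$ m)"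
proof -
  have N0: "N > 0" using assms by (simp add: prime_gt_0_nat)
  define k f where "k = fls_subdegree g" and "f = fls_base_factor_to_fps g"
  have g: "g = fls_shift (- k) (fps_to_fls f)"
    unfolding k_def f_def by (rule fls_conv_base_factor_to_fps_shift_subdegree)
  have pw: "g ^ N = fls_shift (- (int N * k)) (fps_to_fls (f ^ N))"
    unfolding g by (simp add: fls_pow_conv_fps_pow fps_to_fls_power fls_shifted_pow)
  show ?thesis
  proof (cases "m < k")
    case True
    hence "m * int N < int N * k" using N0 by (simp add: mult.commute)
    moreover have "g $$ m = 0" using True by (simp add: k_def)
    ultimately show ?thesis unfolding pw by simp
  next
    case False
    define j where "j = nat (m - k)"
    have j: "m = k + int j" using False by (simp add: j_def)
    have "m * int N - int N * k = int (j * N)" by (simp add: j algebra_simps)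
    moreover have "nat (int (j * N)) = j * N" "\<not> int (j * N) < 0" by (simp_all only: nat_int)
    ultimately have "(g ^ N) $$ (m * int N) = (f ^ N) $ (j * N)" unfolding pw by (simp del: of_nat_mult)
    moreover have "g $$ m = f $ j" by (subst g) (simp add: j)
    ultimately show ?thesis using congp_power_int_fps_nth[OF assms, of f "j * N"] N0 by simp
  qed
qed

definition inflate :: "nat \<Rightarrow> 'a::zero fps \<Rightarrow> 'a fps" where
  "inflate N f = Abs_fps (\<lambda>d. if N dvd d then f $ (d div N) else 0)"

text \<open>Frobenius in both variables: F^N is congruent to F(u^N, q^N), read off at u^N.\<close>

lemma congp_row_power:
  fixes F :: "int fls fps"
  assumes "prime p" and N: "N = p ^ r"
  shows "congp p (row (int N) (F ^ N)) (inflate N (row 1 F))"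
proof (rule congp_fpsI)
  fix d
  have "congp p ((F ^ N) $ d $$ int N) ((if N dvd d then (F $ (d div N)) ^ N else 0) $$ int N)"
    by (intro congp_fls_nth congp_power_fps_nth[OF assms])
  also have "congp p \<dots> (inflate N (row 1 F) $ d)"
    using congp_power_int_fls_nth[OF assms, of "F $ (d div N)" 1] by (simp add: inflate_def)
  finally show "congp p (row (int N) (F ^ N) $ d) (inflate N (row 1 F) $ d)" by simp
qed

text \<open>\<open>k\<close> may be divisible by \<open>p\<close>, but less often than p^r, so one
  factor \<open>p\<close> is left for \<open>x\<close>. This replaces division by an exponent in all
  arguments with exact forms.\<close>

lemma prime_dvd_of_mult_eq:
  fixes x y :: int
  assumes "prime p" "of_nat k * x = of_nat (p ^ r) * y" "\<not> p ^ r dvd k"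
  shows "int p dvd x"
proof (rule ccontr)
  assume "\<not> int p dvd x"
  hence "coprime (int p) x" using assms(1) by (simp add: prime_imp_coprime)
  hence "coprime (int (p ^ r)) x" by simp
  moreover have "int (p ^ r) dvd int k * x" using assms(2) by simp
  ultimately have "int (p ^ r) dvd int k" by (simp add: coprime_dvd_mult_left_iff)
  thus False using assms(3) by (metis of_nat_dvd_iff)
qed

text \<open>
  With \<open>a = c4\<close> and \<open>b = - c6\<close> this is the cubic of the short Weierstrass equation
  \<open>y\<^sup>2 = x\<^sup>3 - 27 c4 x - 54 c6\<close>; at \<open>(E4, E6)\<close> it is the cubic satisfied by \<open>wp\<close> and \<open>3 D wp\<close>.
\<close>
definition weier :: "'a::comm_ring_1 \<Rightarrow> 'a \<Rightarrow> 'a poly" where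
  "weier a b = [:54 * b, - 27 * a, 0, 1:]"

definition hasse :: "nat \<Rightarrow> 'a::comm_ring_1 \<Rightarrow> 'a \<Rightarrow> 'a" where
  "hasse M a b = poly.coeff (weier a b ^ M) (2 * M)"

definition eval_emb :: "'a::comm_ring_1 fls fps \<Rightarrow> 'a fps poly \<Rightarrow> 'a fls fps" where
  "eval_emb z g = (\<Sum>i\<le>degree g. emb (poly.coeff g i) * z ^ i)"

lemma eval_emb_le: "degree g \<le> n \<Longrightarrow> eval_emb z g = (\<Sum>i\<le>n. emb (poly.coeff g i) * z ^ i)"
  unfolding eval_emb_def by (rule sum.mono_neutral_left) (auto simp: coeff_eq_0)

lemma eval_emb_add: "eval_emb z (f + g) = eval_emb z f + eval_emb z g"
proof -
  define n where "n = max (degree f) (degree g)"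
  have "degree (f + g) \<le> n" "degree f \<le> n" "degree g \<le> n"
    by (auto simp: n_def degree_add_le_max)
  thus ?thesis by (simp add: eval_emb_le emb_add distrib_right sum.distrib)
qed

lemma eval_emb_smult: "eval_emb z (Polynomial.smult a g) = emb a * eval_emb z g"
  using degree_smult_le[of a g]
  by (simp add: eval_emb_le[of _ "degree g"] emb_mult sum_distrib_left mult.assoc)

lemma eval_emb_pCons: "eval_emb z (pCons a g) = emb a + z * eval_emb z g"
proof -
  have "degree (pCons a g) \<le> Suc (degree g)" by (rule degree_pCons_le)
  hence "eval_emb z (pCons a g) = (\<Sum>i\<le>Suc (degree g). emb (poly.coeff (pCons a g) i) * z ^ i)"
    by (rule eval_emb_le)
  thus ?thesis unfolding sum.atMost_Suc_shift
    by (simp add: eval_emb_def sum_distrib_left mult_ac)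
qed

lemma eval_emb_0 [simp]: "eval_emb z 0 = 0"
  by (simp add: eval_emb_def)

lemma eval_emb_1: "eval_emb z 1 = 1"
  by (simp add: eval_emb_def emb_1)

lemma eval_emb_mult: "eval_emb z (f * g) = eval_emb z f * eval_emb z g"
  by (induction f) (simp_all add: eval_emb_add eval_emb_smult eval_emb_pCons algebra_simps)

lemma eval_emb_power: "eval_emb z (f ^ n) = eval_emb z f ^ n"
  by (induction n) (simp_all add: eval_emb_mult eval_emb_1)

lemma degree_weier_power: "degree (weier a b ^ M) \<le> 3 * M"
proof -
  have "degree (weier a b) \<le> 3" by (simp add: weier_def)
  thus ?thesis using degree_power_le[of "weier a b" M] by (meson le_trans mult_le_mono1)
qed

lemma emb_uminus: "emb (- a) = - emb a"
  using emb_add[of a "- a"] by (simp add: eq_neg_iff_add_eq_0 add.commute)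

lemma emb_of_nat: "emb (of_nat k) = of_nat k"
  by (induction k) (simp_all add: emb_add emb_1)

text \<open>
  The Cartier operator on \<open>D wp du/u\<close>: both sides of \<open>(3 D wp)\<^sup>N = weier(wp)\<^sup>M \<cdot> 3 D wp\<close> are compared at
  \<open>u\<^sup>N\<close>. On the right \<open>wp\<^sup>i D wp = D (wp\<^bsup>i+1\<^esup>) / (i + 1)\<close> contributes modulo \<open>p\<close> only for \<open>i + 1 = N\<close>.
\<close>
lemma hasse_eisenstein:
  assumes p: "prime p" "p > 3" and N: "N = p ^ r" "N = 2 * M + 1"
  shows "congp p (hasse M E4 E6) 1"
proof -
  define C where "C = (\<lambda>i. poly.coeff (weier E4 E6 ^ M) i)"
  define \<omega> where "\<omega> = inflate N (row 1 wp)"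
  let ?z' = "dlog_u wp"
  have "(3 * ?z') ^ 2 = eval_emb wp (weier E4 E6)"
    using wp_weierstrass
    by (simp add: weier_def eval_emb_pCons emb_mult emb_uminus emb_numeral emb_1 power2_eq_square power3_eq_cube algebra_simps)
  hence "((3 * ?z') ^ 2) ^ M = eval_emb wp (weier E4 E6 ^ M)" by (simp add: eval_emb_power)
  also have "\<dots> = (\<Sum>i\<le>3*M. emb (C i) * wp ^ i)"
    unfolding C_def by (rule eval_emb_le[OF degree_weier_power])
  finally have "(3 * ?z') ^ N = (\<Sum>i\<le>3*M. emb (C i) * wp ^ i) * (3 * ?z')"
    by (simp only: N(2) power_add power_mult power_one_right)
  also have "\<dots> = (\<Sum>i\<le>3*M. emb (3 * C i) * (wp ^ i * ?z'))"
    unfolding sum_distrib_right by (intro sum.cong refl) (simp add: emb_mult emb_numeral mult_ac)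
  finally have row_eq: "row (int N) ((3 * ?z') ^ N) = (\<Sum>i\<le>3*M. 3 * C i * row (int N) (wp ^ i * ?z'))"
    by (simp only: row_sum row_emb_mult)
  have K: "of_nat (Suc i) * row (int N) (wp ^ i * ?z') = of_nat N * row (int N) (wp ^ Suc i)" for i
  proof -
    have "of_nat (Suc i) * row (int N) (wp ^ i * ?z') = row (int N) (dlog_u (wp ^ Suc i))"
      unfolding dlog_u_power mult.assoc row_emb_mult[symmetric] emb_of_nat ..
    thus ?thesis by (simp only: row_dlog_u of_int_of_nat_eq)
  qed
  have Kn: "int (Suc i) * row (int N) (wp ^ i * ?z') $ d = int (p ^ r) * row (int N) (wp ^ Suc i) $ d" for i d
    using arg_cong[OF K[of i], of "\<lambda>f. f $ d"] by (simp add: N(1) fps_of_nat[symmetric])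
  have "congp p (row (int N) (wp ^ i * ?z')) (if i = 2 * M then \<omega> else 0)" if i: "i \<le> 3 * M" for i
  proof (cases "i = 2 * M")
    case True
    have "of_nat N * row (int N) (wp ^ i * ?z') = of_nat N * row (int N) (wp ^ N)"
      using K[of i] True N(2) by simp
    moreover have "of_nat N \<noteq> (0 :: int fps)" using N(2) by (simp add: fps_of_nat[symmetric])
    ultimately have "row (int N) (wp ^ i * ?z') = row (int N) (wp ^ N)" by simp
    thus ?thesis using True congp_row_power[OF p(1) N(1), of wp] by (simp add: \<omega>_def)
  next
    case False
    \<comment> \<open>As \<open>i + 1 \<le> 3 * M + 1 < 2 * N\<close>, the only multiple of
      \<open>N\<close> in range is \<open>N\<close> itself, attained at
      \<open>i = 2 * M\<close>.\<close>
    have "\<not> N dvd Suc i"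
    proof
      assume "N dvd Suc i"
      then obtain c where c: "Suc i = N * c" by (elim dvdE)
      have "c < 2" using c i N(2) by (cases "c \<ge> 2") (auto dest: mult_le_mono2[of 2 c N])
      moreover have "c \<noteq> 0" using c by (intro notI) simp
      ultimately have "c = 1" by linarith
      thus False using c N(2) False by simp
    qed
    hence "int p dvd row (int N) (wp ^ i * ?z') $ d" for d
      using prime_dvd_of_mult_eq[OF p(1) Kn[of i d]] N(1) by simp
    thus ?thesis using False by (intro congp_fpsI) (simp add: congp_def)
  qed
  hence "congp p (row (int N) ((3 * ?z') ^ N)) (\<Sum>i\<le>3*M. 3 * C i * (if i = 2 * M then \<omega> else 0))"
    unfolding row_eq by (intro congp_sum congp_mult_left) auto
  also have "(\<Sum>i\<le>3*M. 3 * C i * (if i = 2 * M then \<omega> else 0)) = 3 * C (2 * M) * \<omega>"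
    by (simp add: if_distrib[of "\<lambda>x. _ * x"] cong: if_cong)
  finally have "congp p (3 * C (2 * M) * \<omega>) (row (int N) ((3 * ?z') ^ N))" by (rule congp_sym)
  also have "congp p \<dots> (inflate N (row 1 (3 * ?z')))" by (rule congp_row_power[OF p(1) N(1)])
  also have "inflate N (row 1 (3 * ?z')) = 3 * \<omega>"
  proof -
    have "row 1 (3 * ?z') = 3 * row 1 wp"
      using row_emb_mult[of 1 3 ?z'] by (simp add: emb_numeral row_dlog_u)
    thus ?thesis by (auto intro!: fps_ext simp: inflate_def \<omega>_def fps_numeral_mult_nth)
  qed
  also have "\<omega> = 36 * geo (int N)"
  proof (rule fps_ext)
    fix d
    have "N > 0" using N(2) by simp
    thus "\<omega> $ d = (36 * geo (int N)) $ d"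
      by (simp add: \<omega>_def inflate_def row_wp fps_numeral_mult_nth geo_def del: row_nth)
  qed
  \<comment> \<open>Multiplication by 1 - q^N inverts \<open>geo N\<close>, leaving the constant 108
    = 2^2 3^3, which is prime to \<open>p > 3\<close>.\<close>
  finally have "congp p ((1 - fps_X ^ N) * (3 * C (2 * M) * (36 * geo (int N))))
      ((1 - fps_X ^ N) * (3 * (36 * geo (int N))))" by (rule congp_mult_left)
  moreover have g: "(1 - fps_X ^ N) * geo (int N) = 1" using N(2) by (intro geo_pos) simp
  have "(1 - fps_X ^ N) * (3 * c * (36 * geo (int N))) = 108 * c * ((1 - fps_X ^ N) * geo (int N))" for c
    by (simp add: algebra_simps)
  hence "(1 - fps_X ^ N) * (3 * c * (36 * geo (int N))) = 108 * c" for c by (simp only: g mult_1_right)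
  from this[of "C (2 * M)"] this[of 1]
  have "(1 - fps_X ^ N) * (3 * C (2 * M) * (36 * geo (int N))) = 108 * C (2 * M)"
    "(1 - fps_X ^ N) * (3 * (36 * geo (int N))) = 108 * 1" by (simp_all only: mult_1_right)
  ultimately have *: "congp p (108 * C (2 * M)) (108 * 1)" by (simp only:)
  have "congp p (C (2 * M)) 1"
  proof (rule congp_fpsI)
    fix n
    have "int p dvd 108 * (C (2 * M) $ n - 1 $ n)"
      using congp_fps_nth[OF *, of n]
      by (simp only: congp_def fps_numeral_mult_nth right_diff_distrib)
    moreover have "coprime (int p) 108"
    proof -
      have "\<not> p dvd 2" "\<not> p dvd 3" using p by (auto dest: dvd_imp_le)
      hence "\<not> p dvd 2 ^ 2 * 3 ^ 3" using p(1) by (simp only: prime_dvd_mult_iff prime_dvd_power_iff) auto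
      hence "coprime p 108" using p(1) by (simp add: prime_imp_coprime)
      thus ?thesis by (metis coprime_int_iff of_nat_numeral)
    qed
    ultimately have "int p dvd C (2 * M) $ n - 1 $ n" by (simp only: coprime_dvd_mult_right_iff)
    thus "congp p (C (2 * M) $ n) (1 $ n)" by (simp only: congp_def)
  qed
  thus ?thesis by (simp add: hasse_def C_def)
qed

section \<open>The operator U, written \<open>every N\<close>, on logarithmic forms\<close>

definition every :: "nat \<Rightarrow> 'a::zero fps \<Rightarrow> 'a fps" where
  "every N f = Abs_fps (\<lambda>n. f $ (n * N))"

lemma every_nth [simp]: "every N f $ n = f $ (n * N)"
  by (simp add: every_def)

lemma sum_multiples:
  fixes h :: "nat \<Rightarrow> 'a::comm_monoid_add"
  assumes "N > 0" "\<And>i. \<not> N dvd i \<Longrightarrow> h i = 0"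
  shows "(\<Sum>i=0..n * N. h i) = (\<Sum>j=0..n. h (j * N))"
proof -
  have "(\<Sum>j=0..n. h (j * N)) = (\<Sum>i\<in>(\<lambda>j. j * N) ` {0..n}. h i)"
    using assms(1) by (subst sum.reindex) (auto simp: inj_on_def)
  also have "\<dots> = (\<Sum>i=0..n * N. h i)"
  proof (rule sum.mono_neutral_left)
    show "\<forall>i\<in>{0..n * N} - (\<lambda>j. j * N) ` {0..n}. h i = 0"
    proof
      fix i assume i: "i \<in> {0..n * N} - (\<lambda>j. j * N) ` {0..n}"
      have "\<not> N dvd i"
      proof
        assume "N dvd i"
        then obtain j where "i = j * N" by (metis dvdE mult.commute)
        thus False using i assms(1) by auto
      qed
      thus "h i = 0" by (rule assms(2))
    qed
  qed auto
  finally show ?thesis ..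
qed

text \<open>The projection formula for U: f^N is congruent to f(q^N), and this leaves U as
  \<open>f\<close>.\<close>

lemma every_power_mult:
  fixes f g :: "int fps"
  assumes "prime p" and N: "N = p ^ r"
  shows "congp p (every N (f ^ N * g)) (f * every N g)"
proof (rule congp_fpsI)
  fix n
  have N0: "N > 0" using assms by (simp add: prime_gt_0_nat)
  have "every N (f ^ N * g) $ n = (\<Sum>i=0..n * N. (f ^ N) $ i * g $ (n * N - i))"
    by (simp add: fps_mult_nth)
  also have "congp p \<dots> (\<Sum>i=0..n * N. (if N dvd i then f $ (i div N) else 0) * g $ (n * N - i))"
    by (intro congp_sum congp_mult congp_refl congp_power_int_fps_nth[OF assms])
  also have "\<dots> = (\<Sum>j=0..n. (if N dvd j * N then f $ (j * N div N) else 0) * g $ (n * N - j * N))"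
    by (rule sum_multiples[OF N0]) simp
  also have "\<dots> = (f * every N g) $ n"
    using N0 by (simp add: fps_mult_nth diff_mult_distrib)
  finally show "congp p (every N (f ^ N * g) $ n) ((f * every N g) $ n)" .
qed

lemma every_sum: "every N (\<Sum>i\<in>S. F i) = (\<Sum>i\<in>S. every N (F i))"
  and every_of_int_mult: "every N (of_int c * f) = of_int c * every N f"
  for f g :: "'a::comm_ring_1 fps"
  by (auto intro!: fps_ext simp: fps_sum_nth)

lemma congp_every: "congp p f g \<Longrightarrow> congp p (every N f) (every N g)"
  by (rule congp_fpsI) (simp add: congp_fps_nth)

text \<open>Up to a multiple of \<open>N\<close> the form times \<open>m\<close> is the exact form
  theta (x^m y^(2N-m)), whose coefficient at index n N is divisible by \<open>N\<close>. For
  \<open>m\<close> in this range N does not divide \<open>m\<close>, so a factor \<open>p\<close>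
  survives the division by \<open>m\<close>.\<close>

lemma every_log_form_0:
  fixes x y :: "int fps"
  assumes p: "prime p" "N = p ^ r" and m: "0 < m" "m < 2 * N" "m \<noteq> N"
  shows "congp p (every N (x ^ (m - 1) * y ^ (2 * N - m - 1) * (y * theta x - x * theta y))) 0"
proof (rule congp_fpsI)
  fix n
  define w where "w = x ^ (m - 1) * y ^ (2 * N - m - 1) * (y * theta x - x * theta y)"
  define a b where "a = m - 1" and "b = 2 * N - m - 1"
  have pw: "x ^ m = x * x ^ a" "y ^ (2 * N - m) = y * y ^ b"
    using m by (auto simp: a_def b_def simp flip: power_Suc intro!: arg_cong[where f = "power _"])
  have th: "theta (x ^ m) = of_nat m * x ^ a * theta x"
    "theta (y ^ (2 * N - m)) = (of_nat (2 * N) - of_nat m) * y ^ b * theta y"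
    using m by (simp_all add: theta_power a_def b_def)
  have "theta (x ^ m * y ^ (2 * N - m)) =
     of_nat m * w + of_nat (2 * N) * (x ^ m * y ^ b * theta y)"
    unfolding w_def a_def[symmetric] b_def[symmetric] theta_mult th unfolding pw
    by (simp add: algebra_simps)
  hence "of_nat m * w = theta (x ^ m * y ^ (2 * N - m)) - of_nat (2 * N) * (x ^ m * y ^ b * theta y)"
    by simp
  hence "(of_nat m * w) $ (n * N) =
     (theta (x ^ m * y ^ (2 * N - m)) - of_nat (2 * N) * (x ^ m * y ^ b * theta y)) $ (n * N)" by simp
  hence "int m * w $ (n * N) = int (p ^ r) *
     (int n * (x ^ m * y ^ (2 * N - m)) $ (n * N) - 2 * (x ^ m * y ^ b * theta y) $ (n * N))"
    unfolding fps_mult_of_nat_nth fps_sub_nth theta_nth by (simp add: p(2) algebra_simps)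
  moreover have "\<not> p ^ r dvd m"
  proof
    assume "p ^ r dvd m"
    hence "N dvd m" by (simp only: p(2))
    then obtain c where c: "m = N * c" by (elim dvdE)
    have "c < 2" using c m by (cases "c \<ge> 2") (auto dest: mult_le_mono2[of 2 c N])
    thus False using c m by (cases c) auto
  qed
  ultimately have "int p dvd w $ (n * N)" by (rule prime_dvd_of_mult_eq[OF p(1)])
  thus "congp p (every N w $ n) (0 $ n)" by (simp add: congp_def)
qed

text \<open>The Cartier operator fixes logarithmic forms: N z^(N-1) theta z = theta (z^N), and U of
  the latter is N times theta applied to U(z^N), which is congruent to z.\<close>

lemma every_log_form_1:
  fixes x y :: "int fps"
  assumes p: "prime p" "N = p ^ r"
  shows "congp p (every N (x ^ (N - 1) * y ^ (N - 1) * (y * theta x - x * theta y))) (y * theta x - x * theta y)"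
proof -
  have N0: "N > 0" using p by (simp add: prime_gt_0_nat)
  have pw: "z ^ N = z ^ (N - 1) * z" for z :: "int fps" using N0 by (cases N) (simp_all add: mult.commute)
  have C: "congp p (every N (z ^ (N - 1) * theta z)) (theta z)" for z :: "int fps"
  proof (rule congp_fpsI)
    fix n
    have "theta (z ^ N) = of_nat N * (z ^ (N - 1) * theta z)" by (simp add: theta_power mult.assoc)
    hence "theta (z ^ N) $ (n * N) = (of_nat N * (z ^ (N - 1) * theta z)) $ (n * N)" by simp
    hence "int N * (int n * (z ^ N) $ (n * N)) = int N * (z ^ (N - 1) * theta z) $ (n * N)"
      unfolding fps_mult_of_nat_nth theta_nth by (simp add: mult_ac)
    hence "every N (z ^ (N - 1) * theta z) $ n = int n * (z ^ N) $ (n * N)" using N0 by simp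
    also have "congp p \<dots> (int n * z $ n)"
      using congp_power_int_fps_nth[OF p, of z "n * N"] N0 by (intro congp_mult_left) simp
    finally show "congp p (every N (z ^ (N - 1) * theta z) $ n) (theta z $ n)" by simp
  qed
  have "x ^ (N - 1) * y ^ (N - 1) * (y * theta x - x * theta y) =
      y ^ N * (x ^ (N - 1) * theta x) - x ^ N * (y ^ (N - 1) * theta y)"
    unfolding pw[of x] pw[of y] by (simp add: algebra_simps)
  also have "every N \<dots> = every N (y ^ N * (x ^ (N - 1) * theta x)) - every N (x ^ N * (y ^ (N - 1) * theta y))"
    by (rule fps_ext) simp
  also have "congp p \<dots> (y * every N (x ^ (N - 1) * theta x) - x * every N (y ^ (N - 1) * theta y))"
    by (intro congp_diff every_power_mult[OF p])
  also have "congp p \<dots> (y * theta x - x * theta y)"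
    by (intro congp_diff congp_mult_left C)
  finally show ?thesis .
qed

lemma congp_cancel_unit:
  fixes u f :: "int fps"
  assumes "prime p" "u $ 0 = 1" "congp p (u * f) (u * g)"
  shows "congp p f g"
proof (rule congp_fpsI)
  define h where "h = f - g"
  have uh: "int p dvd (u * h) $ n" for n
    using congp_fps_nth[OF assms(3), of n] by (simp add: congp_def h_def right_diff_distrib)
  have "int p dvd h $ n" for n
  proof (induction n rule: less_induct)
    case (less n)
    have "(u * h) $ n = (\<Sum>i=0..n. u $ i * h $ (n - i))" by (rule fps_mult_nth)
    also have "\<dots> = h $ n + (\<Sum>i=1..n. u $ i * h $ (n - i))"
      using assms(2) by (simp add: sum.atLeast_Suc_atMost)
    finally have "h $ n = (u * h) $ n - (\<Sum>i=1..n. u $ i * h $ (n - i))" by simp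
    moreover have "int p dvd (\<Sum>i=1..n. u $ i * h $ (n - i))"
      by (intro dvd_sum dvd_mult less) auto
    ultimately show ?case using uh[of n] by simp
  qed
  thus "congp p (f $ n) (g $ n)" for n by (simp add: congp_def h_def)
qed

abbreviation "cusp \<equiv> E4 ^ 3 - E6 ^ 2"

text \<open>
  With \<open>x = E6\<^sup>2\<close> and \<open>y = E4\<^sup>3\<close>, the form \<open>y \<theta>x - x \<theta>y\<close> is \<open>- E4\<^sup>2 E6 (E4\<^sup>3 - E6\<^sup>2)\<close>. Multiplied by a power of the
  Hasse polynomial, which is congruent to 1, the series becomes a combination of the logarithmic forms
  \<open>(x / y)\<^bsup>m-1\<^esup> \<theta>(x / y)\<close> with \<open>0 < m < 2 N\<close> and denominators cleared, of which only \<open>m = N\<close> survives.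
\<close>
lemma every_eisenstein_monomial:
  fixes e e' :: "int fps"
  assumes p: "prime p" "p > 3" and N: "N = p ^ r" "N = 2 * M + 1"
    and e: "e * e' = E4 ^ 2 * E6" "e' $ 0 = 1"
    and tau: "hasse M E4 E6 ^ K * e' ^ (N - 1) = (\<Sum>s\<le>N-1. of_int (\<tau> s) * E4 ^ (3 * s) * E6 ^ (2 * (N - 1 - s)))"
    and i: "i \<le> N - 1"
  shows "congp p (every N (e * cusp * E6 ^ (2 * i) * E4 ^ (3 * (N - 1 - i)))) (of_int (\<tau> i) * (e * cusp))"
proof -
  define x y where "x = E6 ^ 2" and "y = E4 ^ 3"
  define A where "A = e * cusp * E6 ^ (2 * i) * E4 ^ (3 * (N - 1 - i))"
  define \<omega> where "\<omega> = y * theta x - x * theta y"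
  define W where "W = (\<lambda>m. x ^ (m - 1) * y ^ (2 * N - m - 1) * \<omega>)"
  have N0: "N > 0" using N(2) by simp
  have om: "\<omega> = - (E4 ^ 2 * E6 * cusp)"
  proof -
    have "\<omega> = - (E4 ^ 2 * E6 * (3 * E6 * theta E4 - 2 * E4 * theta E6))"
      by (simp add: \<omega>_def x_def y_def theta_power theta_mult power2_eq_square power3_eq_cube algebra_simps)
    thus ?thesis by (simp only: theta_E4_E6)
  qed
  have h: "congp p (hasse M E4 E6 ^ K) 1"
    using congp_power[OF hasse_eisenstein[OF p N], of K] by simp
  have eN: "e' ^ N = e' ^ (N - 1) * e'" using N0 by (cases N) (simp_all add: mult.commute)
  define X where "X = e' ^ (N - 1) * (e * e') * cusp * E6 ^ (2 * i) * E4 ^ (3 * (N - 1 - i))"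
  \<comment> \<open>The factor \<open>e' ^ N\<close> leaves U as \<open>e'\<close>, a series with
    constant term 1 that is cancelled at the end. One of its factors completes \<open>e\<close> to
    E4^2 E6; the others go into the expansion \<open>tau\<close>.\<close>
  have AX: "e' ^ N * A = X * 1"
    unfolding X_def A_def eN mult_1_right by (simp only: mult_ac)
  have "X * hasse M E4 E6 ^ K =
      (hasse M E4 E6 ^ K * e' ^ (N - 1)) * (E6 ^ (2 * i) * E4 ^ (3 * (N - 1 - i)) * (- \<omega>))"
    unfolding om X_def e(1) minus_minus by (simp only: mult_ac)
  also have "\<dots> = (\<Sum>s\<le>N-1. of_int (- \<tau> s) * W (N + i - s))"
    unfolding tau sum_distrib_right
  proof (intro sum.cong refl)
    fix s assume s: "s \<in> {..N - 1}"
    have e1: "x ^ (N + i - s - 1) = x ^ (N - 1 - s) * x ^ i"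
      using s N0 by (subst power_add[symmetric]) (simp add: add.commute)
    have e2: "y ^ (2 * N - (N + i - s) - 1) = y ^ s * y ^ (N - 1 - i)"
    proof -
      have "2 * N - (N + i - s) - 1 = s + (N - 1 - i)" using s i N0 by simp
      thus ?thesis by (simp only: power_add)
    qed
    have e3: "E4 ^ (3 * t) = y ^ t" "E6 ^ (2 * t) = x ^ t" for t
      by (simp_all only: x_def y_def power_mult)
    show "of_int (\<tau> s) * E4 ^ (3 * s) * E6 ^ (2 * (N - 1 - s)) *
        (E6 ^ (2 * i) * E4 ^ (3 * (N - 1 - i)) * (- \<omega>)) = of_int (- \<tau> s) * W (N + i - s)"
      unfolding W_def e1 e2 e3 by (simp only: of_int_minus mult_minus_left mult_minus_right mult_ac)
  qed
  finally have XK: "X * hasse M E4 E6 ^ K = (\<Sum>s\<le>N-1. of_int (- \<tau> s) * W (N + i - s))" .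
  have "congp p (X * 1) (X * hasse M E4 E6 ^ K)" by (rule congp_mult_left[OF congp_sym[OF h]])
  hence "congp p (every N (e' ^ N * A)) (every N (\<Sum>s\<le>N-1. of_int (- \<tau> s) * W (N + i - s)))"
    unfolding AX XK by (rule congp_every)
  also have "\<dots> = (\<Sum>s\<le>N-1. of_int (- \<tau> s) * every N (W (N + i - s)))"
    by (simp only: every_sum every_of_int_mult)
  \<comment> \<open>The index m = N + i - s runs between 1 and 2 N - 1 and equals \<open>N\<close>
    just for \<open>s = i\<close>, which selects the coefficient \<tau> i.\<close>
  also have "congp p \<dots> (\<Sum>s\<le>N-1. of_int (- \<tau> s) * (if s = i then \<omega> else 0))"
  proof (intro congp_sum congp_mult_left)
    fix s assume s: "s \<in> {..N - 1}"
    show "congp p (every N (W (N + i - s))) (if s = i then \<omega> else 0)"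
    proof (cases "s = i")
      case True
      have "2 * N - N - 1 = N - 1" by simp
      thus ?thesis using every_log_form_1[OF p(1) N(1), of x y] True by (simp add: W_def \<omega>_def)
    next
      case False
      thus ?thesis using every_log_form_0[OF p(1) N(1), of "N + i - s" x y] s i N0
        by (simp add: W_def \<omega>_def)
    qed
  qed
  also have "(\<Sum>s\<le>N-1. of_int (- \<tau> s) * (if s = i then \<omega> else 0)) = of_int (\<tau> i) * - \<omega>"
    using i by (simp add: if_distrib[of "\<lambda>x. _ * x"] cong: if_cong)
  also have "\<dots> = e' * (of_int (\<tau> i) * (e * cusp))"
    unfolding om e(1)[symmetric] by (simp add: mult_ac)
  finally have "congp p (every N (e' ^ N * A)) (e' * (of_int (\<tau> i) * (e * cusp)))" .
  moreover have "congp p (every N (e' ^ N * A)) (e' * every N A)"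
    by (rule every_power_mult[OF p(1) N(1)])
  ultimately have "congp p (e' * every N A) (e' * (of_int (\<tau> i) * (e * cusp)))"
    using congp_sym congp_trans by blast
  thus ?thesis unfolding A_def by (rule congp_cancel_unit[OF p(1) e(2)])
qed

text \<open>
  Isobaric polynomials in \<open>a\<close> (weight 2) and \<open>b\<close> (weight 3), evaluated in two rings at once so that
  both evaluations share their integer coefficients.
\<close>
inductive isobaric :: "nat \<Rightarrow> ('b::comm_ring_1 \<Rightarrow> 'b \<Rightarrow> 'b) \<Rightarrow> ('c::comm_ring_1 \<Rightarrow> 'c \<Rightarrow> 'c) \<Rightarrow> bool" where
  monomial: "w = 2 * i + 3 * l \<Longrightarrow> isobaric w (\<lambda>a b. of_int c * a ^ i * b ^ l) (\<lambda>a b. of_int c * a ^ i * b ^ l)"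
| zero: "isobaric w (\<lambda>a b. 0) (\<lambda>a b. 0)"
| add: "isobaric w f f' \<Longrightarrow> isobaric w g g' \<Longrightarrow> isobaric w (\<lambda>a b. f a b + g a b) (\<lambda>a b. f' a b + g' a b)"

lemma isobaric_monomial_mult:
  assumes "isobaric v g g'"
  shows "isobaric (2 * i + 3 * l + v) (\<lambda>a b. of_int c * a ^ i * b ^ l * g a b) (\<lambda>a b. of_int c * a ^ i * b ^ l * g' a b)"
  using assms
proof (induction rule: isobaric.induct)
  case (monomial v i' l' c')
  have "isobaric (2 * i + 3 * l + v) (\<lambda>a b. of_int (c * c') * a ^ (i + i') * b ^ (l + l'))
      (\<lambda>a b. of_int (c * c') * a ^ (i + i') * b ^ (l + l'))"
    using monomial by (intro isobaric.monomial) (simp add: algebra_simps)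
  thus ?case by (simp add: power_add mult_ac)
next
  case (add v f f' g g')
  show ?case using isobaric.add[OF add.IH] by (simp only: distrib_left)
qed (simp_all add: isobaric.zero)

lemma isobaric_mult:
  assumes "isobaric w f f'" "isobaric v g g'"
  shows "isobaric (w + v) (\<lambda>a b. f a b * g a b) (\<lambda>a b. f' a b * g' a b)"
  using assms(1)
proof (induction rule: isobaric.induct)
  case (monomial w i l c)
  thus ?case using isobaric_monomial_mult[OF assms(2)] by simp
next
  case (add w f f' h h')
  show ?case using isobaric.add[OF add.IH] by (simp only: distrib_right)
qed (simp_all add: isobaric.zero)

lemma isobaric_1: "isobaric 0 (\<lambda>a b. 1) (\<lambda>a b. 1)"
  using isobaric.monomial[of 0 0 0 1] by simp

lemma isobaric_power:
  assumes "isobaric w f f'"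
  shows "isobaric (n * w) (\<lambda>a b. f a b ^ n) (\<lambda>a b. f' a b ^ n)"
proof (induction n)
  case (Suc n)
  show ?case using isobaric_mult[OF assms Suc] by simp
qed (simp add: isobaric_1)

lemma coeff_weier_mult:
  "poly.coeff (weier a b * f) j = 54 * b * poly.coeff f j + (if j \<ge> 1 then - 27 * a * poly.coeff f (j - 1) else 0)
     + (if j \<ge> 3 then poly.coeff f (j - 3) else 0)"
  by (cases j; cases "j - 1"; cases "j - 2")
    (auto simp: weier_def coeff_pCons numeral_3_eq_3 algebra_simps split: nat.splits)

text \<open>If x has weight 1, the cubic \<open>weier a b\<close> is homogeneous of weight
  3.\<close>

lemma isobaric_coeff_weier_power:
  "j \<le> 3 * m \<Longrightarrow> isobaric (3 * m - j) (\<lambda>a b :: 'b::comm_ring_1. poly.coeff (weier a b ^ m) j)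
     (\<lambda>a b :: 'c::comm_ring_1. poly.coeff (weier a b ^ m) j)"
proof (induction m arbitrary: j)
  case 0
  thus ?case using isobaric_1 by simp
next
  case (Suc m)
  \<comment> \<open>For \<open>j > 3 * m\<close> the subtraction truncates to 0, but the coefficient
    is 0 and thus isobaric of every weight.\<close>
  have gen: "isobaric (3 * m - j) (\<lambda>a b :: 'b. poly.coeff (weier a b ^ m) j) (\<lambda>a b :: 'c. poly.coeff (weier a b ^ m) j)" for j
  proof (cases "j \<le> 3 * m")
    case False
    hence "poly.coeff (weier a b ^ m) j = 0" for a b :: 'c
      using degree_weier_power[of a b m] by (intro coeff_eq_0) simp
    hence "(\<lambda>a b :: 'c. poly.coeff (weier a b ^ m) j) = (\<lambda>a b. 0)" by (intro ext)
    moreover have "poly.coeff (weier a b ^ m) j = 0" for a b :: 'b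
      using degree_weier_power[of a b m] False by (intro coeff_eq_0) simp
    hence "(\<lambda>a b :: 'b. poly.coeff (weier a b ^ m) j) = (\<lambda>a b. 0)" by (intro ext)
    ultimately show ?thesis by (simp add: isobaric.zero)
  qed (use Suc.IH in auto)
  have shift: "isobaric (3 * Suc m - j) (\<lambda>a b :: 'b. of_int c * a ^ i * b ^ l * poly.coeff (weier a b ^ m) (j - e))
      (\<lambda>a b :: 'c. of_int c * a ^ i * b ^ l * poly.coeff (weier a b ^ m) (j - e))"
    if "e \<le> j" "2 * i + 3 * l + e = 3" for c i l e
  proof (cases "j - e \<le> 3 * m")
    case True
    have "2 * i + 3 * l + (3 * m - (j - e)) = 3 * Suc m - j" using that True Suc.prems by simp
    thus ?thesis using isobaric_monomial_mult[OF gen[of "j - e"], of i l c] by simp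
  next
    case False
    hence "poly.coeff (weier a b ^ m) (j - e) = 0" for a b :: 'c
      using degree_weier_power[of a b m] by (intro coeff_eq_0) simp
    moreover have "poly.coeff (weier a b ^ m) (j - e) = 0" for a b :: 'b
      using degree_weier_power[of a b m] False by (intro coeff_eq_0) simp
    ultimately show ?thesis by (simp add: isobaric.zero)
  qed
  have t1: "isobaric (3 * Suc m - j) (\<lambda>a b :: 'b. 54 * b * poly.coeff (weier a b ^ m) j) (\<lambda>a b :: 'c. 54 * b * poly.coeff (weier a b ^ m) j)"
    using shift[of 0 0 1 54] by simp
  have t2: "isobaric (3 * Suc m - j) (\<lambda>a b :: 'b. if j \<ge> 1 then - 27 * a * poly.coeff (weier a b ^ m) (j - 1) else 0)
     (\<lambda>a b :: 'c. if j \<ge> 1 then - 27 * a * poly.coeff (weier a b ^ m) (j - 1) else 0)"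
    using shift[of 1 1 0 "- 27"] by (cases "j \<ge> 1") (simp_all add: isobaric.zero)
  have t3: "isobaric (3 * Suc m - j) (\<lambda>a b :: 'b. if j \<ge> 3 then poly.coeff (weier a b ^ m) (j - 3) else 0)
     (\<lambda>a b :: 'c. if j \<ge> 3 then poly.coeff (weier a b ^ m) (j - 3) else 0)"
    using shift[of 3 0 0 1] by (cases "j \<ge> 3") (simp_all add: isobaric.zero)
  show ?case using isobaric.add[OF isobaric.add[OF t1 t2] t3] by (simp only: power_Suc coeff_weier_mult)
qed

lemma sum_delta_monomial:
  fixes f :: "nat \<Rightarrow> 'a::comm_ring_1"
  assumes "s \<le> n"
  shows "(\<Sum>t\<le>n. of_int (if t = s then c else 0) * f t * g t) = of_int c * f s * g s"
proof -
  have "(\<Sum>t\<le>n. of_int (if t = s then c else 0) * f t * g t) = (\<Sum>t\<le>n. if t = s then of_int c * f t * g t else 0)"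
    by (intro sum.cong) auto
  thus ?thesis using assms by simp
qed

text \<open>From 2 i + 3 l = 6 n it follows that 3 divides \<open>i\<close> and 2 divides
  \<open>l\<close>, so each monomial is a product of powers of a^3 and b^2 of total exponent
  \<open>n\<close>.\<close>

lemma isobaric_6_expansion:
  assumes "isobaric w f f'" "w = 6 * n"
  shows "\<exists>\<tau>. (\<forall>a b. f a b = (\<Sum>s\<le>n. of_int (\<tau> s) * a ^ (3 * s) * b ^ (2 * (n - s)))) \<and>
             (\<forall>a b. f' a b = (\<Sum>s\<le>n. of_int (\<tau> s) * a ^ (3 * s) * b ^ (2 * (n - s))))"
  using assms
proof (induction rule: isobaric.induct)
  case (monomial w i l c)
  then obtain s where s: "i = 3 * s" "l = 2 * (n - s)" "s \<le> n"
  proof -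
    have eq: "2 * i + 3 * l = 6 * n" using monomial by simp
    hence "i mod 3 = 0" by presburger
    then obtain s where s: "i = 3 * s" by auto
    hence l: "2 * s + l = 2 * n" using eq by simp
    hence "l = 2 * (n - s)" "s \<le> n" by simp_all
    thus ?thesis using that s by blast
  qed
  show ?case unfolding s(1,2)
    by (intro exI[of _ "\<lambda>t. if t = s then c else 0"] conjI allI) (rule sum_delta_monomial[OF s(3), symmetric])+
next
  case (zero w)
  show ?case by (intro exI[of _ "\<lambda>_. 0"]) simp
next
  case (add w f f' g g')
  obtain \<tau> where \<tau>: "\<forall>a b. f a b = (\<Sum>s\<le>n. of_int (\<tau> s) * a ^ (3 * s) * b ^ (2 * (n - s)))"
    "\<forall>a b. f' a b = (\<Sum>s\<le>n. of_int (\<tau> s) * a ^ (3 * s) * b ^ (2 * (n - s)))" using add by blast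
  obtain \<sigma> where \<sigma>: "\<forall>a b. g a b = (\<Sum>s\<le>n. of_int (\<sigma> s) * a ^ (3 * s) * b ^ (2 * (n - s)))"
    "\<forall>a b. g' a b = (\<Sum>s\<le>n. of_int (\<sigma> s) * a ^ (3 * s) * b ^ (2 * (n - s)))" using add by blast
  show ?case
    by (intro exI[of _ "\<lambda>s. \<tau> s + \<sigma> s"]) (simp add: \<tau> \<sigma> distrib_right sum.distrib)
qed

text \<open>The Hasse polynomial has weight \<open>M\<close>, so the total weight is M (K + 4
  \<alpha> + 6 \<beta>) = 12 M. The condition on \<open>K\<close> is what forces the exponent k -
  2.\<close>

lemma hasse_power_expansion:
  assumes "\<alpha> \<le> 2" "\<beta> \<le> 1" "K + 4 * \<alpha> + 6 * \<beta> = 12"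
  shows "\<exists>\<tau>. (\<forall>a b :: 'b::comm_ring_1. hasse M a b ^ K * (a ^ \<alpha> * b ^ \<beta>) ^ (2 * M) =
          (\<Sum>s\<le>2*M. of_int (\<tau> s) * a ^ (3 * s) * b ^ (2 * (2 * M - s)))) \<and>
        (\<forall>a b :: 'c::comm_ring_1. hasse M a b ^ K * (a ^ \<alpha> * b ^ \<beta>) ^ (2 * M) =
          (\<Sum>s\<le>2*M. of_int (\<tau> s) * a ^ (3 * s) * b ^ (2 * (2 * M - s))))"
proof -
  have h: "isobaric M (\<lambda>a b :: 'b. hasse M a b) (\<lambda>a b :: 'c. hasse M a b)"
    using isobaric_coeff_weier_power[of "2 * M" M] by (simp add: hasse_def)
  have m: "isobaric (2 * \<alpha> + 3 * \<beta>) (\<lambda>a b :: 'b. a ^ \<alpha> * b ^ \<beta>) (\<lambda>a b :: 'c. a ^ \<alpha> * b ^ \<beta>)"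
    using isobaric.monomial[OF refl, of \<alpha> \<beta> 1] by simp
  have "K * M + 2 * M * (2 * \<alpha> + 3 * \<beta>) = M * (K + 4 * \<alpha> + 6 * \<beta>)" by (simp add: algebra_simps)
  also have "\<dots> = 6 * (2 * M)" unfolding assms(3) by simp
  finally have "K * M + 2 * M * (2 * \<alpha> + 3 * \<beta>) = 6 * (2 * M)" .
  with isobaric_mult[OF isobaric_power[OF h, of K] isobaric_power[OF m, of "2 * M"]]
  show ?thesis by (rule isobaric_6_expansion)
qed

section \<open>Localization and residue field at a prime\<close>

locale nf_place =
  fixes P :: "'a::number_field set"
  assumes nf_prime: "nf_prime P"
begin

abbreviation "A \<equiv> local_ring P"
abbreviation "M \<equiv> local_max_ideal P"

sublocale primeideal P "ring_of_integers :: 'a ring"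
  using nf_prime by (simp add: nf_prime_def)

lemma int_add: "algebraic_int x \<Longrightarrow> algebraic_int y \<Longrightarrow> algebraic_int (x + y)" for x y :: 'a
  using add.m_closed[of x y] by (simp add: ring_of_integers_def)

lemma int_mult: "algebraic_int x \<Longrightarrow> algebraic_int y \<Longrightarrow> algebraic_int (x * y)" for x y :: 'a
  using m_closed[of x y] by (simp add: ring_of_integers_def)

lemma int_diff: "algebraic_int x \<Longrightarrow> algebraic_int y \<Longrightarrow> algebraic_int (x - y)" for x y :: 'a
  using int_add[of x "- y"] by simp

lemma int_sum: "(\<And>i. i \<in> S \<Longrightarrow> algebraic_int (f i)) \<Longrightarrow> algebraic_int (\<Sum>i\<in>S. f i)" for f :: "_ \<Rightarrow> 'a"
  by (induction S rule: infinite_finite_induct) (auto intro: int_add)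

lemma int_power: "algebraic_int x \<Longrightarrow> algebraic_int (x ^ n)" for x :: 'a
  by (induction n) (auto intro: int_mult)

lemma P_int: "x \<in> P \<Longrightarrow> algebraic_int x"
  using a_subset by (auto simp: ring_of_integers_def)

lemma P_0: "0 \<in> P"
  using additive_subgroup.zero_closed[OF is_additive_subgroup] by (simp add: ring_of_integers_def)

lemma P_add: "x \<in> P \<Longrightarrow> y \<in> P \<Longrightarrow> x + y \<in> P"
  using additive_subgroup.a_closed[OF is_additive_subgroup, of x y] by (simp add: ring_of_integers_def)

lemma P_mult: "x \<in> P \<Longrightarrow> algebraic_int y \<Longrightarrow> y * x \<in> P"
  using I_l_closed[of x y] by (simp add: ring_of_integers_def)

lemma P_minus: "x \<in> P \<Longrightarrow> - x \<in> P"
  using P_mult[of x "- 1"] by simp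

lemma P_diff: "x \<in> P \<Longrightarrow> y \<in> P \<Longrightarrow> x - y \<in> P"
  using P_add[of x "- y"] P_minus by simp

lemma P_sum: "(\<And>i. i \<in> S \<Longrightarrow> f i \<in> P) \<Longrightarrow> (\<Sum>i\<in>S. f i) \<in> P"
  by (induction S rule: infinite_finite_induct) (auto intro: P_add P_0)

lemma P_prime: "algebraic_int x \<Longrightarrow> algebraic_int y \<Longrightarrow> x * y \<in> P \<Longrightarrow> x \<in> P \<or> y \<in> P"
  using I_prime[of x y] by (simp add: ring_of_integers_def)

lemma P_1: "1 \<notin> P"
  using I_notcarr one_imp_carrier by (force simp: ring_of_integers_def)

lemma A_iff: "x \<in> A \<longleftrightarrow> (\<exists>s. algebraic_int s \<and> s \<notin> P \<and> algebraic_int (x * s))"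
proof
  assume "x \<in> A"
  then obtain a s where "x = a / s" "algebraic_int a" "algebraic_int s" "s \<notin> P"
    by (auto simp: local_ring_def)
  moreover from this have "s \<noteq> 0" using P_0 by auto
  ultimately show "\<exists>s. algebraic_int s \<and> s \<notin> P \<and> algebraic_int (x * s)" by auto
next
  assume "\<exists>s. algebraic_int s \<and> s \<notin> P \<and> algebraic_int (x * s)"
  then obtain s where s: "algebraic_int s" "s \<notin> P" "algebraic_int (x * s)" by blast
  hence "x = (x * s) / s" using P_0 by auto
  thus "x \<in> A" unfolding local_ring_def using s by blast
qed

lemma M_iff: "x \<in> M \<longleftrightarrow> (\<exists>s. algebraic_int s \<and> s \<notin> P \<and> x * s \<in> P)"
proof
  assume "x \<in> M"
  then obtain a s where "x = a / s" "a \<in> P" "algebraic_int s" "s \<notin> P"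
    by (auto simp: local_max_ideal_def)
  moreover from this have "s \<noteq> 0" using P_0 by auto
  ultimately show "\<exists>s. algebraic_int s \<and> s \<notin> P \<and> x * s \<in> P" by auto
next
  assume "\<exists>s. algebraic_int s \<and> s \<notin> P \<and> x * s \<in> P"
  then obtain s where s: "algebraic_int s" "s \<notin> P" "x * s \<in> P" by blast
  hence "x = (x * s) / s" using P_0 by auto
  thus "x \<in> M" unfolding local_max_ideal_def using s by blast
qed

lemma int_A: "algebraic_int x \<Longrightarrow> x \<in> A" for x :: 'a
  unfolding A_iff using P_1 by (intro exI[of _ 1]) auto

lemma P_M: "x \<in> P \<Longrightarrow> x \<in> M"
  unfolding M_iff using P_1 by (intro exI[of _ 1]) auto

lemma M_A: "x \<in> M \<Longrightarrow> x \<in> A"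
  unfolding A_iff M_iff using P_int by blast

lemma A_add:
  assumes "x \<in> A" "y \<in> A"
  shows "x + y \<in> A"
proof -
  obtain s t where s: "algebraic_int s" "s \<notin> P" "algebraic_int (x * s)"
    and t: "algebraic_int t" "t \<notin> P" "algebraic_int (y * t)" using assms by (auto simp: A_iff)
  have "(x + y) * (s * t) = (x * s) * t + (y * t) * s" by (simp add: algebra_simps)
  thus ?thesis unfolding A_iff using s t P_prime[of s t] by (intro exI[of _ "s * t"]) (auto intro: int_add int_mult)
qed

lemma A_mult:
  assumes "x \<in> A" "y \<in> A"
  shows "x * y \<in> A"
proof -
  obtain s t where s: "algebraic_int s" "s \<notin> P" "algebraic_int (x * s)"
    and t: "algebraic_int t" "t \<notin> P" "algebraic_int (y * t)" using assms by (auto simp: A_iff)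
  have "(x * y) * (s * t) = (x * s) * (y * t)" by (simp add: algebra_simps)
  hence "algebraic_int (x * y * (s * t))" using s t by (simp only: int_mult)
  thus ?thesis unfolding A_iff using s t P_prime[of s t] by (intro exI[of _ "s * t"]) (auto intro: int_mult)
qed

lemma M_add:
  assumes "x \<in> M" "y \<in> M"
  shows "x + y \<in> M"
proof -
  obtain s t where s: "algebraic_int s" "s \<notin> P" "x * s \<in> P"
    and t: "algebraic_int t" "t \<notin> P" "y * t \<in> P" using assms by (auto simp: M_iff)
  have "(x + y) * (s * t) = t * (x * s) + s * (y * t)" by (simp add: algebra_simps)
  thus ?thesis unfolding M_iff using s t P_prime[of s t]
    by (intro exI[of _ "s * t"]) (auto intro: int_mult P_add P_mult)
qed

lemma M_mult:
  assumes "x \<in> A" "y \<in> M"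
  shows "x * y \<in> M"
proof -
  obtain s t where s: "algebraic_int s" "s \<notin> P" "algebraic_int (x * s)"
    and t: "algebraic_int t" "t \<notin> P" "y * t \<in> P" using assms by (auto simp: A_iff M_iff)
  have "(x * y) * (s * t) = (x * s) * (y * t)" by (simp add: algebra_simps)
  hence "x * y * (s * t) \<in> P" using s t by (simp only: P_mult)
  thus ?thesis unfolding M_iff using s t P_prime[of s t] by (intro exI[of _ "s * t"]) (auto intro: int_mult)
qed

lemma A_consts [simp, intro]: "0 \<in> A" "1 \<in> A" "numeral n \<in> A" "of_nat k \<in> A" "of_int m \<in> A"
  by (simp_all add: int_A)

lemma A_uminus: "x \<in> A \<Longrightarrow> - x \<in> A"
  using A_mult[of "- 1" x] int_A[of "- 1"] by simp

lemma A_diff: "x \<in> A \<Longrightarrow> y \<in> A \<Longrightarrow> x - y \<in> A"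
  using A_add[of x "- y"] A_uminus by simp

lemma A_power: "x \<in> A \<Longrightarrow> x ^ n \<in> A"
  by (induction n) (auto intro: A_mult)

lemma A_sum: "(\<And>i. i \<in> S \<Longrightarrow> f i \<in> A) \<Longrightarrow> (\<Sum>i\<in>S. f i) \<in> A"
  by (induction S rule: infinite_finite_induct) (auto intro: A_add)

lemmas A_intros = A_add A_mult A_uminus A_diff A_power A_sum

lemma M_0 [simp]: "0 \<in> M"
  by (simp add: P_M P_0)

lemma M_uminus: "x \<in> M \<Longrightarrow> - x \<in> M"
  using M_mult[of "- 1" x] int_A[of "- 1"] by simp

lemma M_diff: "x \<in> M \<Longrightarrow> y \<in> M \<Longrightarrow> x - y \<in> M"
  using M_add[of x "- y"] M_uminus by simp

lemma M_sum: "(\<And>i. i \<in> S \<Longrightarrow> f i \<in> M) \<Longrightarrow> (\<Sum>i\<in>S. f i) \<in> M"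
  by (induction S rule: infinite_finite_induct) (auto intro: M_add)

lemma M_int: "x \<in> M \<Longrightarrow> algebraic_int x \<Longrightarrow> x \<in> P"
  unfolding M_iff using P_prime by blast

lemma M_1: "1 \<notin> M"
  using M_int P_1 by auto

lemma unit_inverse:
  assumes "x \<in> A" "x \<notin> M"
  shows "inverse x \<in> A" "x \<noteq> 0"
proof -
  show x: "x \<noteq> 0" using assms(2) by auto
  obtain s where s: "algebraic_int s" "s \<notin> P" "algebraic_int (x * s)" using assms by (auto simp: A_iff)
  moreover have "x * s \<notin> P" using assms(2) s unfolding M_iff by blast
  moreover have "inverse x * (x * s) = s" using x by (simp add: mult.assoc[symmetric])
  ultimately show "inverse x \<in> A" unfolding A_iff by (intro exI[of _ "x * s"]) (simp only: simp_thms)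
qed

lemma local_unit_iff: "local_unit P x \<longleftrightarrow> x \<in> A \<and> x \<notin> M"
proof
  assume "local_unit P x"
  hence x: "x \<in> A" "x \<noteq> 0" "inverse x \<in> A" by (auto simp: local_unit_def)
  have "x \<notin> M"
  proof
    assume "x \<in> M"
    hence "inverse x * x \<in> M" using x by (intro M_mult)
    thus False using x M_1 by simp
  qed
  thus "x \<in> A \<and> x \<notin> M" using x by simp
qed (use unit_inverse in \<open>auto simp: local_unit_def\<close>)

lemma has_valuation_0: "has_valuation P x 0 \<Longrightarrow> x \<in> A \<and> x \<notin> M"
  using local_unit_iff by (auto simp: has_valuation_def)

lemma M_prime:
  assumes "x \<in> A" "y \<in> A" "x * y \<in> M"
  shows "x \<in> M \<or> y \<in> M"
proof (rule ccontr)
  assume "\<not> (x \<in> M \<or> y \<in> M)"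
  hence x: "inverse x \<in> A" "x \<noteq> 0" "y \<notin> M" using unit_inverse assms by auto
  have "inverse x * (x * y) \<in> M" by (rule M_mult[OF x(1) assms(3)])
  moreover have "inverse x * (x * y) = y" using x by (simp add: mult.assoc[symmetric])
  ultimately show False using x by (simp only:)
qed

lemma M_power: "x \<in> A \<Longrightarrow> x ^ n \<in> M \<Longrightarrow> x \<in> M"
  by (induction n) (use M_1 M_prime A_power in auto)

definition eqv :: "'a \<Rightarrow> 'a \<Rightarrow> bool" (infix "\<approx>" 50) where
  "x \<approx> y \<longleftrightarrow> x - y \<in> M"

lemma eqv_refl [simp]: "x \<approx> x" by (simp add: eqv_def)

lemma eqv_sym: "x \<approx> y \<Longrightarrow> y \<approx> x"
  using M_uminus[of "x - y"] by (simp add: eqv_def)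

lemma eqv_trans [trans]: "x \<approx> y \<Longrightarrow> y \<approx> z \<Longrightarrow> x \<approx> z"
  using M_add[of "x - y" "y - z"] by (simp add: eqv_def)

lemma eqv_add: "x \<approx> y \<Longrightarrow> x' \<approx> y' \<Longrightarrow> x + x' \<approx> y + y'"
  using M_add[of "x - y" "x' - y'"] by (simp add: eqv_def algebra_simps)

lemma eqv_diff: "x \<approx> y \<Longrightarrow> x' \<approx> y' \<Longrightarrow> x - x' \<approx> y - y'"
  using M_diff[of "x - y" "x' - y'"] by (simp add: eqv_def algebra_simps)

lemma eqv_mult_left: "z \<in> A \<Longrightarrow> x \<approx> y \<Longrightarrow> z * x \<approx> z * y"
  unfolding eqv_def right_diff_distrib[symmetric] by (rule M_mult)

lemma eqv_A: "x \<approx> y \<Longrightarrow> y \<in> A \<Longrightarrow> x \<in> A"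
  unfolding eqv_def using A_add[of "x - y" y] M_A by simp

lemma eqv_mult:
  assumes "x \<approx> y" "x' \<approx> y'" "y \<in> A" "y' \<in> A"
  shows "x * x' \<approx> y * y'"
proof -
  have "x' * x \<approx> x' * y" using assms eqv_A by (intro eqv_mult_left)
  also have "x' * y = y * x'" by simp
  also have "\<dots> \<approx> y * y'" using assms by (intro eqv_mult_left)
  finally show ?thesis by (simp add: mult.commute)
qed

lemma eqv_power: "x \<approx> y \<Longrightarrow> y \<in> A \<Longrightarrow> x ^ n \<approx> y ^ n"
  by (induction n) (auto intro: eqv_mult A_power)

lemma eqv_sum: "(\<And>i. i \<in> S \<Longrightarrow> f i \<approx> g i) \<Longrightarrow> (\<Sum>i\<in>S. f i) \<approx> (\<Sum>i\<in>S. g i)"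
  by (induction S rule: infinite_finite_induct) (auto intro: eqv_add)

lemma eqv_cancel:
  assumes "u \<in> A" "u \<notin> M" "u * x \<approx> u * y"
  shows "x \<approx> y"
proof -
  have "inverse u * (u * x) \<approx> inverse u * (u * y)" 
    by (rule eqv_mult_left[OF unit_inverse(1)[OF assms(1,2)] assms(3)])
  moreover have "inverse u * (u * z) = z" for z
    using unit_inverse(2)[OF assms(1,2)] by (simp add: mult.assoc[symmetric])
  ultimately show ?thesis by (simp only:)
qed

text \<open>The lowest nonzero coefficient of an integer polynomial vanishing at \<open>x\<close> is
  an integral multiple of \<open>x\<close>.\<close>

lemma ex_int_in_P:
  assumes x: "x \<in> P" "x \<noteq> 0" and q: "poly (map_poly of_int q) x = 0" "q \<noteq> (0 :: int poly)"
  shows "\<exists>c. c \<noteq> 0 \<and> (of_int c :: 'a) \<in> P"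
  using q
proof (induction q)
  case (pCons c q)
  show ?case
  proof (cases "c = 0")
    case True
    thus ?thesis using pCons x by (auto simp: map_poly_pCons)
  next
    case False
    have "algebraic_int (poly (map_poly of_int r) x)" for r :: "int poly"
      using P_int[OF x(1)] by (induction r) (auto simp: map_poly_pCons intro: int_add int_mult)
    hence "poly (map_poly of_int q) x * x \<in> P" using x by (intro P_mult)
    moreover have "of_int c = - (poly (map_poly of_int q) x * x)"
      using pCons.prems by (simp add: map_poly_pCons eq_neg_iff_add_eq_0 mult.commute)
    ultimately show ?thesis using False P_minus by metis
  qed
qed simp

lemma ex_prime_in_P: "\<exists>p. prime p \<and> (of_nat p :: 'a) \<in> P"
proof -
  obtain x where x: "x \<in> P" "x \<noteq> 0" using nf_prime P_0 by (auto simp: nf_prime_def)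
  then obtain q where q: "poly (map_poly of_int q) x = 0" "lead_coeff q = (1 :: int)"
    using P_int[OF x(1)] by (auto simp: algebraic_int_altdef_ipoly)
  then obtain c where c: "c \<noteq> 0" "(of_int c :: 'a) \<in> P"
    using ex_int_in_P[OF x q(1)] by (metis leading_coeff_0_iff zero_neq_one)
  have "of_nat (nat \<bar>c\<bar>) = (of_int \<bar>c\<bar> :: 'a)" by (simp add: of_nat_nat)
  also have "\<dots> \<in> P" using c P_minus by (auto simp: abs_if)
  finally have "(of_nat (nat \<bar>c\<bar>) :: 'a) \<in> P" .
  moreover have "\<exists>p. prime p \<and> (of_nat p :: 'a) \<in> P" if "n > 0" "(of_nat n :: 'a) \<in> P" for n
    using that
  proof (induction n rule: less_induct)
    case (less n)
    have "n \<noteq> 1" using less.prems P_1 by auto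
    then obtain p where p: "prime p" "p dvd n" using prime_factor_nat by blast
    then obtain m where m: "n = p * m" by (elim dvdE)
    have "(of_nat p :: 'a) \<in> P \<or> (of_nat m :: 'a) \<in> P"
      using less.prems m by (intro P_prime) auto
    moreover have "m > 0" "m < n" using m less.prems p(1) prime_gt_1_nat[OF p(1)] by auto
    ultimately show ?case using less.IH p(1) by blast
  qed
  moreover have "nat \<bar>c\<bar> > 0" using c(1) by simp
  ultimately show ?thesis by blast
qed

lemma of_int_in_P_iff:
  assumes "prime p" "(of_nat p :: 'a) \<in> P"
  shows "(of_int n :: 'a) \<in> P \<longleftrightarrow> int p dvd n"
proof
  assume "int p dvd n"
  then obtain m where "n = int p * m" by (elim dvdE)
  thus "(of_int n :: 'a) \<in> P" using P_mult[OF assms(2), of "of_int m"] by (simp add: mult.commute)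
next
  assume n: "(of_int n :: 'a) \<in> P"
  show "int p dvd n"
  proof (rule ccontr)
    assume "\<not> int p dvd n"
    hence "coprime (int p) n" using assms(1) by (simp add: prime_imp_coprime)
    then obtain u v where "u * int p + v * n = 1" by (metis bezout_int coprime_imp_gcd_eq_1)
    hence "(of_int (u * int p + v * n) :: 'a) = 1" by simp
    moreover have "(of_int (u * int p + v * n) :: 'a) \<in> P"
      using P_add[OF P_mult[OF assms(2), of "of_int u"] P_mult[OF n, of "of_int v"]] by simp
    ultimately show False using P_1 by simp
  qed
qed

end

section \<open>Finiteness of the residue field\<close>

lemma primitive_integer_multiple:
  fixes u :: "'b \<Rightarrow> rat"
  assumes "finite S" "v \<in> S" "u v \<noteq> 0" "p > 1"
  shows "\<exists>c :: 'b \<Rightarrow> int. \<exists>k :: rat. (\<forall>w\<in>S. of_int (c w) = k * u w) \<and> (\<exists>w\<in>S. \<not> int p dvd c w)"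
proof -
  define D where "D = (\<Prod>w\<in>S. snd (quotient_of (u w)))"
  have pos: "snd (quotient_of r) > 0" for r by (rule quotient_of_denom_pos')
  have "\<exists>m :: int. of_int m = of_int D * u w" if "w \<in> S" for w
  proof -
    have "snd (quotient_of (u w)) dvd D" unfolding D_def using that assms(1) by (intro dvd_prodI)
    then obtain t where t: "D = snd (quotient_of (u w)) * t" by (elim dvdE)
    have "u w = of_int (fst (quotient_of (u w))) / of_int (snd (quotient_of (u w)))"
      by (metis quotient_of_div prod.collapse)
    hence "of_int D * u w = of_int (fst (quotient_of (u w)) * t)"
      using pos[of "u w"] by (simp add: t field_simps)
    thus ?thesis by metis
  qed
  then obtain m :: "'b \<Rightarrow> int" where m: "\<And>w. w \<in> S \<Longrightarrow> of_int (m w) = of_int D * u w" by metis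
  have D: "D > 0" unfolding D_def using pos by (intro prod_pos) auto
  define g where "g = Gcd (m ` S)"
  have mv: "m v \<noteq> 0" using m[OF assms(2)] assms(3) D by auto
  hence g0: "g \<noteq> 0" using assms(2) by (auto simp: g_def)
  have gd: "g dvd m w" if "w \<in> S" for w using that by (simp add: g_def)
  have "\<exists>w\<in>S. \<not> int p dvd m w div g"
  proof (rule ccontr)
    assume "\<not> (\<exists>w\<in>S. \<not> int p dvd m w div g)"
    hence "g * int p dvd m w" if "w \<in> S" for w
      using that gd[OF that] g0 by (metis dvd_mult_div_cancel mult_dvd_mono dvd_refl)
    hence "g * int p dvd g" unfolding g_def by (intro Gcd_greatest) auto
    hence "int p dvd 1" using g0 by (metis dvd_mult_cancel_left mult.right_neutral)
    thus False using assms(4) by simp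
  qed
  moreover have "of_int (m w div g) = (of_int D / of_int g) * u w" if "w \<in> S" for w
  proof -
    have "m w = g * (m w div g)" using gd[OF that] by simp
    hence "of_int (m w) = (of_int g * of_int (m w div g) :: rat)" by (metis of_int_mult)
    thus ?thesis using m[OF that] g0 by (simp add: field_simps)
  qed
  ultimately show ?thesis by (intro exI[of _ "\<lambda>w. m w div g"] exI[of _ "of_int D / of_int g"]) blast
qed

context nf_place
begin

text \<open>Linear independence of residue classes over the field with \<open>p\<close> elements,
  stated with integer coefficients to stay inside the number field.\<close>

definition indep :: "nat \<Rightarrow> 'a set \<Rightarrow> bool" where
  "indep p S \<longleftrightarrow> finite S \<and> (\<forall>x\<in>S. algebraic_int x) \<and>
     (\<forall>c :: 'a \<Rightarrow> int. (\<Sum>v\<in>S. of_int (c v) * v) \<in> P \<longrightarrow> (\<forall>v\<in>S. int p dvd c v))"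

lemma indepD:
  "indep p S \<Longrightarrow> (\<Sum>v\<in>S. of_int (c v) * v) \<in> P \<Longrightarrow> v \<in> S \<Longrightarrow> int p dvd c v"
  unfolding indep_def by blast

text \<open>A rational dependence rescales to an integer relation with some coefficient prime to
  \<open>p\<close>. Its sum 0 lies in \<open>P\<close>, so elements independent modulo
  \<open>p\<close> are independent over the rationals.\<close>

lemma indep_card_bounded:
  assumes "p > 1"
  shows "\<exists>d. \<forall>S. indep p S \<longrightarrow> card S \<le> d"
proof -
  interpret vs: vector_space "\<lambda>r x. of_rat r * x :: 'a"
    by unfold_locales (simp_all add: algebra_simps of_rat_add of_rat_mult)
  obtain B :: "'a set" where B: "finite B" "\<And>x. \<exists>r :: 'a \<Rightarrow> rat. x = (\<Sum>b\<in>B. of_rat (r b) * b)"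
    using finite_degree by metis
  have span: "vs.span B = UNIV"
  proof -
    have "x \<in> vs.span B" for x
    proof -
      obtain r where "x = (\<Sum>b\<in>B. of_rat (r b) * b)" using B(2) by blast
      thus ?thesis by (auto intro!: vs.span_sum intro: vs.span_scale vs.span_base)
    qed
    thus ?thesis by auto
  qed
  have "card S \<le> card B" if S: "indep p S" for S
  proof -
    have fin: "finite S" using S by (simp add: indep_def)
    have "vs.independent S"
    proof
      assume "vs.dependent S"
      then obtain u where u: "\<exists>v\<in>S. u v \<noteq> 0" "(\<Sum>v\<in>S. of_rat (u v) * v) = 0"
        unfolding vs.dependent_finite[OF fin] by blast
      then obtain v where "v \<in> S" "u v \<noteq> 0" by blast
      then obtain c :: "'a \<Rightarrow> int" and k where c: "\<forall>w\<in>S. of_int (c w) = k * u w" "\<exists>w\<in>S. \<not> int p dvd c w"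
        using primitive_integer_multiple[OF fin _ _ assms, of v u] by blast
      have "(\<Sum>w\<in>S. of_int (c w) * w) = (\<Sum>w\<in>S. of_rat k * (of_rat (u w) * w))"
      proof (intro sum.cong refl)
        fix w assume "w \<in> S"
        hence "(of_rat (of_int (c w)) :: 'a) = of_rat (k * u w)" using c by simp
        thus "of_int (c w) * w = of_rat k * (of_rat (u w) * w)" by (simp add: of_rat_mult)
      qed
      also have "\<dots> = 0" unfolding sum_distrib_left[symmetric] u(2) by simp
      finally have "\<forall>w\<in>S. int p dvd c w" using S P_0 by (simp add: indep_def)
      thus False using c by blast
    qed
    thus ?thesis using vs.independent_span_bound[OF B(1), of S] span by simp
  qed
  thus ?thesis by blast
qed

text \<open>A maximal independent set spans: in a relation involving a new element \<open>x\<close>,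
  its coefficient is prime to \<open>p\<close>, and Bezout solves for \<open>x\<close> modulo
  \<open>P\<close>.\<close>

lemma ex_residue_basis:
  assumes p: "prime p" "(of_nat p :: 'a) \<in> P"
  shows "\<exists>S. indep p S \<and> (\<forall>x. algebraic_int x \<longrightarrow> (\<exists>c. x - (\<Sum>v\<in>S. of_int (c v) * v) \<in> P))"
proof -
  have p1: "p > 1" using p(1) by (rule prime_gt_1_nat)
  obtain d where d: "\<And>S. indep p S \<Longrightarrow> card S \<le> d" using indep_card_bounded[OF p1] by blast
  have "indep p {}" by (simp add: indep_def)
  moreover have "\<forall>S. indep p S \<longrightarrow> card S < Suc d" using d by (auto simp: less_Suc_eq_le)
  ultimately have "\<exists>S. indep p S \<and> (\<forall>T. indep p T \<longrightarrow> card T \<le> card S)"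
    by (rule ex_has_greatest_nat)
  then obtain S where S: "indep p S" "\<And>T. indep p T \<Longrightarrow> card T \<le> card S" by blast
  have fin: "finite S" using S by (simp add: indep_def)
  have "\<exists>c. x - (\<Sum>v\<in>S. of_int (c v) * v) \<in> P" if x: "algebraic_int x" for x
  proof (cases "x \<in> S")
    case True
    have "(\<Sum>v\<in>S. of_int (if v = x then 1 else 0) * v) = (\<Sum>v\<in>S. if v = x then v else 0)"
      by (intro sum.cong) auto
    also have "\<dots> = x" using True fin by simp
    finally show ?thesis using P_0 by (intro exI[of _ "\<lambda>v. if v = x then 1 else 0"]) simp
  next
    case False
    have "\<not> indep p (insert x S)" using S(2)[of "insert x S"] False fin by auto
    then obtain c :: "'a \<Rightarrow> int" where c: "(\<Sum>v\<in>insert x S. of_int (c v) * v) \<in> P"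
      "\<exists>v\<in>insert x S. \<not> int p dvd c v"
      using S(1) x by (auto simp: indep_def)
    define Y where "Y = (\<Sum>v\<in>S. of_int (c v) * v)"
    have cY: "of_int (c x) * x + Y \<in> P" using c(1) False fin by (simp add: Y_def)
    have "\<not> int p dvd c x"
    proof
      assume *: "int p dvd c x"
      hence "(of_int (c x) :: 'a) \<in> P" using of_int_in_P_iff[OF p] by simp
      hence "of_int (c x) * x \<in> P" using P_mult[of "of_int (c x)" x] x by (simp add: mult.commute)
      hence "Y \<in> P" using P_diff[OF cY] by fastforce
      hence "\<forall>v\<in>S. int p dvd c v" using S(1) unfolding indep_def Y_def by blast
      thus False using c(2) * by blast
    qed
    hence "coprime (int p) (c x)" using p(1) by (simp add: prime_imp_coprime)
    then obtain u w where uw: "u * int p + w * c x = 1" by (metis bezout_int coprime_imp_gcd_eq_1)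
    have "x = of_int (u * int p + w * c x) * x" by (simp add: uw)
    hence "x - (\<Sum>v\<in>S. of_int (- w * c v) * v) = of_int w * (of_int (c x) * x + Y) + (of_int u * x) * of_nat p"
      by (simp add: Y_def sum_distrib_left sum_negf algebra_simps)
    also have "\<dots> \<in> P" using x by (intro P_add P_mult[OF cY] P_mult[OF p(2)] int_mult) auto
    finally show ?thesis by (rule exI[of _ "\<lambda>v. - w * c v"])
  qed
  thus ?thesis using S(1) by blast
qed

abbreviation "k\<^sub>P \<equiv> residue_field P"

definition cls :: "'a \<Rightarrow> 'a set" where "cls x = {z. z - x \<in> P}"

lemma cls_coset: "cls x = P +>\<^bsub>ring_of_integers\<^esub> x"
proof -
  have "P +>\<^bsub>ring_of_integers\<^esub> x = (\<Union>h\<in>P. {h + x})"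
    unfolding a_r_coset_def' by (simp add: ring_of_integers_def)
  also have "\<dots> = cls x" by (auto simp: cls_def intro: diff_add_cancel[symmetric])
  finally show ?thesis ..
qed

lemma cls_eq_iff: "cls x = cls y \<longleftrightarrow> x - y \<in> P"
proof
  assume "cls x = cls y"
  moreover have "x \<in> cls x" by (simp add: cls_def P_0)
  ultimately show "x - y \<in> P" by (auto simp: cls_def)
next
  assume *: "x - y \<in> P"
  have "z - x \<in> P \<longleftrightarrow> z - y \<in> P" for z
    using P_add[OF _ *, of "z - x"] P_diff[OF _ *, of "z - y"] by auto
  thus "cls x = cls y" by (simp add: cls_def)
qed

lemma carrier_residue: "carrier k\<^sub>P = cls ` {x. algebraic_int x}"
proof -
  have "carrier k\<^sub>P = (\<Union>x\<in>carrier ring_of_integers. {P +>\<^bsub>ring_of_integers\<^esub> x})"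
    unfolding residue_field_def FactRing_def A_RCOSETS_def' by simp
  also have "\<dots> = (\<Union>x\<in>{x. algebraic_int x}. {cls x})"
    unfolding cls_coset by (simp add: ring_of_integers_def)
  finally show ?thesis by blast
qed

lemma card_residue:
  assumes p: "prime p" "(of_nat p :: 'a) \<in> P"
  shows "\<exists>r. r > 0 \<and> finite (carrier k\<^sub>P) \<and> prime_norm P = p ^ r"
proof -
  obtain S where S: "indep p S" "\<And>x. algebraic_int x \<Longrightarrow> \<exists>c. x - (\<Sum>v\<in>S. of_int (c v) * v) \<in> P"
    using ex_residue_basis[OF p] by blast
  have p0: "p > 0" using p(1) by (simp add: prime_gt_0_nat)
  have fin: "finite S" and Sint: "\<And>v. v \<in> S \<Longrightarrow> algebraic_int v" using S(1) by (auto simp: indep_def)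
  define F where "F = (S \<rightarrow>\<^sub>E {0..<int p})"
  define \<Phi> where "\<Phi> = (\<lambda>f. cls (\<Sum>v\<in>S. of_int (f v) * v))"
  have "bij_betw \<Phi> F (carrier k\<^sub>P)"
  proof (rule bij_betw_imageI)
    show "inj_on \<Phi> F"
    proof (rule inj_onI)
      fix f g assume fg: "f \<in> F" "g \<in> F" "\<Phi> f = \<Phi> g"
      hence "(\<Sum>v\<in>S. of_int (f v - g v) * v) \<in> P"
        by (simp add: \<Phi>_def cls_eq_iff sum_subtractf left_diff_distrib)
      hence d: "int p dvd f v - g v" if "v \<in> S" for v
        by (rule indepD[OF S(1), of "\<lambda>v. f v - g v"]) (rule that)
      show "f = g"
      proof
        fix v
        show "f v = g v"
        proof (cases "v \<in> S")
          case True
          hence "f v \<in> {0..<int p}" "g v \<in> {0..<int p}" using fg by (auto simp: F_def)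
          hence "f v mod int p = f v" "g v mod int p = g v" by auto
          thus ?thesis using d[OF True] by (metis mod_eq_dvd_iff)
        qed (use fg in \<open>auto simp: F_def PiE_def extensional_def\<close>)
      qed
    qed
    show "\<Phi> ` F = carrier k\<^sub>P"
    proof
      show "\<Phi> ` F \<subseteq> carrier k\<^sub>P"
        using Sint by (auto simp: \<Phi>_def carrier_residue intro!: imageI int_sum int_mult)
      show "carrier k\<^sub>P \<subseteq> \<Phi> ` F"
      proof
        fix X assume "X \<in> carrier k\<^sub>P"
        then obtain x where x: "algebraic_int x" "X = cls x" by (auto simp: carrier_residue)
        obtain c where c: "x - (\<Sum>v\<in>S. of_int (c v) * v) \<in> P" using S(2)[OF x(1)] by blast
        define f where "f = restrict (\<lambda>v. c v mod int p) S"
        have f: "f \<in> F" using p0 by (auto simp: f_def F_def)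
        have "(\<Sum>v\<in>S. of_int (c v) * v) - (\<Sum>v\<in>S. of_int (f v) * v) =
            (\<Sum>v\<in>S. (of_int (c v div int p) * v) * of_nat p)"
          unfolding sum_subtractf[symmetric] left_diff_distrib[symmetric] of_int_diff[symmetric]
        proof (intro sum.cong refl)
          fix v assume "v \<in> S"
          hence "c v - f v = c v div int p * int p" by (simp add: f_def minus_mod_eq_div_mult)
          thus "of_int (c v - f v) * v = of_int (c v div int p) * v * of_nat p" by simp
        qed
        also have "\<dots> \<in> P" using Sint p(2) by (intro P_sum P_mult int_mult) auto
        finally have "x - (\<Sum>v\<in>S. of_int (f v) * v) \<in> P" using P_add[OF c] by fastforce
        hence "X = \<Phi> f" by (simp add: x \<Phi>_def cls_eq_iff)
        thus "X \<in> \<Phi> ` F" using f by blast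
      qed
    qed
  qed
  moreover have "finite F" unfolding F_def using fin by (intro finite_PiE) auto
  moreover have "card F = p ^ card S" unfolding F_def using fin by (simp add: card_PiE)
  ultimately have "finite (carrier k\<^sub>P)" "prime_norm P = p ^ card S"
    by (auto simp: prime_norm_def bij_betw_same_card dest: bij_betw_finite)
  moreover have "card S > 0"
  proof (rule ccontr)
    assume "\<not> card S > 0"
    hence "S = {}" using fin by simp
    thus False using S(2)[of 1] P_1 by simp
  qed
  ultimately show ?thesis by blast
qed

end

lemma (in domain) finite_domain_is_field:
  assumes "finite (carrier R)"
  shows "field R"
proof (rule cring_fieldI)
  show "Units R = carrier R - {\<zero>}"
  proof
    show "Units R \<subseteq> carrier R - {\<zero>}"
      using Units_closed zero_not_one by (auto simp: Units_def)
    show "carrier R - {\<zero>} \<subseteq> Units R"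
    proof
      fix x assume x: "x \<in> carrier R - {\<zero>}"
      have "inj_on (\<lambda>y. x \<otimes> y) (carrier R)"
        using x by (intro inj_onI) (simp add: m_lcancel)
      hence "(\<lambda>y. x \<otimes> y) ` carrier R = carrier R"
        using x assms by (intro endo_inj_surj) auto
      then obtain y where "y \<in> carrier R" "x \<otimes> y = \<one>" using one_closed by (metis imageE)
      moreover from this have "y \<otimes> x = \<one>" using x m_comm by simp
      ultimately show "x \<in> Units R" using x by (auto simp: Units_def)
    qed
  qed
qed

section \<open>Fermat and power sums in the residue field\<close>

locale nf_residue = nf_place +
  fixes p r :: nat
  assumes p: "prime p" "(of_nat p :: 'a) \<in> P"
    and fin: "finite (carrier (residue_field P))"
    and norm: "prime_norm P = p ^ r" and r: "r > 0"
begin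

abbreviation "N \<equiv> prime_norm P"

lemma cls_ops:
  assumes "algebraic_int x" "algebraic_int y"
  shows "cls x \<otimes>\<^bsub>k\<^sub>P\<^esub> cls y = cls (x * y)" "cls x \<oplus>\<^bsub>k\<^sub>P\<^esub> cls y = cls (x + y)"
  using ring_hom_mult[OF rcos_ring_hom, of x y] ring_hom_add[OF rcos_ring_hom, of x y] assms
  by (simp_all add: cls_coset residue_field_def) (simp_all add: ring_of_integers_def)

lemma cls_one: "\<one>\<^bsub>k\<^sub>P\<^esub> = cls 1"
  using ring_hom_one[OF rcos_ring_hom] by (simp add: cls_coset residue_field_def) (simp add: ring_of_integers_def)

lemma cls_zero: "\<zero>\<^bsub>k\<^sub>P\<^esub> = cls 0"
  by (simp add: residue_field_def FactRing_def cls_def)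

lemma cls_pow: "algebraic_int x \<Longrightarrow> cls x [^]\<^bsub>k\<^sub>P\<^esub> (n :: nat) = cls (x ^ n)"
  by (induction n) (simp_all add: cls_one cls_ops int_power mult.commute)

lemma residue_is_field: "field k\<^sub>P"
  using domain.finite_domain_is_field[OF quotient_is_domain] fin by (simp add: residue_field_def)

lemma ex_inverse_mod:
  assumes "algebraic_int s" "s \<notin> P"
  shows "\<exists>t. algebraic_int t \<and> s * t - 1 \<in> P"
proof -
  interpret K: field k\<^sub>P by (rule residue_is_field)
  have "cls s \<in> carrier k\<^sub>P - {\<zero>\<^bsub>k\<^sub>P\<^esub>}"
    using assms by (auto simp: carrier_residue cls_zero cls_eq_iff)
  hence "\<exists>y\<in>carrier k\<^sub>P. cls s \<otimes>\<^bsub>k\<^sub>P\<^esub> y = \<one>\<^bsub>k\<^sub>P\<^esub>"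
    unfolding K.field_Units[symmetric] by (auto simp: Units_def)
  then obtain t where "algebraic_int t" "cls s \<otimes>\<^bsub>k\<^sub>P\<^esub> cls t = \<one>\<^bsub>k\<^sub>P\<^esub>"
    by (auto simp: carrier_residue)
  thus ?thesis using assms by (auto simp: cls_ops cls_one cls_eq_iff)
qed

text \<open>The localization and the ring of integers have the same residue field: a denominator
  outside \<open>P\<close> is inverted modulo \<open>P\<close>.\<close>

lemma ex_int_eqv:
  assumes "x \<in> A"
  shows "\<exists>y. algebraic_int y \<and> y \<approx> x"
proof -
  obtain s where s: "algebraic_int s" "s \<notin> P" "algebraic_int (x * s)" using assms by (auto simp: A_iff)
  obtain t where t: "algebraic_int t" "s * t - 1 \<in> P" using ex_inverse_mod[OF s(1,2)] by blast
  have "x * s * t - x = x * (s * t - 1)" by (simp add: algebra_simps)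
  also have "\<dots> \<in> M" using assms P_M[OF t(2)] by (intro M_mult)
  finally show ?thesis using s t int_mult by (auto simp: eqv_def)
qed

lemma int_eqv_iff: "algebraic_int x \<Longrightarrow> algebraic_int y \<Longrightarrow> x \<approx> y \<longleftrightarrow> x - y \<in> P"
  unfolding eqv_def using M_int P_M int_diff by blast

text \<open>Representatives allow sums over the residue field to be formed in the number field and
  compared by \<open>eqv\<close>.\<close>

definition reps :: "'a set" where "reps = (\<lambda>X. SOME x. x \<in> X) ` carrier k\<^sub>P"

lemma some_cls:
  assumes "algebraic_int x"
  shows "algebraic_int (SOME y. y \<in> cls x)" "cls (SOME y. y \<in> cls x) = cls x"
proof -
  have "(SOME y. y \<in> cls x) \<in> cls x" by (rule someI[of _ x]) (simp add: cls_def P_0)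
  hence *: "(SOME y. y \<in> cls x) - x \<in> P" by (simp add: cls_def)
  thus "cls (SOME y. y \<in> cls x) = cls x" by (simp add: cls_eq_iff)
  show "algebraic_int (SOME y. y \<in> cls x)" using int_add[OF P_int[OF *] assms] by simp
qed

lemma reps_int: "t \<in> reps \<Longrightarrow> algebraic_int t"
  using some_cls by (auto simp: reps_def carrier_residue)

lemma reps_A: "t \<in> reps \<Longrightarrow> t \<in> A"
  using reps_int int_A by blast

lemma bij_cls_reps: "bij_betw cls reps (carrier k\<^sub>P)"
proof (rule bij_betw_imageI)
  show "inj_on cls reps" using some_cls by (auto simp: inj_on_def reps_def carrier_residue)
  show "cls ` reps = carrier k\<^sub>P"
    using some_cls(2) by (auto simp: reps_def carrier_residue image_image)
qed

lemma finite_reps [simp]: "finite reps" and card_reps: "card reps = N"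
  using bij_cls_reps fin by (auto simp: bij_betw_finite bij_betw_same_card prime_norm_def)

lemma reps_eqvD: "s \<in> reps \<Longrightarrow> t \<in> reps \<Longrightarrow> s \<approx> t \<Longrightarrow> s = t"
  using bij_cls_reps reps_int by (auto simp: int_eqv_iff bij_betw_def inj_on_def cls_eq_iff)

lemma ex_rep:
  assumes "x \<in> A"
  shows "\<exists>t\<in>reps. t \<approx> x"
proof -
  obtain y where y: "algebraic_int y" "y \<approx> x" using ex_int_eqv[OF assms] by blast
  have "cls y \<in> cls ` reps" using bij_cls_reps y(1) by (simp add: bij_betw_def carrier_residue)
  then obtain t where t: "t \<in> reps" "cls y = cls t" by blast
  hence "t \<approx> y" using y by (metis cls_eq_iff eqv_def P_M)
  thus ?thesis using t y eqv_trans by blast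
qed

lemma sum_reps_permute:
  assumes \<sigma>: "\<And>t. t \<in> reps \<Longrightarrow> \<sigma> t \<in> A" "\<And>s t. s \<in> reps \<Longrightarrow> t \<in> reps \<Longrightarrow> \<sigma> s \<approx> \<sigma> t \<Longrightarrow> s \<approx> t"
    and F: "\<And>x y. x \<in> A \<Longrightarrow> y \<in> A \<Longrightarrow> x \<approx> y \<Longrightarrow> F x \<approx> F y"
  shows "(\<Sum>t\<in>reps. F (\<sigma> t)) \<approx> (\<Sum>t\<in>reps. F t)"
proof -
  have "\<forall>t\<in>reps. \<exists>u. u \<in> reps \<and> u \<approx> \<sigma> t" using ex_rep \<sigma>(1) by blast
  then obtain \<pi> where \<pi>: "\<And>t. t \<in> reps \<Longrightarrow> \<pi> t \<in> reps" "\<And>t. t \<in> reps \<Longrightarrow> \<pi> t \<approx> \<sigma> t" by metis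
  have inj: "inj_on \<pi> reps"
  proof (rule inj_onI)
    fix s t assume st: "s \<in> reps" "t \<in> reps" "\<pi> s = \<pi> t"
    hence "\<sigma> s \<approx> \<sigma> t" using \<pi>(2) eqv_sym eqv_trans by metis
    thus "s = t" using st \<sigma>(2) reps_eqvD by blast
  qed
  hence im: "\<pi> ` reps = reps" using \<pi>(1) by (intro endo_inj_surj) auto
  have "(\<Sum>t\<in>reps. F (\<sigma> t)) \<approx> (\<Sum>t\<in>reps. F (\<pi> t))"
    using \<pi> \<sigma>(1) reps_A by (intro eqv_sum F eqv_sym[OF \<pi>(2)]) auto
  also have "(\<Sum>t\<in>reps. F (\<pi> t)) = (\<Sum>t\<in>reps. F t)"
    using sum.reindex[OF inj, of F] im by simp
  finally show ?thesis .
qed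

lemma residue_generator:
  shows "\<exists>g. algebraic_int g \<and> g \<notin> P \<and> (\<forall>k. 0 < k \<and> k < N - 1 \<longrightarrow> g ^ k - 1 \<notin> P)"
    and "algebraic_int x \<Longrightarrow> x \<notin> P \<Longrightarrow> x ^ (N - 1) - 1 \<in> P"
proof -
  interpret K: field k\<^sub>P by (rule residue_is_field)
  interpret G: group "mult_of k\<^sub>P" by (rule K.field_mult_group)
  have order: "Coset.order (mult_of k\<^sub>P) = N - 1"
    using K.order_mult_of fin by (simp add: Coset.order_def prime_norm_def)
  have unit: "cls x \<in> carrier (mult_of k\<^sub>P) \<longleftrightarrow> x \<notin> P" if "algebraic_int x" for x
    using that by (auto simp: carrier_residue cls_zero cls_eq_iff)
  {
    assume x: "algebraic_int x" "x \<notin> P"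
    have "cls x [^]\<^bsub>mult_of k\<^sub>P\<^esub> Coset.order (mult_of k\<^sub>P) = \<one>\<^bsub>mult_of k\<^sub>P\<^esub>"
      using x unit by (intro G.pow_order_eq_1) auto
    thus "x ^ (N - 1) - 1 \<in> P"
      using x by (simp add: order nat_pow_mult_of cls_pow cls_one cls_eq_iff)
  }
  obtain X where X: "X \<in> carrier (mult_of k\<^sub>P)" "carrier (mult_of k\<^sub>P) = {X [^]\<^bsub>k\<^sub>P\<^esub> i | i::nat. i \<in> UNIV}"
    using K.finite_field_mult_group_has_gen[OF fin] by blast
  then obtain g where g: "algebraic_int g" "X = cls g" by (auto simp: carrier_residue)
  have gP: "g \<notin> P" using X(1) unit[OF g(1)] unfolding g(2) by blast
  have "g ^ k - 1 \<notin> P" if k: "0 < k" "k < N - 1" for k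
  proof
    assume "g ^ k - 1 \<in> P"
    hence gk: "X [^]\<^bsub>k\<^sub>P\<^esub> k = \<one>\<^bsub>k\<^sub>P\<^esub>" using g by (simp add: cls_pow cls_one cls_eq_iff)
    have "carrier (mult_of k\<^sub>P) \<subseteq> (\<lambda>i. X [^]\<^bsub>k\<^sub>P\<^esub> i) ` {..<k}"
    proof
      fix Y assume "Y \<in> carrier (mult_of k\<^sub>P)"
      then obtain i :: nat where "Y = X [^]\<^bsub>k\<^sub>P\<^esub> i" using X(2) by auto
      also have "i = k * (i div k) + i mod k" by simp
      also have "X [^]\<^bsub>k\<^sub>P\<^esub> \<dots> = (X [^]\<^bsub>k\<^sub>P\<^esub> k) [^]\<^bsub>k\<^sub>P\<^esub> (i div k) \<otimes>\<^bsub>k\<^sub>P\<^esub> X [^]\<^bsub>k\<^sub>P\<^esub> (i mod k)"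
        using X(1) by (simp add: K.nat_pow_mult K.nat_pow_pow)
      also have "\<dots> = X [^]\<^bsub>k\<^sub>P\<^esub> (i mod k)" using X(1) by (simp add: gk)
      finally show "Y \<in> (\<lambda>i. X [^]\<^bsub>k\<^sub>P\<^esub> i) ` {..<k}" using k by auto
    qed
    hence "card (carrier (mult_of k\<^sub>P)) \<le> card ((\<lambda>i. X [^]\<^bsub>k\<^sub>P\<^esub> i) ` {..<k})"
      by (intro card_mono) auto
    also have "\<dots> \<le> k" using card_image_le[of "{..<k}"] by simp
    finally show False using order k by (simp add: Coset.order_def del: carrier_mult_of)
  qed
  thus "\<exists>g. algebraic_int g \<and> g \<notin> P \<and> (\<forall>k. 0 < k \<and> k < N - 1 \<longrightarrow> g ^ k - 1 \<notin> P)"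
    using g gP by blast
qed

lemma fermat_A:
  assumes "x \<in> A" "x \<notin> M"
  shows "x ^ (N - 1) \<approx> 1"
proof -
  obtain y where y: "algebraic_int y" "y \<approx> x" using ex_int_eqv[OF assms(1)] by blast
  have "y \<notin> P"
  proof
    assume "y \<in> P"
    hence "y - (y - x) \<in> M" using y(2) unfolding eqv_def by (rule M_diff[OF P_M])
    moreover have "y - (y - x) = x" by simp
    ultimately show False using assms by (simp only:)
  qed
  hence "y ^ (N - 1) \<approx> 1" using residue_generator(2)[OF y(1)] by (simp add: eqv_def P_M)
  moreover have "x ^ (N - 1) \<approx> y ^ (N - 1)" using y int_A by (intro eqv_power eqv_sym[OF y(2)])
  ultimately show ?thesis using eqv_trans by blast
qed

lemma N_gt_1: "N > 1"
  unfolding norm using prime_gt_1_nat[OF p(1)] r by (rule one_less_power)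

lemma of_nat_N_eqv: "of_nat N \<approx> 0"
proof -
  have "(of_nat N :: 'a) = of_nat p * of_nat p ^ (r - 1)"
    using r by (cases r) (simp_all add: norm)
  thus ?thesis using M_mult[OF _ P_M[OF p(2)], of "of_nat p ^ (r - 1)"]
    by (simp add: eqv_def mult.commute A_power)
qed

lemma fermat_A_N:
  assumes "x \<in> A"
  shows "x ^ N \<approx> x"
proof -
  have N: "x ^ N = x * x ^ (N - 1)" using N_gt_1 by (cases N) auto
  show ?thesis
  proof (cases "x \<in> M")
    case True
    hence "x ^ (N - 1) * x - x \<in> M" using assms by (intro M_diff M_mult A_power)
    thus ?thesis by (simp add: eqv_def N mult.commute)
  next
    case False
    thus ?thesis using eqv_mult_left[OF assms fermat_A[OF assms False]] by (simp add: N)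
  qed
qed

text \<open>If N - 1 does not divide \<open>k\<close>, the substitution t -> g t with a primitive
  root multiplies the sum by g^k, which is not 1. For \<open>k = 0\<close> the sum is
  \<open>N\<close>, as 0^0 = 1, and this is 0 modulo the ideal.\<close>

lemma power_sum:
  "(\<Sum>t\<in>reps. t ^ k) \<approx> (if k > 0 \<and> (N - 1) dvd k then - 1 else 0)"
proof -
  consider "k = 0" | "k > 0" "(N - 1) dvd k" | "k > 0" "\<not> (N - 1) dvd k" by blast
  thus ?thesis
  proof cases
    case 1
    thus ?thesis using of_nat_N_eqv by (simp add: card_reps)
  next
    case 2
    obtain t0 where t0: "t0 \<in> reps" "t0 \<approx> 0" using ex_rep[of 0] by auto
    have "t ^ k \<approx> (if t = t0 then 0 else 1)" if t: "t \<in> reps" for t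
    proof (cases "t = t0")
      case True
      thus ?thesis using eqv_power[OF t0(2), of k] 2 by (simp add: zero_power)
    next
      case False
      have "t \<notin> M"
      proof
        assume "t \<in> M"
        hence "t \<approx> t0" using t0(2) by (metis eqv_def diff_zero eqv_sym eqv_trans)
        thus False using False t t0 reps_eqvD by blast
      qed
      hence "t ^ (N - 1) \<approx> 1" using t reps_A fermat_A by blast
      moreover obtain c where "k = (N - 1) * c" using 2(2) by (elim dvdE)
      ultimately show ?thesis using eqv_power[of "t ^ (N - 1)" 1 c] False by (simp add: power_mult)
    qed
    hence "(\<Sum>t\<in>reps. t ^ k) \<approx> (\<Sum>t\<in>reps. if t = t0 then 0 else 1)" by (rule eqv_sum)
    also have "(\<Sum>t\<in>reps. if t = t0 then 0 else 1) = (\<Sum>t\<in>reps - {t0}. 1 :: 'a)"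
      by (rule sum.mono_neutral_cong_right) auto
    also have "\<dots> = of_nat N - 1" using t0 N_gt_1 by (simp add: card_reps of_nat_diff)
    also have "\<dots> \<approx> 0 - 1" by (rule eqv_diff[OF of_nat_N_eqv]) simp
    finally show ?thesis using 2 by simp
  next
    case 3
    obtain g where g: "algebraic_int g" "g \<notin> P" "\<And>k. 0 < k \<Longrightarrow> k < N - 1 \<Longrightarrow> g ^ k - 1 \<notin> P"
      using residue_generator(1) by blast
    have gA: "g \<in> A" "g \<notin> M" using g int_A M_int by auto
    have gk: "\<not> g ^ k \<approx> 1"
    proof
      assume *: "g ^ k \<approx> 1"
      define l where "l = k mod (N - 1)"
      have "g ^ k = (g ^ (N - 1)) ^ (k div (N - 1)) * g ^ l"
        by (simp add: l_def power_mult[symmetric] power_add[symmetric])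
      also have "\<dots> \<approx> 1 ^ (k div (N - 1)) * g ^ l"
        using gA by (intro eqv_mult eqv_power fermat_A A_power) auto
      finally have "g ^ l \<approx> 1" using * by (metis eqv_sym eqv_trans power_one mult_1)
      hence "g ^ l - 1 \<in> P" using g(1) by (simp add: int_eqv_iff int_power)
      moreover have "l < N - 1" "l > 0" using 3 N_gt_1 by (auto simp: l_def mod_greater_zero_iff_not_dvd)
      ultimately show False using g(3) by blast
    qed
    have "(\<Sum>t\<in>reps. (g * t) ^ k) \<approx> (\<Sum>t\<in>reps. t ^ k)"
    proof (rule sum_reps_permute)
      fix s t assume "g * s \<approx> g * t"
      thus "s \<approx> t" by (rule eqv_cancel[OF gA])
    qed (auto intro: A_mult gA reps_A eqv_power)
    hence "(g ^ k - 1) * (\<Sum>t\<in>reps. t ^ k) \<in> M"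
      by (simp add: eqv_def power_mult_distrib sum_distrib_left left_diff_distrib sum_subtractf)
    hence "(\<Sum>t\<in>reps. t ^ k) \<in> M"
      using gk gA reps_A by (metis eqv_def M_prime A_diff A_power A_sum A_consts(2))
    thus ?thesis using 3 by (simp add: eqv_def)
  qed
qed

end

section \<open>Binomial coefficients modulo p\<close>

lemma prime_dvd_choose_prime_power:
  assumes "prime p" "0 < i" "i < p ^ r"
  shows "p dvd (p ^ r) choose i"
proof -
  obtain j where j: "i = Suc j" using assms(2) by (cases i) auto
  obtain n where n: "p ^ r = Suc n" using assms by (cases "p ^ r") auto
  have "Suc j * (Suc n choose Suc j) = Suc n * (n choose j)" 
    using Suc_times_binomial_eq[of n j] by (simp only: mult.commute)
  hence "int i * int (p ^ r choose i) = int (p ^ r) * int (n choose j)"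
    unfolding j n by (metis of_nat_mult)
  hence "int p dvd int (p ^ r choose i)"
    using assms by (intro prime_dvd_of_mult_eq[of p i _ r "int (n choose j)"]) (auto dest: dvd_imp_le)
  thus ?thesis by simp
qed

text \<open>Pascal's rule: neighbouring entries of row N - 1 sum to an inner entry of row N, which
  is 0 modulo \<open>p\<close>.\<close>

lemma choose_prime_power_minus_1:
  assumes "prime p" "i < p ^ r"
  shows "int p dvd int ((p ^ r - 1) choose i) - (- 1) ^ i"
  using assms(2)
proof (induction i)
  case (Suc i)
  obtain n where n: "p ^ r = Suc n" using Suc.prems by (cases "p ^ r") auto
  have "int p dvd int (p ^ r choose Suc i)"
    using prime_dvd_choose_prime_power[OF assms(1) _ Suc.prems] by simp
  moreover have "int p dvd int ((p ^ r - 1) choose i) - (- 1) ^ i" using Suc by simp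
  ultimately have "int p dvd int (p ^ r choose Suc i) - (int ((p ^ r - 1) choose i) - (- 1) ^ i)"
    by (rule dvd_diff)
  moreover have "int ((p ^ r - 1) choose Suc i) - (- 1) ^ Suc i =
      int (p ^ r choose Suc i) - (int ((p ^ r - 1) choose i) - (- 1) ^ i)"
    unfolding n by simp
  ultimately show ?case by (simp only:)
qed simp

text \<open>Modulo \<open>p\<close> this is \<open>(x - y)\<^bsup>N-1\<^esup> = (x\<^bsup>N\<^esup> - y\<^bsup>N\<^esup>) / (x - y)\<close>.\<close>
lemma diff_power_prime_power_minus_1:
  assumes "prime p" "N = p ^ r" "odd N"
  shows "\<exists>d :: nat \<Rightarrow> int. \<forall>x y :: 'b::comm_ring_1. (x - y) ^ (N - 1) =
    (\<Sum>i\<le>N-1. x ^ i * y ^ (N - 1 - i)) + of_nat p * (\<Sum>i\<le>N-1. of_int (d i) * x ^ i * y ^ (N - 1 - i))"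
proof -
  have N0: "N > 0" using assms by (simp add: prime_gt_0_nat)
  have "\<exists>d. i \<le> N - 1 \<longrightarrow> int ((N - 1) choose i) = (- 1) ^ i + int p * d" for i
  proof (cases "i \<le> N - 1")
    case True
    have "i < p ^ r" using True N0 unfolding assms(2) by linarith
    hence "int p dvd int ((N - 1) choose i) - (- 1) ^ i"
      unfolding assms(2) by (rule choose_prime_power_minus_1[OF assms(1)])
    then obtain d where "int ((N - 1) choose i) - (- 1) ^ i = int p * d" by (elim dvdE)
    thus ?thesis by (intro exI[of _ d]) simp
  qed simp
  then obtain d where d: "\<And>i. i \<le> N - 1 \<Longrightarrow> int ((N - 1) choose i) = (- 1) ^ i + int p * d i" by metis
  have "(x - y) ^ (N - 1) = (\<Sum>i\<le>N-1. x ^ i * y ^ (N - 1 - i)) +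
      of_nat p * (\<Sum>i\<le>N-1. of_int (d i * (- 1) ^ (N - 1 - i)) * x ^ i * y ^ (N - 1 - i))" for x y :: 'b
  proof -
    have "(x - y) ^ (N - 1) = (x + - y) ^ (N - 1)" by simp
    also have "\<dots> = (\<Sum>i\<le>N-1. of_nat ((N - 1) choose i) * x ^ i * (- y) ^ (N - 1 - i))"
      by (rule binomial_ring)
    also have "\<dots> = (\<Sum>i\<le>N-1. x ^ i * y ^ (N - 1 - i) +
        of_nat p * (of_int (d i * (- 1) ^ (N - 1 - i)) * x ^ i * y ^ (N - 1 - i)))"
    proof (intro sum.cong refl)
      fix i assume "i \<in> {..N - 1}"
      hence i: "i \<le> N - 1" by simp
      have "(of_nat ((N - 1) choose i) :: 'b) = of_int (int ((N - 1) choose i))" by simp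
      also have "\<dots> = (- 1) ^ i + of_nat p * of_int (d i)" unfolding d[OF i] by simp
      finally have b: "(of_nat ((N - 1) choose i) :: 'b) = (- 1) ^ i + of_nat p * of_int (d i)" .
      have "even (N - 1)" "i + (N - 1 - i) = N - 1" using i assms(3) by simp_all
      hence s: "(- 1 :: 'b) ^ i * (- 1) ^ (N - 1 - i) = 1"
        by (metis neg_one_even_power power_add)
      have m: "(- y) ^ (N - 1 - i) = (- 1) ^ (N - 1 - i) * y ^ (N - 1 - i)" by (rule power_minus)
      have "of_nat ((N - 1) choose i) * x ^ i * (- y) ^ (N - 1 - i) =
          ((- 1) ^ i * (- 1) ^ (N - 1 - i)) * (x ^ i * y ^ (N - 1 - i)) +
          of_nat p * (of_int (d i * (- 1) ^ (N - 1 - i)) * x ^ i * y ^ (N - 1 - i))"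
        unfolding b m by (simp add: algebra_simps)
      thus "of_nat ((N - 1) choose i) * x ^ i * (- y) ^ (N - 1 - i) = x ^ i * y ^ (N - 1 - i) +
          of_nat p * (of_int (d i * (- 1) ^ (N - 1 - i)) * x ^ i * y ^ (N - 1 - i))"
        unfolding s by simp
    qed
    finally show ?thesis by (simp add: sum.distrib sum_distrib_left)
  qed
  thus ?thesis by (intro exI[of _ "\<lambda>i. d i * (- 1) ^ (N - 1 - i)"] allI)
qed

section \<open>The trace of Frobenius and the Hasse polynomial\<close>

definition c6 :: "'a::comm_ring_1 weierstrass \<Rightarrow> 'a" where
  "c6 W = - (b2 W ^ 3) + 36 * b2 W * b4 W - 216 * b6 W"

lemma discriminant_c4_c6: "1728 * discriminant W = c4 W ^ 3 - c6 W ^ 2"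
  for W :: "'a::comm_ring_1 weierstrass"
  unfolding discriminant_def c4_def c6_def b2_def b4_def b6_def b8_def
  by (simp add: eval_nat_numeral algebra_simps)

definition affine_eq :: "'a::comm_ring_1 weierstrass \<Rightarrow> 'a \<Rightarrow> 'a \<Rightarrow> 'a" where
  "affine_eq W x y = y ^ 2 + a1 W * x * y + a3 W * y - (x ^ 3 + a2 W * x ^ 2 + a4 W * x + a6 W)"

text \<open>Completing the square and the cube without denominators: x is scaled by 6^2 and y by
  6^3, so the equation is scaled by 6^6 = 46656.\<close>

lemma affine_eq_short:
  "46656 * affine_eq W x y =
     (216 * y + 108 * (a1 W * x + a3 W)) ^ 2 - poly (weier (c4 W) (- c6 W)) (36 * x + 3 * b2 W)"
  for W :: "'a::comm_ring_1 weierstrass"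
  unfolding affine_eq_def weier_def c4_def c6_def b2_def b4_def b6_def
  by (simp add: eval_nat_numeral algebra_simps)

context nf_residue
begin

lemma weierstrass_points_card:
  assumes W: "set_weierstrass W \<subseteq> A"
  shows "card (curve_points k\<^sub>P (map_weierstrass (reduce_mod P) W)) =
    1 + card {(x, y). x \<in> reps \<and> y \<in> reps \<and> affine_eq W x y \<in> M}"
proof -
  have red: "\<exists>v. algebraic_int v \<and> v \<approx> u \<and> reduce_mod P u = cls v" if u: "u \<in> A" for u
  proof -
    obtain v where v: "algebraic_int v" "v \<approx> u" using ex_int_eqv[OF u] by blast
    have "z - u \<in> M \<longleftrightarrow> z - v \<in> P" if z: "algebraic_int z" for z
    proof -
      have "z - u \<in> M \<longleftrightarrow> z \<approx> v" using v(2) eqv_sym eqv_trans unfolding eqv_def[symmetric] by blast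
      thus ?thesis using int_eqv_iff[OF z v(1)] by simp
    qed
    moreover have "algebraic_int z" if "z - v \<in> P" for z
      using int_add[OF P_int[OF that] v(1)] by simp
    ultimately have "reduce_mod P u = cls v" by (auto simp: reduce_mod_def cls_def)
    thus ?thesis using v by blast
  qed
  have WA: "a1 W \<in> A" "a2 W \<in> A" "a3 W \<in> A" "a4 W \<in> A" "a6 W \<in> A"
    using W by (cases W; auto)+
  obtain v1 v2 v3 v4 v6 where
    v: "algebraic_int v1" "algebraic_int v2" "algebraic_int v3" "algebraic_int v4" "algebraic_int v6"
    and e: "v1 \<approx> a1 W" "v2 \<approx> a2 W" "v3 \<approx> a3 W" "v4 \<approx> a4 W" "v6 \<approx> a6 W"
    and m: "reduce_mod P (a1 W) = cls v1" "reduce_mod P (a2 W) = cls v2" "reduce_mod P (a3 W) = cls v3"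
      "reduce_mod P (a4 W) = cls v4" "reduce_mod P (a6 W) = cls v6"
    using red[OF WA(1)] red[OF WA(2)] red[OF WA(3)] red[OF WA(4)] red[OF WA(5)] by metis
  define W' where "W' = map_weierstrass (reduce_mod P) W"
  have W': "a1 W' = cls v1" "a2 W' = cls v2" "a3 W' = cls v3" "a4 W' = cls v4" "a6 W' = cls v6"
    unfolding W'_def using m by (cases W; simp)+
  define E where "E = (\<lambda>X Y. Y [^]\<^bsub>k\<^sub>P\<^esub> (2::nat) \<oplus>\<^bsub>k\<^sub>P\<^esub> a1 W' \<otimes>\<^bsub>k\<^sub>P\<^esub> X \<otimes>\<^bsub>k\<^sub>P\<^esub> Y \<oplus>\<^bsub>k\<^sub>P\<^esub> a3 W' \<otimes>\<^bsub>k\<^sub>P\<^esub> Y =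
     X [^]\<^bsub>k\<^sub>P\<^esub> (3::nat) \<oplus>\<^bsub>k\<^sub>P\<^esub> a2 W' \<otimes>\<^bsub>k\<^sub>P\<^esub> X [^]\<^bsub>k\<^sub>P\<^esub> (2::nat) \<oplus>\<^bsub>k\<^sub>P\<^esub> a4 W' \<otimes>\<^bsub>k\<^sub>P\<^esub> X \<oplus>\<^bsub>k\<^sub>P\<^esub> a6 W')"
  have E: "E (cls x) (cls y) \<longleftrightarrow> affine_eq W x y \<in> M" if xy: "algebraic_int x" "algebraic_int y" for x y
  proof -
    define l where "l = y ^ 2 + v1 * x * y + v3 * y"
    define l' where "l' = x ^ 3 + v2 * x ^ 2 + v4 * x + v6"
    have "E (cls x) (cls y) \<longleftrightarrow> cls l = cls l'"
      unfolding E_def W' l_def l'_def using v xy by (simp add: cls_pow cls_ops int_power int_mult int_add)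
    also have "\<dots> \<longleftrightarrow> l - l' \<in> M"
      unfolding cls_eq_iff using v xy
      by (metis P_M M_int l_def l'_def int_power int_mult int_add int_diff)
    also have "\<dots> \<longleftrightarrow> affine_eq W x y \<in> M"
    proof -
      have xyA: "x \<in> A" "y \<in> A" using xy int_A by auto
      have "l \<approx> y ^ 2 + a1 W * x * y + a3 W * y"
        unfolding l_def using xyA e WA by (intro eqv_add eqv_mult eqv_refl A_mult)
      moreover have "l' \<approx> x ^ 3 + a2 W * x ^ 2 + a4 W * x + a6 W"
        unfolding l'_def using xyA e WA by (intro eqv_add eqv_mult eqv_refl A_mult A_power)
      ultimately have "l - l' \<approx> affine_eq W x y" unfolding affine_eq_def by (rule eqv_diff)
      thus ?thesis
        by (metis diff_zero eqv_def eqv_sym eqv_trans)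
    qed
    finally show ?thesis .
  qed
  define S where "S = {(x, y). x \<in> reps \<and> y \<in> reps \<and> affine_eq W x y \<in> M}"
  have carr: "carrier k\<^sub>P = cls ` reps" using bij_cls_reps by (simp add: bij_betw_def)
  have "{(X, Y). X \<in> carrier k\<^sub>P \<and> Y \<in> carrier k\<^sub>P \<and> E X Y} = (\<lambda>(x, y). (cls x, cls y)) ` S"
    unfolding carr S_def using E reps_int by (auto simp: image_iff)
  hence "curve_points k\<^sub>P W' = insert None (Some ` (\<lambda>(x, y). (cls x, cls y)) ` S)"
    unfolding curve_points_def E_def by simp
  moreover have "inj_on (\<lambda>(x, y). (cls x, cls y)) S"
    using bij_cls_reps unfolding S_def bij_betw_def inj_on_def by auto
  moreover have "S \<subseteq> reps \<times> reps" by (auto simp: S_def)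
  hence "finite S" by (rule finite_subset) simp
  ultimately show ?thesis
    by (simp add: W'_def[symmetric] S_def[symmetric] card_insert_if card_image image_iff)
qed

lemma coeff_weier_power_A:
  assumes "a \<in> A" "b \<in> A"
  shows "poly.coeff (weier a b ^ n) i \<in> A"
proof (induction n arbitrary: i)
  case (Suc n)
  show ?case unfolding power_Suc coeff_weier_mult using Suc.IH assms by (auto intro!: A_intros)
qed (auto simp: one_pCons coeff_pCons split: nat.split)

text \<open>The Chevalley-Warning count. Each summand is 1 or 0 modulo the ideal according to
  whether (x, y) is on the curve, and \<open>power_sum\<close> leaves only exponents that are
  positive multiples of N - 1.\<close>

lemma short_points_sum:
  assumes ab: "a \<in> A" "b \<in> A" and N: "N = 2 * m + 1"
  shows "(\<Sum>x\<in>reps. \<Sum>y\<in>reps. 1 - (y ^ 2 - poly (weier a b) x) ^ (N - 1)) \<approx> - hasse m a b"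
proof -
  define f where "f = (\<lambda>x. poly (weier a b) x)"
  define C where "C = (\<lambda>i. poly.coeff (weier a b ^ m) i)"
  have m: "m > 0" "N - 1 = 2 * m" using N N_gt_1 by auto
  have CA: "C i \<in> A" for i unfolding C_def by (rule coeff_weier_power_A[OF ab])
  have fA: "f x \<in> A" if "x \<in> A" for x
    unfolding f_def weier_def using ab that by (auto intro!: A_intros)
  obtain d :: "nat \<Rightarrow> int" where d: "\<forall>x y :: 'a. (x - y) ^ (N - 1) =
    (\<Sum>i\<le>N-1. x ^ i * y ^ (N - 1 - i)) + of_nat p * (\<Sum>i\<le>N-1. of_int (d i) * x ^ i * y ^ (N - 1 - i))"
    using diff_power_prime_power_minus_1[OF p(1) norm] N by fastforce
  have D: "(x - y) ^ (N - 1) \<approx> (\<Sum>i\<le>N-1. x ^ i * y ^ (N - 1 - i))" if "x \<in> A" "y \<in> A" for x y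
  proof -
    \<comment> \<open>Membership of p times this sum in \<open>M\<close> needs an integral cofactor;
      the explicit integers \<open>d i\<close> supply it.\<close>
    have "(\<Sum>i\<le>N-1. of_int (d i) * x ^ i * y ^ (N - 1 - i)) * of_nat p \<in> M"
      using that P_M[OF p(2)] by (intro M_mult A_sum A_mult A_power) auto
    thus ?thesis unfolding d[rule_format] eqv_def by (simp add: mult.commute)
  qed
  \<comment> \<open>The number of square roots of f(x) by Euler's criterion. The exponents 2 i = N -
    1 and 2 i = 2 (N - 1) of y give the two terms.\<close>
  have inner: "(\<Sum>y\<in>reps. 1 - (y ^ 2 - f x) ^ (N - 1)) \<approx> 1 + f x ^ m" if x: "x \<in> A" for x
  proof -
    have "(\<Sum>y\<in>reps. (y ^ 2 - f x) ^ (N - 1)) \<approx> (\<Sum>y\<in>reps. \<Sum>i\<le>N-1. (y ^ 2) ^ i * f x ^ (N - 1 - i))"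
      using fA[OF x] reps_A by (intro eqv_sum D A_power) auto
    also have "\<dots> = (\<Sum>i\<le>N-1. f x ^ (N - 1 - i) * (\<Sum>y\<in>reps. y ^ (2 * i)))"
      unfolding power_mult[symmetric] sum_distrib_left by (subst sum.swap) (simp only: mult.commute[of "f x ^ _"])
    also have "\<dots> \<approx> (\<Sum>i\<le>N-1. f x ^ (N - 1 - i) * (if 2 * i > 0 \<and> (N - 1) dvd 2 * i then - 1 else 0))"
      using fA[OF x] by (intro eqv_sum eqv_mult_left power_sum A_power)
    also have "\<dots> = (\<Sum>i\<le>2*m. if i = m then - (f x ^ m) else if i = 2 * m then - 1 else 0)"
      unfolding m(2)
    proof (intro sum.cong refl)
      fix i assume i: "i \<in> {..2 * m}"
      have "2 * i > 0 \<and> 2 * m dvd 2 * i \<longleftrightarrow> i = m \<or> i = 2 * m"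
      proof
        assume *: "2 * i > 0 \<and> 2 * m dvd 2 * i"
        then obtain c where c: "i = m * c" by auto
        hence "c \<le> 2" "c > 0" using i m(1) * by (auto simp: mult.commute intro!: Nat.gr0I)
        thus "i = m \<or> i = 2 * m" using c by (cases "c = 1") auto
      qed (use m in auto)
      thus "f x ^ (2 * m - i) * (if 2 * i > 0 \<and> 2 * m dvd 2 * i then - 1 else 0) =
          (if i = m then - (f x ^ m) else if i = 2 * m then - 1 else 0)"
        using m(1) by auto
    qed
    also have "\<dots> = (\<Sum>i\<in>{m, 2 * m}. if i = m then - (f x ^ m) else if i = 2 * m then - 1 else 0)"
      by (rule sum.mono_neutral_right) auto
    also have "\<dots> = - (f x ^ m) - 1" using m(1) by simp
    finally have "of_nat N - (\<Sum>y\<in>reps. (y ^ 2 - f x) ^ (N - 1)) \<approx> 0 - (- (f x ^ m) - 1)"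
      by (intro eqv_diff of_nat_N_eqv)
    thus ?thesis by (simp add: sum_subtractf card_reps add.commute)
  qed
  have "(\<Sum>x\<in>reps. \<Sum>y\<in>reps. 1 - (y ^ 2 - f x) ^ (N - 1)) \<approx> (\<Sum>x\<in>reps. 1 + f x ^ m)"
    by (intro eqv_sum inner reps_A)
  also have "\<dots> = of_nat N + (\<Sum>x\<in>reps. f x ^ m)" by (simp add: sum.distrib card_reps)
  also have "(\<Sum>x\<in>reps. f x ^ m) = (\<Sum>x\<in>reps. \<Sum>i\<le>3*m. C i * x ^ i)"
  proof (intro sum.cong refl)
    fix x
    have "f x ^ m = poly (weier a b ^ m) x" by (simp add: f_def)
    also have "\<dots> = (\<Sum>i\<le>3*m. C i * x ^ i)"
      unfolding C_def poly_altdef using degree_weier_power[of a b m]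
      by (intro sum.mono_neutral_left) (auto simp: coeff_eq_0)
    finally show "f x ^ m = (\<Sum>i\<le>3*m. C i * x ^ i)" .
  qed
  also have "\<dots> = (\<Sum>i\<le>3*m. C i * (\<Sum>x\<in>reps. x ^ i))"
    by (subst sum.swap) (simp add: sum_distrib_left)
  also have "of_nat N + \<dots> \<approx> 0 + (\<Sum>i\<le>3*m. C i * (if i > 0 \<and> (N - 1) dvd i then - 1 else 0))"
    by (intro eqv_add of_nat_N_eqv eqv_sum eqv_mult_left power_sum CA)
  also have "(\<Sum>i\<le>3*m. C i * (if i > 0 \<and> (N - 1) dvd i then - 1 else 0)) = (\<Sum>i\<le>3*m. if i = 2 * m then - C i else 0)"
    unfolding m(2)
  proof (intro sum.cong refl)
    fix i assume i: "i \<in> {..3 * m}"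
    have "i > 0 \<and> 2 * m dvd i \<longleftrightarrow> i = 2 * m"
    proof
      assume *: "i > 0 \<and> 2 * m dvd i"
      then obtain c where c: "i = 2 * m * c" by (auto elim: dvdE)
      have "c < 2"
      proof (rule ccontr)
        assume "\<not> c < 2"
        hence "2 * m * 2 \<le> i" unfolding c by (intro mult_le_mono2) simp
        thus False using i m(1) by simp
      qed
      moreover have "c > 0" using c * by (intro Nat.gr0I) simp
      ultimately have "c = 1" by simp
      thus "i = 2 * m" using c by simp
    qed (use m in auto)
    thus "C i * (if i > 0 \<and> 2 * m dvd i then - 1 else 0) = (if i = 2 * m then - C i else 0)" by simp
  qed
  also have "0 + \<dots> = - hasse m a b" by (simp add: C_def hasse_def)
  finally show ?thesis by (simp add: f_def)
qed

text \<open>By Fermat the indicator of a point is 1 minus a power with exponent N - 1. As 6 is a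
  unit, the factor 6^6 disappears in it, and the passage to the short equation permutes first the
  values of y, then those of x.\<close>

lemma trace_eqv_hasse:
  assumes W: "set_weierstrass W \<subseteq> A" and N: "N = 2 * m + 1" and six: "6 \<notin> P"
  shows "of_int (int N + 1 - int (card (curve_points k\<^sub>P (map_weierstrass (reduce_mod P) W))))
     \<approx> hasse m (c4 W) (- c6 W)"
proof -
  have WA: "a1 W \<in> A" "a2 W \<in> A" "a3 W \<in> A" "a4 W \<in> A" "a6 W \<in> A"
    using W by (cases W; auto)+
  have bA: "b2 W \<in> A" "b4 W \<in> A" "b6 W \<in> A"
    unfolding b2_def b4_def b6_def using WA by (auto intro!: A_intros)
  have c46A: "c4 W \<in> A" "c6 W \<in> A"
    unfolding c4_def c6_def using bA by (auto intro!: A_intros)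
  hence cA: "c4 W \<in> A" "- c6 W \<in> A" by (auto intro: A_uminus)
  have six_M: "6 ^ k \<notin> M" for k :: nat
    using six M_int[of 6] M_power[of 6 k] by auto
  have const: "36 \<notin> M" "216 \<notin> M" "46656 \<notin> M"
    using six_M[of 2] six_M[of 3] six_M[of 6] by simp_all
  define H where "H = (\<lambda>x y. 1 - (y ^ 2 - poly (weier (c4 W) (- c6 W)) x) ^ (N - 1))"
  have GA: "affine_eq W x y \<in> A" if "x \<in> A" "y \<in> A" for x y
    unfolding affine_eq_def using WA that by (auto intro!: A_intros)
  have wA: "poly (weier (c4 W) (- c6 W)) x \<in> A" if "x \<in> A" for x
    unfolding weier_def using c46A that by (auto intro!: A_intros)
  have w_eqv: "poly (weier (c4 W) (- c6 W)) x \<approx> poly (weier (c4 W) (- c6 W)) x'" if "x \<in> A" "x' \<in> A" "x \<approx> x'" for x x'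
  proof -
    have "poly (weier (c4 W) (- c6 W)) z = z ^ 3 - 27 * c4 W * z - 54 * c6 W" for z
      by (simp add: weier_def power3_eq_cube algebra_simps)
    thus ?thesis using that cA
      by (auto intro!: eqv_add eqv_diff eqv_power eqv_mult_left A_intros)
  qed
  have H_eqv: "H x y \<approx> H x' y'" if "x \<in> A" "x' \<in> A" "x \<approx> x'" "y \<in> A" "y' \<in> A" "y \<approx> y'" for x y x' y'
    unfolding H_def using that wA by (intro eqv_diff eqv_refl eqv_power w_eqv A_diff A_power)
  have ind: "(if affine_eq W x y \<in> M then 1 else 0) \<approx> H (36 * x + 3 * b2 W) (216 * y + 108 * (a1 W * x + a3 W))"
    if "x \<in> A" "y \<in> A" for x y
  proof -
    have "H (36 * x + 3 * b2 W) (216 * y + 108 * (a1 W * x + a3 W)) = 1 - 46656 ^ (N - 1) * affine_eq W x y ^ (N - 1)"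
      unfolding H_def affine_eq_short[symmetric] power_mult_distrib ..
    also have "\<dots> \<approx> 1 - 1 * affine_eq W x y ^ (N - 1)"
      using GA[OF that] const by (intro eqv_diff eqv_refl eqv_mult fermat_A A_power) auto
    also have "\<dots> \<approx> 1 - (if affine_eq W x y \<in> M then 0 else 1)"
    proof (intro eqv_diff eqv_refl)
      show "1 * affine_eq W x y ^ (N - 1) \<approx> (if affine_eq W x y \<in> M then 0 else 1)"
      proof (cases "affine_eq W x y \<in> M")
        case True
        hence "affine_eq W x y ^ (N - 1) \<approx> 0 ^ (N - 1)" by (intro eqv_power) (auto simp: eqv_def)
        thus ?thesis using True N_gt_1 by (simp add: zero_power)
      qed (use fermat_A GA[OF that] in simp)
    qed
    finally show ?thesis by (auto dest: eqv_sym)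
  qed
  define S where "S = {(x, y). x \<in> reps \<and> y \<in> reps \<and> affine_eq W x y \<in> M}"
  have "(of_nat (card S) :: 'a) = (\<Sum>z\<in>S. 1)" by simp
  also have "\<dots> = (\<Sum>z\<in>reps \<times> reps. if affine_eq W (fst z) (snd z) \<in> M then 1 else 0)"
    by (rule sum.mono_neutral_cong_left) (auto simp: S_def)
  also have "\<dots> = (\<Sum>x\<in>reps. \<Sum>y\<in>reps. if affine_eq W x y \<in> M then 1 else 0)"
    by (simp add: sum.cartesian_product case_prod_beta)
  also have "\<dots> \<approx> (\<Sum>x\<in>reps. \<Sum>y\<in>reps. H (36 * x + 3 * b2 W) (216 * y + 108 * (a1 W * x + a3 W)))"
    by (intro eqv_sum ind reps_A)
  also have "\<dots> \<approx> (\<Sum>x\<in>reps. \<Sum>y\<in>reps. H (36 * x + 3 * b2 W) y)"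
  proof (rule eqv_sum)
    fix x assume x: "x \<in> reps"
    show "(\<Sum>y\<in>reps. H (36 * x + 3 * b2 W) (216 * y + 108 * (a1 W * x + a3 W))) \<approx>
        (\<Sum>y\<in>reps. H (36 * x + 3 * b2 W) y)"
    proof (rule sum_reps_permute[where \<sigma> = "\<lambda>y. 216 * y + 108 * (a1 W * x + a3 W)"])
      fix s t assume "216 * s + 108 * (a1 W * x + a3 W) \<approx> 216 * t + 108 * (a1 W * x + a3 W)"
      hence "216 * s \<approx> 216 * t" by (simp add: eqv_def)
      thus "s \<approx> t" by (rule eqv_cancel[rotated 2]) (use const in auto)
    next
      fix t assume "t \<in> reps"
      thus "216 * t + 108 * (a1 W * x + a3 W) \<in> A" using x WA reps_A by (auto intro!: A_intros)
    next
      fix y y' assume "y \<in> A" "y' \<in> A" "y \<approx> y'"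
      thus "H (36 * x + 3 * b2 W) y \<approx> H (36 * x + 3 * b2 W) y'"
        using x bA reps_A by (intro H_eqv eqv_refl A_add A_mult) auto
    qed
  qed
  also have "\<dots> \<approx> (\<Sum>x\<in>reps. \<Sum>y\<in>reps. H x y)"
  proof (rule sum_reps_permute[where \<sigma> = "\<lambda>x. 36 * x + 3 * b2 W" and F = "\<lambda>x. \<Sum>y\<in>reps. H x y"])
    fix s t assume "36 * s + 3 * b2 W \<approx> 36 * t + 3 * b2 W"
    hence "36 * s \<approx> 36 * t" by (simp add: eqv_def)
    thus "s \<approx> t" by (rule eqv_cancel[rotated 2]) (use const in auto)
  next
    fix t assume "t \<in> reps"
    thus "36 * t + 3 * b2 W \<in> A" using bA reps_A by (auto intro!: A_intros)
  next
    fix x x' assume "x \<in> A" "x' \<in> A" "x \<approx> x'"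
    thus "(\<Sum>y\<in>reps. H x y) \<approx> (\<Sum>y\<in>reps. H x' y)" using reps_A by (intro eqv_sum H_eqv eqv_refl)
  qed
  also have "\<dots> \<approx> - hasse m (c4 W) (- c6 W)"
    unfolding H_def by (rule short_points_sum[OF cA N])
  finally have "of_nat N - of_nat (card S) \<approx> 0 - (- hasse m (c4 W) (- c6 W))"
    by (intro eqv_diff of_nat_N_eqv)
  thus ?thesis unfolding weierstrass_points_card[OF W] S_def[symmetric] by simp
qed

end

section \<open>The operator U on quotients of Eisenstein series\<close>

definition fps_of_ints :: "int fps \<Rightarrow> 'a::comm_ring_1 fps" where
  "fps_of_ints f = Abs_fps (\<lambda>n. of_int (f $ n))"

lemma fps_of_ints_nth [simp]: "fps_of_ints f $ n = of_int (f $ n)"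
  by (simp add: fps_of_ints_def)

lemma fps_of_ints_diff: "fps_of_ints (f - g) = fps_of_ints f - fps_of_ints g"
  and fps_of_ints_mult: "fps_of_ints (f * g) = fps_of_ints f * fps_of_ints g"
  and fps_of_ints_1: "fps_of_ints 1 = 1"
  by (rule fps_ext, simp add: fps_mult_nth)+

lemma fps_of_ints_power: "fps_of_ints (f ^ n) = fps_of_ints f ^ n"
  by (induction n) (simp_all add: fps_of_ints_1 fps_of_ints_mult)

section \<open>Bernoulli numbers, and E_k as a monomial in E4 and E6\<close>

lemma bernoulli_Suc_list:
  "bernoulli (Suc n) = - (\<Sum>i\<leftarrow>[0..<Suc n]. of_nat ((n + 2) choose i) * bernoulli i) / of_nat (n + 2)"
  by (simp only: bernoulli.simps(2) interv_sum_list_conv_sum_set_nat set_upt atLeast0LessThan lessThan_Suc_atMost)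

lemmas nat_numeral_unfold = numeral_eq_Suc pred_numeral_simps BitM.simps One_nat_def

lemma bernoulli_le_8:
  "bernoulli 0 = 1" "bernoulli 1 = - 1 / 2" "bernoulli 2 = 1 / 6" "bernoulli 3 = 0" "bernoulli 4 = - 1 / 30"
  "bernoulli 5 = 0" "bernoulli 6 = 1 / 42" "bernoulli 7 = 0" "bernoulli 8 = - 1 / 30"
  by (simp_all add: eval_nat_numeral)

declare bernoulli.simps(2) [simp del]

lemma bernoulli_9: "bernoulli 9 = 0"
proof -
  have "bernoulli (Suc 8) = 0"
    unfolding bernoulli_Suc_list
    by (simp add: upt_rec binomial_fact fact_numeral
      bernoulli_le_8[unfolded nat_numeral_unfold])
  thus ?thesis by simp
qed

lemma bernoulli_10: "bernoulli 10 = 5 / 66"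
proof -
  have "bernoulli (Suc 9) = 5 / 66"
    unfolding bernoulli_Suc_list
    by (simp add: upt_rec binomial_fact fact_numeral
      bernoulli_le_8[unfolded nat_numeral_unfold] bernoulli_9[unfolded nat_numeral_unfold])
  thus ?thesis by simp
qed

lemma bernoulli_11: "bernoulli 11 = 0"
proof -
  have "bernoulli (Suc 10) = 0"
    unfolding bernoulli_Suc_list
    by (simp add: upt_rec binomial_fact fact_numeral
      bernoulli_le_8[unfolded nat_numeral_unfold] bernoulli_9[unfolded nat_numeral_unfold] bernoulli_10[unfolded nat_numeral_unfold])
  thus ?thesis by simp
qed

lemma bernoulli_12: "bernoulli 12 = - 691 / 2730"
proof -
  have "bernoulli (Suc 11) = - 691 / 2730"
    unfolding bernoulli_Suc_list
    by (simp add: upt_rec binomial_fact fact_numeral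
      bernoulli_le_8[unfolded nat_numeral_unfold] bernoulli_9[unfolded nat_numeral_unfold] bernoulli_10[unfolded nat_numeral_unfold] bernoulli_11[unfolded nat_numeral_unfold])
  thus ?thesis by simp
qed

lemma bernoulli_13: "bernoulli 13 = 0"
proof -
  have "bernoulli (Suc 12) = 0"
    unfolding bernoulli_Suc_list
    by (simp add: upt_rec binomial_fact fact_numeral
      bernoulli_le_8[unfolded nat_numeral_unfold] bernoulli_9[unfolded nat_numeral_unfold] bernoulli_10[unfolded nat_numeral_unfold] bernoulli_11[unfolded nat_numeral_unfold] bernoulli_12[unfolded nat_numeral_unfold])
  thus ?thesis by simp
qed

lemma bernoulli_14: "bernoulli 14 = 7 / 6"
proof -
  have "bernoulli (Suc 13) = 7 / 6"
    unfolding bernoulli_Suc_list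
    by (simp add: upt_rec binomial_fact fact_numeral
      bernoulli_le_8[unfolded nat_numeral_unfold] bernoulli_9[unfolded nat_numeral_unfold] bernoulli_10[unfolded nat_numeral_unfold] bernoulli_11[unfolded nat_numeral_unfold] bernoulli_12[unfolded nat_numeral_unfold] bernoulli_13[unfolded nat_numeral_unfold])
  thus ?thesis by simp
qed

lemma eisenstein_eq:
  assumes "of_int c = - 2 * of_nat k / bernoulli k"
  shows "eisenstein k = fps_of_ints (eis c (k - 1))"
proof (rule fps_ext)
  fix n
  have "(of_rat (- 2 * of_nat k / bernoulli k) :: 'a) = of_int c"
    unfolding assms[symmetric] by simp
  thus "eisenstein k $ n = (fps_of_ints (eis c (k - 1)) $ n :: 'a)"
    by (simp add: eisenstein_def eis_nth)
qed

text \<open>\<alpha> and \<beta> are the exponents of the complementary factor: E_k E4^\<alpha>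
  E6^\<beta> = E4^2 E6, of weight 14.\<close>

lemma eisenstein_monomial:
  assumes "k \<in> {4, 6, 8, 10, 14}"
  obtains \<alpha> \<beta> where "\<alpha> \<le> 2" "\<beta> \<le> 1" "k + 4 * \<alpha> + 6 * \<beta> = 14"
    "eisenstein k = (fps_of_ints (E4 ^ (2 - \<alpha>) * E6 ^ (1 - \<beta>)) :: 'a::field_char_0 fps)"
proof -
  have e4: "eisenstein 4 = (fps_of_ints E4 :: 'a fps)"
    using eisenstein_eq[of 240 4] by (simp add: bernoulli_4_6)
  have e6: "eisenstein 6 = (fps_of_ints E6 :: 'a fps)"
    using eisenstein_eq[of "- 504" 6] by (simp add: bernoulli_4_6)
  have e8: "eisenstein 8 = (fps_of_ints (E4 ^ 2) :: 'a fps)"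
    using eisenstein_eq[of 480 8] unfolding power2_eq_square E4_square by (simp add: bernoulli_le_8)
  have e10: "eisenstein 10 = (fps_of_ints (E4 * E6) :: 'a fps)"
    using eisenstein_eq[of "- 264" 10] unfolding E4_E6 by (simp add: bernoulli_10)
  have e14: "eisenstein 14 = (fps_of_ints (E4 ^ 2 * E6) :: 'a fps)"
    using eisenstein_eq[of "- 24" 14] unfolding power2_eq_square E4_square_E6 by (simp add: bernoulli_14)
  consider "k = 4" | "k = 6" | "k = 8" | "k = 10" | "k = 14" using assms by blast
  thus thesis
  proof cases
    case 1 thus ?thesis using that[of 1 1] e4 by simp
  next
    case 2 thus ?thesis using that[of 2 0] e6 by simp
  next
    case 3 thus ?thesis using that[of 0 1] e8 by simp
  next
    case 4 thus ?thesis using that[of 1 0] e10 by simp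
  next
    case 5 thus ?thesis using that[of 0 0] e14 by simp
  qed
qed

text \<open>Clearing the denominator of j = 1728 E4^3 / (E4^3 - E6^2) turns the quotient of Laurent
  series into an identity of power series; the cofactor has constant term 1728 since
  \<open>cusp\<close> has none.\<close>

lemma eisenstein_over_j_mult:
  fixes c :: "'a::field_char_0"
  shows "eisenstein_over_j k c * (1728 * fps_of_ints (E4 ^ 3) - fps_const c * fps_of_ints cusp) =
    eisenstein k * fps_of_ints cusp"
proof -
  define F Q D where "F = eisenstein_over_j k c" and "Q = (fps_of_ints (E4 ^ 3) :: 'a fps)"
    and "D = (fps_of_ints cusp :: 'a fps)"
  have e4: "(eisenstein 4 :: 'a fps) = fps_of_ints E4" and e6: "(eisenstein 6 :: 'a fps) = fps_of_ints E6"
    using eisenstein_eq[of 240 4] eisenstein_eq[of "- 504" 6] by (simp_all add: bernoulli_4_6)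
  have j: "modular_j = 1728 * fps_to_fls Q / fps_to_fls D"
    by (simp add: modular_j_def e4 e6 Q_def D_def fps_of_ints_diff fps_of_ints_power)
  have D1: "D $ 0 = 0" "D $ 1 = 1728" "Q $ 0 = 1"
    using eisenstein_diff_nth[where 'a = 'a]
    by (simp_all add: D_def Q_def e4 e6 fps_of_ints_diff fps_of_ints_power eis_nth fps_power_zeroth)
  hence D0: "fps_to_fls D \<noteq> 0" by auto
  have X: "(modular_j - fls_const c) * fps_to_fls D = fps_to_fls (1728 * Q - fps_const c * D)"
    using D0 by (simp add: j left_diff_distrib fls_times_fps_to_fls fps_to_fls_minus)
  have "(1728 * Q - fps_const c * D) $ 0 \<noteq> 0" using D1 by (simp add: fps_numeral_mult_nth)
  hence "1728 * Q - fps_const c * D \<noteq> 0" by (metis fps_zero_nth)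
  hence "fps_to_fls (1728 * Q - fps_const c * D) \<noteq> 0" by (simp only: fps_to_fls_eq_0_iff not_False_eq_True)
  hence nz: "modular_j - fls_const c \<noteq> 0" using X by auto
  have "fps_to_fls F * (modular_j - fls_const c) = fps_to_fls (eisenstein k)"
    using nz by (simp add: F_def eisenstein_over_j_eq)
  hence "fps_to_fls F * ((modular_j - fls_const c) * fps_to_fls D) = fps_to_fls (eisenstein k) * fps_to_fls D"
    by (simp add: mult.assoc[symmetric])
  hence "fps_to_fls (F * (1728 * Q - fps_const c * D)) = fps_to_fls (eisenstein k * D)"
    unfolding X by (simp add: fls_times_fps_to_fls)
  thus ?thesis by (simp add: F_def Q_def D_def)
qed

section \<open>Power series over the localization and the eigenvalue of U\<close>

context nf_residue
begin

definition fps_A :: "'a fps \<Rightarrow> bool" where "fps_A f \<longleftrightarrow> (\<forall>n. f $ n \<in> A)"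

definition fps_eqv :: "'a fps \<Rightarrow> 'a fps \<Rightarrow> bool" where "fps_eqv f g \<longleftrightarrow> (\<forall>n. f $ n \<approx> g $ n)"

lemma fps_eqv_refl [simp]: "fps_eqv f f"
  by (simp add: fps_eqv_def)

lemma fps_eqv_sym: "fps_eqv f g \<Longrightarrow> fps_eqv g f"
  using eqv_sym by (auto simp: fps_eqv_def)

lemma fps_eqv_trans [trans]: "fps_eqv f g \<Longrightarrow> fps_eqv g h \<Longrightarrow> fps_eqv f h"
  unfolding fps_eqv_def by (blast intro: eqv_trans)

lemma fps_A_mult: "fps_A f \<Longrightarrow> fps_A g \<Longrightarrow> fps_A (f * g)"
  by (auto simp: fps_A_def fps_mult_nth intro: A_sum A_mult)

lemma fps_A_diff: "fps_A f \<Longrightarrow> fps_A g \<Longrightarrow> fps_A (f - g)"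
  by (auto simp: fps_A_def intro: A_diff)

lemma fps_A_const: "c \<in> A \<Longrightarrow> fps_A (fps_const c)"
  by (auto simp: fps_A_def)

lemma fps_A_of_ints: "fps_A (fps_of_ints f)"
  by (auto simp: fps_A_def)

lemma fps_A_power: "fps_A f \<Longrightarrow> fps_A (f ^ n)"
proof (induction n)
  case (Suc n)
  thus ?case by (simp add: fps_A_mult)
qed (simp add: fps_A_def)

lemma fps_A_sum: "(\<And>i. i \<in> S \<Longrightarrow> fps_A (f i)) \<Longrightarrow> fps_A (\<Sum>i\<in>S. f i)"
  by (auto simp: fps_A_def fps_sum_nth intro: A_sum)

lemma fps_A_of_int: "fps_A (of_int k)"
  by (auto simp: fps_A_def)

lemma fps_eqv_mult_left: "fps_A h \<Longrightarrow> fps_eqv f g \<Longrightarrow> fps_eqv (h * f) (h * g)"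
  by (auto simp: fps_eqv_def fps_A_def fps_mult_nth intro: eqv_sum eqv_mult_left)

lemma fps_eqv_mult_right: "fps_A h \<Longrightarrow> fps_eqv f g \<Longrightarrow> fps_eqv (f * h) (g * h)"
  using fps_eqv_mult_left[of h f g] by (simp only: mult.commute)

lemma fps_eqv_diff: "fps_eqv f g \<Longrightarrow> fps_eqv f' g' \<Longrightarrow> fps_eqv (f - f') (g - g')"
  by (auto simp: fps_eqv_def intro: eqv_diff)

lemma fps_eqv_sum: "(\<And>i. i \<in> S \<Longrightarrow> fps_eqv (f i) (g i)) \<Longrightarrow> fps_eqv (\<Sum>i\<in>S. f i) (\<Sum>i\<in>S. g i)"
  by (auto simp: fps_eqv_def fps_sum_nth intro: eqv_sum)

lemma of_int_p_dvd: "int p dvd m \<Longrightarrow> (of_int m :: 'a) \<approx> 0"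
  using of_int_in_P_iff[OF p] P_M by (simp add: eqv_def)

lemma fps_eqv_of_ints: "congp p f g \<Longrightarrow> fps_eqv (fps_of_ints f) (fps_of_ints g)"
  using of_int_p_dvd congp_fps_nth[of p f g]
  by (fastforce simp: fps_eqv_def congp_def eqv_def simp flip: of_int_diff)

lemma fps_eqv_p_mult: "fps_A f \<Longrightarrow> fps_eqv (g + of_nat p * f) g"
  using M_mult[OF _ P_M[OF p(2)]]
  by (auto simp: fps_eqv_def fps_A_def eqv_def mult.commute[of "of_nat p"] simp del: fps_mult_of_nat_nth(1))

lemma fps_A_cancel:
  assumes "fps_A u" "u $ 0 \<notin> M" "fps_A (u * f)"
  shows "fps_A f"
proof -
  have "f $ n \<in> A" for n
  proof (induction n rule: less_induct)
    case (less n)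
    have "(u * f) $ n = u $ 0 * f $ n + (\<Sum>i=1..n. u $ i * f $ (n - i))"
      by (simp add: fps_mult_nth sum.atLeast_Suc_atMost)
    hence "u $ 0 * f $ n = (u * f) $ n - (\<Sum>i=1..n. u $ i * f $ (n - i))" by simp
    moreover have "(u * f) $ n - (\<Sum>i=1..n. u $ i * f $ (n - i)) \<in> A"
      using assms less by (intro A_diff A_sum A_mult) (auto simp: fps_A_def)
    ultimately have "u $ 0 * f $ n \<in> A" by (simp only:)
    moreover have "inverse (u $ 0) \<in> A" using assms unit_inverse(1)[of "u $ 0"] by (simp add: fps_A_def)
    ultimately have "inverse (u $ 0) * (u $ 0 * f $ n) \<in> A" by (simp only: A_mult)
    moreover have "inverse (u $ 0) * (u $ 0 * f $ n) = f $ n"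
      using assms unit_inverse(2)[of "u $ 0"] by (simp add: fps_A_def)
    ultimately show ?case by (simp only:)
  qed
  thus ?thesis by (simp add: fps_A_def)
qed

lemma fps_eqv_cancel:
  assumes "fps_A u" "u $ 0 \<notin> M" "fps_eqv (u * f) (u * g)"
  shows "fps_eqv f g"
proof -
  define h where "h = f - g"
  have uh: "(u * h) $ n \<in> M" for n
    using assms(3) by (simp add: h_def right_diff_distrib fps_eqv_def eqv_def)
  have "h $ n \<in> M" for n
  proof (induction n rule: less_induct)
    case (less n)
    have "(u * h) $ n = u $ 0 * h $ n + (\<Sum>i=1..n. u $ i * h $ (n - i))"
      by (simp add: fps_mult_nth sum.atLeast_Suc_atMost)
    hence "u $ 0 * h $ n = (u * h) $ n - (\<Sum>i=1..n. u $ i * h $ (n - i))" by simp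
    also have "\<dots> \<in> M"
      using assms less by (intro M_diff[OF uh] M_sum M_mult) (auto simp: fps_A_def)
    finally have "u $ 0 * h $ n \<approx> u $ 0 * 0" by (simp add: eqv_def)
    moreover have "u $ 0 \<in> A" using assms(1) by (simp add: fps_A_def)
    ultimately have "h $ n \<approx> 0" using eqv_cancel[OF _ assms(2)] by blast
    thus ?case by (simp add: eqv_def)
  qed
  thus ?thesis by (simp add: fps_eqv_def eqv_def h_def)
qed

lemma hasse_A: "a \<in> A \<Longrightarrow> b \<in> A \<Longrightarrow> hasse m a b \<in> A"
  unfolding hasse_def by (rule coeff_weier_power_A)

lemma every_mult_inflated:
  fixes V V' F :: "'a fps"
  assumes V: "\<And>n. V' $ n = (if N dvd n then V $ (n div N) else 0)"
  shows "every N (V' * F) = V * every N F"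
proof (rule fps_ext)
  fix n
  have "every N (V' * F) $ n = (\<Sum>i=0..n * N. V' $ i * F $ (n * N - i))" by (simp add: fps_mult_nth)
  also have "\<dots> = (\<Sum>j=0..n. V' $ (j * N) * F $ (n * N - j * N))"
    using N_gt_1 by (intro sum_multiples) (auto simp: V)
  also have "\<dots> = (V * every N F) $ n"
    using N_gt_1 by (simp add: fps_mult_nth V diff_mult_distrib)
  finally show "every N (V' * F) $ n = (V * every N F) $ n" .
qed

lemma eisenstein_over_j_eqv:
  assumes k: "k \<in> {4, 6, 8, 10, 14}" and six: "6 \<notin> P"
    and W: "set_weierstrass W \<subseteq> A" and \<Delta>: "discriminant W \<notin> M" "c4 W \<notin> M" "c6 W \<notin> M"
    and c: "c = j_invariant W"
  shows "fps_A (eisenstein_over_j k c)"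
    and "fps_eqv (every N (eisenstein_over_j k c))
      (fps_const (of_int (int N + 1 - int (card (curve_points k\<^sub>P (map_weierstrass (reduce_mod P) W)))) ^ (k - 2))
        * eisenstein_over_j k c)"
proof -
  define F where "F = eisenstein_over_j k c"
  define a b where "a = c4 W" and "b = - c6 W"
  have WA: "a1 W \<in> A" "a2 W \<in> A" "a3 W \<in> A" "a4 W \<in> A" "a6 W \<in> A"
    using W by (cases W; auto)+
  have bA: "b2 W \<in> A" "b4 W \<in> A" "b6 W \<in> A" "b8 W \<in> A"
    unfolding b2_def b4_def b6_def b8_def using WA by (auto intro!: A_intros)
  have ab: "a \<in> A" "b \<in> A" and dA: "discriminant W \<in> A"
    unfolding a_def b_def c4_def c6_def discriminant_def using bA by (auto intro!: A_intros)
  have abM: "a \<notin> M" "b \<notin> M" using \<Delta> M_uminus[of b] by (auto simp: a_def b_def)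
  define \<delta> where "\<delta> = discriminant W"
  have \<delta>: "\<delta> \<in> A" "\<delta> \<notin> M" "\<delta> \<noteq> 0" using dA \<Delta> by (auto simp: \<delta>_def)
  have ab\<delta>: "a ^ 3 - b ^ 2 = 1728 * \<delta>" using discriminant_c4_c6[of W] by (simp add: a_def b_def \<delta>_def)
  obtain \<alpha> \<beta> where k': "\<alpha> \<le> 2" "\<beta> \<le> 1" "k + 4 * \<alpha> + 6 * \<beta> = 14"
    and ek: "(eisenstein k :: 'a fps) = fps_of_ints (E4 ^ (2 - \<alpha>) * E6 ^ (1 - \<beta>))"
    by (rule eisenstein_monomial[OF k, where 'a = 'a])
  define e e' where "e = E4 ^ (2 - \<alpha>) * E6 ^ (1 - \<beta>)" and "e' = E4 ^ \<alpha> * E6 ^ \<beta>"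
  have ee: "e * e' = E4 ^ 2 * E6"
  proof -
    have "e * e' = E4 ^ (2 - \<alpha> + \<alpha>) * E6 ^ (1 - \<beta> + \<beta>)"
      unfolding e_def e'_def power_add by (simp only: mult_ac)
    thus ?thesis using k' by simp
  qed
  have e'0: "e' $ 0 = 1" by (simp add: e'_def fps_power_zeroth eis_nth)
  have p3: "p > 3"
  proof -
    have "p \<noteq> 2" "p \<noteq> 3" using six P_mult[OF p(2), of 3] P_mult[OF p(2), of 2] by auto
    thus ?thesis using prime_ge_2_nat[OF p(1)] by linarith
  qed
  have "odd N" unfolding norm using p(1) p3 prime_odd_nat[of p] by simp
  then obtain m where m: "N = 2 * m + 1" by (elim oddE)
  define K where "K = k - 2"
  have K: "K + 4 * \<alpha> + 6 * \<beta> = 12" using k' k by (auto simp: K_def)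
  \<comment> \<open>One family of integers for both rings: at (E4, E6) it enters
    \<open>star\<close>, at (a, b) it sums to \<mu>.\<close>
  obtain \<tau> where \<tau>: "\<And>x y :: int fps. hasse m x y ^ K * (x ^ \<alpha> * y ^ \<beta>) ^ (2 * m) =
          (\<Sum>s\<le>2*m. of_int (\<tau> s) * x ^ (3 * s) * y ^ (2 * (2 * m - s)))"
    "\<And>x y :: 'a. hasse m x y ^ K * (x ^ \<alpha> * y ^ \<beta>) ^ (2 * m) =
          (\<Sum>s\<le>2*m. of_int (\<tau> s) * x ^ (3 * s) * y ^ (2 * (2 * m - s)))"
    using hasse_power_expansion[OF k'(1,2) K, where M = m and 'b = "int fps" and 'c = 'a] by blast
  define \<mu> where "\<mu> = hasse m a b ^ K * (a ^ \<alpha> * b ^ \<beta>) ^ (N - 1)"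
  have star: "congp p (every N (e * cusp * E6 ^ (2 * i) * E4 ^ (3 * (N - 1 - i)))) (of_int (\<tau> i) * (e * cusp))"
    if "i \<le> N - 1" for i
    using that \<tau>(1)[of E4 E6] m
    by (intro every_eisenstein_monomial[OF p(1) p3 norm m ee e'0, where K = K]) (simp_all add: e'_def)
  define x y where "x = fps_const (a ^ 3) * fps_of_ints (E6 ^ 2)" and "y = fps_const (b ^ 2) * fps_of_ints (E4 ^ 3)"
  define V where "V = x - y"
  have xyA: "fps_A x" "fps_A y" unfolding x_def y_def using ab
    by (auto intro!: fps_A_mult fps_A_const fps_A_of_ints A_power)
  hence VA: "fps_A V" unfolding V_def by (rule fps_A_diff)
  \<comment> \<open>The constant term is a^3 - b^2 = 1728 \<delta>, a unit since 27 * 1728 = 6^6.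
    Division by \<open>V\<close> then preserves integrality and congruences.\<close>
  have V0: "V $ 0 \<notin> M"
  proof -
    have "V $ 0 = 1728 * \<delta>"
      using ab\<delta> by (simp add: V_def x_def y_def fps_power_zeroth eis_nth)
    moreover have "(1728 :: 'a) \<notin> M"
    proof
      assume "(1728 :: 'a) \<in> M"
      hence "27 * (1728 :: 'a) \<in> M" by (intro M_mult) auto
      hence "(6 :: 'a) ^ 6 \<in> M" by simp
      thus False using M_power[of 6 6] M_int[of 6] six by auto
    qed
    ultimately show ?thesis using M_prime[of 1728 \<delta>] \<delta> by auto
  qed
  define G where "G = fps_const \<delta> * fps_of_ints (e * cusp)"
  have GA: "fps_A G" unfolding G_def using \<delta> by (intro fps_A_mult fps_A_const fps_A_of_ints)
  have VF: "V * F = G"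
  proof -
    have "\<delta> * c = a ^ 3" using \<delta>(3) by (simp add: c j_invariant_def a_def \<delta>_def)
    hence f1: "fps_const (a ^ 3) = fps_const \<delta> * fps_const c" by simp
    have f2: "fps_const (b ^ 2) = fps_const \<delta> * fps_const c - fps_const \<delta> * 1728"
      using ab\<delta> \<open>\<delta> * c = a ^ 3\<close> by (simp add: numeral_fps_const algebra_simps)
    have VD: "V = fps_const \<delta> * (1728 * fps_of_ints (E4 ^ 3) - fps_const c * fps_of_ints cusp)"
      unfolding V_def x_def y_def fps_of_ints_diff f1 f2 by (simp add: algebra_simps del: fps_const_mult)
    have "V * F = fps_const \<delta> * (F * (1728 * fps_of_ints (E4 ^ 3) - fps_const c * fps_of_ints cusp))"
      unfolding VD by (simp only: mult_ac)
    also have "F * (1728 * fps_of_ints (E4 ^ 3) - fps_const c * fps_of_ints cusp) = eisenstein k * fps_of_ints cusp"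
      unfolding F_def by (rule eisenstein_over_j_mult)
    also have "fps_const \<delta> * \<dots> = G"
      unfolding ek G_def e_def[symmetric] fps_of_ints_mult ..
    finally show ?thesis .
  qed
  have FA: "fps_A F" using fps_A_cancel[OF VA V0] VF GA by simp
  thus "fps_A (eisenstein_over_j k c)" by (simp add: F_def)
  have everyA: "fps_A (every N f)" if "fps_A f" for f using that by (simp add: fps_A_def)
  have every_eqv: "fps_eqv (every N f) (every N g)" if "fps_eqv f g" for f g
    using that by (simp add: fps_eqv_def)

  obtain d where d: "\<And>x y :: 'a fps. (x - y) ^ (N - 1) =
      (\<Sum>i\<le>N-1. x ^ i * y ^ (N - 1 - i)) + of_nat p * (\<Sum>i\<le>N-1. of_int (d i) * x ^ i * y ^ (N - 1 - i))"
    using diff_power_prime_power_minus_1[OF p(1) norm \<open>odd N\<close>, where 'b = "'a fps"] by blast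
  define S1 S2 where "S1 = (\<Sum>i\<le>N-1. x ^ i * y ^ (N - 1 - i))"
    and "S2 = (\<Sum>i\<le>N-1. of_int (d i) * x ^ i * y ^ (N - 1 - i))"
  have VS: "V ^ (N - 1) = S1 + of_nat p * S2" unfolding V_def d S1_def S2_def ..
  have S2A: "fps_A S2" unfolding S2_def using xyA by (intro fps_A_mult fps_A_sum fps_A_of_int fps_A_power)
  define V' where "V' = Abs_fps (\<lambda>n. if N dvd n then V $ (n div N) else 0)"
  have VN: "fps_eqv (V ^ N) V'"
  proof -
    have pwN: "z ^ N = z * z ^ (N - 1)" for z :: "'a fps" using N_gt_1 by (cases N) auto
    \<comment> \<open>The N-th power fixes constants modulo the ideal, \<open>N\<close> being the
      order of the residue field; for the integer series the Frobenius congruence applies.\<close>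
    have pw: "fps_eqv ((fps_const u * fps_of_ints f) ^ N)
        (Abs_fps (\<lambda>n. if N dvd n then (fps_const u * fps_of_ints f) $ (n div N) else 0))"
      if u: "u \<in> A" for u f
    proof -
      have "u ^ N * of_int ((f ^ N) $ n) \<approx> u * of_int (if N dvd n then f $ (n div N) else 0)" for n
      proof (rule eqv_mult)
        show "u ^ N \<approx> u" by (rule fermat_A_N[OF u])
        show "of_int ((f ^ N) $ n) \<approx> of_int (if N dvd n then f $ (n div N) else 0)"
          using of_int_p_dvd[OF congp_power_int_fps_nth[OF p(1) norm, of f n, unfolded congp_def of_nat_id]]
          by (simp only: eqv_def of_int_diff diff_0_right)
      qed (use u in auto)
      moreover have "((fps_const u * fps_of_ints f) ^ N) $ n = u ^ N * of_int ((f ^ N) $ n)" for n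
        by (simp only: power_mult_distrib fps_const_power fps_of_ints_power[symmetric]
            fps_mult_left_const_nth fps_of_ints_nth)
      moreover have "Abs_fps (\<lambda>n. if N dvd n then (fps_const u * fps_of_ints f) $ (n div N) else 0) $ n =
          u * of_int (if N dvd n then f $ (n div N) else 0)" for n
        by simp
      ultimately show ?thesis unfolding fps_eqv_def by (simp only: simp_thms)
    qed
    \<comment> \<open>V S1 telescopes to x^N - y^N, which reduces Frobenius for \<open>V\<close> to
      products of a constant and an integer series. The relation \<open>congp\<close> over the field
      itself would be void, as \<open>p\<close> is invertible there.\<close>
    have "V ^ N = V * (S1 + of_nat p * S2)" unfolding pwN[of V] VS ..
    hence "V ^ N = V * S1 + of_nat p * (V * S2)" by (simp only: distrib_left mult.left_commute)
    also have "V * S1 = x ^ N - y ^ N"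
    proof -
      have "x ^ N - y ^ N = (x - y) * (\<Sum>i<N. y ^ (N - Suc i) * x ^ i)"
        by (rule power_diff_sumr2)
      also have "{..<N} = {..N - 1}" using N_gt_1 by auto
      finally show ?thesis by (simp add: V_def S1_def mult.commute)
    qed
    finally have VN: "V ^ N = x ^ N - y ^ N + of_nat p * (V * S2)" .
    have "fps_eqv (V ^ N) (x ^ N - y ^ N)"
      unfolding VN by (intro fps_eqv_p_mult fps_A_mult VA S2A)
    also have "fps_eqv (x ^ N - y ^ N) (Abs_fps (\<lambda>n. if N dvd n then x $ (n div N) else 0) -
        Abs_fps (\<lambda>n. if N dvd n then y $ (n div N) else 0))"
      unfolding x_def y_def using ab by (intro fps_eqv_diff pw A_power)
    also have "\<dots> = V'" by (rule fps_ext) (simp add: V'_def V_def)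
    finally show ?thesis .
  qed
  have "fps_eqv (every N (V ^ N * F)) (every N (V' * F))"
    by (intro every_eqv fps_eqv_mult_right FA VN)
  also have "every N (V' * F) = V * every N F"
    by (rule every_mult_inflated) (simp add: V'_def)
  finally have lhs: "fps_eqv (V * every N F) (every N (V ^ N * F))" by (rule fps_eqv_sym)

  \<comment> \<open>One factor \<open>V\<close> clears the denominator of \<open>F\<close>; only
    multiples of the integer series \<open>e * cusp\<close> remain under U.\<close>
  have VNF: "V ^ N * F = V ^ (N - 1) * G"
    unfolding VF[symmetric] using power_minus_mult[of N V] N_gt_1 by (simp add: mult.assoc[symmetric])
  define T where "T = (\<lambda>g. \<Sum>i\<le>N-1. fps_const (\<delta> * a ^ (3 * i) * b ^ (2 * (N - 1 - i))) * fps_of_ints (g i))"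
  define m' where "m' = (\<lambda>i. e * cusp * E6 ^ (2 * i) * E4 ^ (3 * (N - 1 - i)))"
  have "fps_eqv (V ^ (N - 1) * G) (S1 * G)"
    unfolding VS by (rule fps_eqv_mult_right[OF GA]) (rule fps_eqv_p_mult[OF S2A])
  also have "S1 * G = T m'"
    unfolding S1_def sum_distrib_right T_def
  proof (intro sum.cong refl)
    fix i
    have xi: "x ^ i = fps_const (a ^ (3 * i)) * fps_of_ints (E6 ^ (2 * i))"
      unfolding x_def power_mult_distrib fps_of_ints_power[symmetric] fps_const_power power_mult ..
    have yj: "y ^ j = fps_const (b ^ (2 * j)) * fps_of_ints (E4 ^ (3 * j))" for j
      unfolding y_def power_mult_distrib fps_of_ints_power[symmetric] fps_const_power power_mult ..
    show "x ^ i * y ^ (N - 1 - i) * G =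
        fps_const (\<delta> * a ^ (3 * i) * b ^ (2 * (N - 1 - i))) * fps_of_ints (m' i)"
      unfolding xi yj m'_def G_def fps_of_ints_mult fps_const_mult[symmetric] by (simp only: mult_ac)
  qed
  finally have "fps_eqv (every N (V ^ N * F)) (every N (T m'))" unfolding VNF by (rule every_eqv)
  also have "every N (T m') = T (\<lambda>i. every N (m' i))"
    unfolding T_def by (rule fps_ext) (simp add: fps_sum_nth)
  finally have t1: "fps_eqv (every N (V ^ N * F)) (T (\<lambda>i. every N (m' i)))" .
  have t2: "fps_eqv (T (\<lambda>i. every N (m' i))) (T (\<lambda>i. of_int (\<tau> i) * (e * cusp)))"
    unfolding T_def
  proof (intro fps_eqv_sum fps_eqv_mult_left fps_eqv_of_ints)
    fix i assume "i \<in> {..N - 1}"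
    thus "congp p (every N (m' i)) (of_int (\<tau> i) * (e * cusp))" unfolding m'_def by (intro star) simp
    show "fps_A (fps_const (\<delta> * a ^ (3 * i) * b ^ (2 * (N - 1 - i))))"
      using ab \<delta> by (intro fps_A_const A_mult A_power)
  qed
  have t3: "T (\<lambda>i. of_int (\<tau> i) * (e * cusp)) = fps_const \<mu> * G"
  proof (rule fps_ext)
    fix n
    have mu: "\<mu> = (\<Sum>i\<le>N-1. of_int (\<tau> i) * a ^ (3 * i) * b ^ (2 * (N - 1 - i)))"
      unfolding \<mu>_def using \<tau>(2)[of a b] m by simp
    show "T (\<lambda>i. of_int (\<tau> i) * (e * cusp)) $ n = (fps_const \<mu> * G) $ n"
      unfolding mu T_def G_def fps_sum_nth fps_mult_left_const_nth sum_distrib_right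
        fps_of_ints_nth fps_mult_of_int_nth of_int_mult
      by (intro sum.cong refl) (simp only: of_int_eq_id id_apply mult_ac)
  qed
  have t4: "fps_const \<mu> * G = V * (fps_const \<mu> * F)" unfolding VF[symmetric] by (simp only: mult_ac)
  have "fps_eqv (V * every N F) (V * (fps_const \<mu> * F))"
    using fps_eqv_trans[OF fps_eqv_trans[OF lhs t1] t2] unfolding t3 t4 .
  hence U: "fps_eqv (every N F) (fps_const \<mu> * F)" by (rule fps_eqv_cancel[OF VA V0])

  define t :: 'a where "t = of_int (int N + 1 - int (card (curve_points k\<^sub>P (map_weierstrass (reduce_mod P) W))))"
  have "t \<approx> hasse m a b" unfolding t_def a_def b_def by (rule trace_eqv_hasse[OF W m six])
  hence tK: "t ^ K \<approx> hasse m a b ^ K" by (rule eqv_power) (rule hasse_A[OF ab])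
  \<comment> \<open>Regrouped as powers of a^(N-1) and b^(N-1), both 1 by Fermat because c4 and c6
    are units.\<close>
  have "\<mu> = hasse m a b ^ K * ((a ^ (N - 1)) ^ \<alpha> * (b ^ (N - 1)) ^ \<beta>)"
    unfolding \<mu>_def power_mult_distrib by (simp add: power_mult[symmetric] mult.commute)
  also have "\<dots> \<approx> hasse m a b ^ K * (1 ^ \<alpha> * 1 ^ \<beta>)"
    using ab abM hasse_A[OF ab] by (intro eqv_mult_left eqv_mult eqv_power fermat_A A_power) auto
  also have "hasse m a b ^ K * (1 ^ \<alpha> * 1 ^ \<beta>) = hasse m a b ^ K" by simp
  also have "\<dots> \<approx> t ^ K" by (rule eqv_sym[OF tK])
  finally have "\<mu> \<approx> t ^ K" .
  hence "fps_eqv (fps_const \<mu> * F) (fps_const (t ^ K) * F)"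
    by (intro fps_eqv_mult_right FA) (simp add: fps_eqv_def)
  from fps_eqv_trans[OF U this] show "fps_eqv (every N (eisenstein_over_j k c))
      (fps_const (of_int (int N + 1 - int (card (curve_points k\<^sub>P (map_weierstrass (reduce_mod P) W)))) ^ (k - 2))
        * eisenstein_over_j k c)"
    unfolding F_def t_def K_def .
qed

end

section \<open>Change of model and the congruence for the curve\<close>

lemma weierstrass_iso_invariants:
  fixes W W' :: "'a::field_char_0 weierstrass"
  assumes "weierstrass_iso W W'"
  shows "\<exists>u. u \<noteq> 0 \<and> u ^ 4 * c4 W' = c4 W \<and> u ^ 12 * discriminant W' = discriminant W"
proof -
  obtain u r s t where u: "u \<noteq> 0" and e: "u * a1 W' = a1 W + 2 * s"
    "u ^ 2 * a2 W' = a2 W - s * a1 W + 3 * r - s ^ 2"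
    "u ^ 3 * a3 W' = a3 W + r * a1 W + 2 * t"
    "u ^ 4 * a4 W' = a4 W - s * a3 W + 2 * r * a2 W - (t + r * s) * a1 W + 3 * r ^ 2 - 2 * s * t"
    "u ^ 6 * a6 W' = a6 W + r * a4 W + r ^ 2 * a2 W + r ^ 3 - t * a3 W - t ^ 2 - r * t * a1 W"
    using assms unfolding weierstrass_iso_def by blast
  have "u ^ 2 * b2 W' = (u * a1 W') ^ 2 + 4 * (u ^ 2 * a2 W')"
    by (simp add: b2_def power_mult_distrib distrib_left)
  also have "\<dots> = b2 W + 12 * r"
    unfolding e b2_def by (simp add: power2_eq_square algebra_simps)
  finally have b2: "u ^ 2 * b2 W' = b2 W + 12 * r" .
  have "u ^ 4 * b4 W' = 2 * (u ^ 4 * a4 W') + (u * a1 W') * (u ^ 3 * a3 W')"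
    by (simp add: b4_def eval_nat_numeral algebra_simps)
  also have "\<dots> = b4 W + r * b2 W + 6 * r ^ 2"
    unfolding e b4_def b2_def by (simp add: eval_nat_numeral algebra_simps)
  finally have b4: "u ^ 4 * b4 W' = b4 W + r * b2 W + 6 * r ^ 2" .
  have "u ^ 6 * b6 W' = (u ^ 3 * a3 W') ^ 2 + 4 * (u ^ 6 * a6 W')"
    by (simp add: b6_def eval_nat_numeral algebra_simps)
  also have "\<dots> = b6 W + 2 * r * b4 W + r ^ 2 * b2 W + 4 * r ^ 3"
    unfolding e b6_def b4_def b2_def by (simp add: eval_nat_numeral algebra_simps)
  finally have b6: "u ^ 6 * b6 W' = b6 W + 2 * r * b4 W + r ^ 2 * b2 W + 4 * r ^ 3" .
  have "u ^ 4 * c4 W' = (u ^ 2 * b2 W') ^ 2 - 24 * (u ^ 4 * b4 W')"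
    by (simp add: c4_def eval_nat_numeral algebra_simps)
  also have "\<dots> = c4 W"
    unfolding b2 b4 c4_def by (simp add: eval_nat_numeral algebra_simps)
  finally have c4: "u ^ 4 * c4 W' = c4 W" .
  have "u ^ 6 * c6 W' = - ((u ^ 2 * b2 W') ^ 3) + 36 * (u ^ 2 * b2 W') * (u ^ 4 * b4 W') - 216 * (u ^ 6 * b6 W')"
    by (simp add: c6_def eval_nat_numeral algebra_simps)
  also have "\<dots> = c6 W"
    unfolding b2 b4 b6 c6_def by (simp add: eval_nat_numeral algebra_simps)
  finally have c6: "u ^ 6 * c6 W' = c6 W" .
  \<comment> \<open>The discriminant is treated through c4^3 - c6^2, which avoids the transformation
    of \<open>b8\<close>; characteristic 0 allows the cancellation of 1728.\<close>
  have "1728 * (u ^ 12 * discriminant W') = u ^ 12 * (c4 W' ^ 3 - c6 W' ^ 2)"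
    unfolding discriminant_c4_c6[symmetric] by simp
  also have "\<dots> = (u ^ 4 * c4 W') ^ 3 - (u ^ 6 * c6 W') ^ 2"
    by (simp add: power_mult_distrib power_mult[symmetric] right_diff_distrib)
  also have "\<dots> = 1728 * discriminant W" unfolding c4 c6 discriminant_c4_c6 ..
  finally have "u ^ 12 * discriminant W' = discriminant W" by simp
  thus ?thesis using u c4 by blast
qed

theorem theorem5p1:
  fixes C :: "'a::number_field weierstrass" and P :: "'a set" and k n :: nat
  assumes "k \<in> {4, 6, 8, 10, 14}"
    and "elliptic_curve C"
    and "nf_prime P"
    and "good_reduction P C"
    and "6 \<notin> P"
    and "has_valuation P (j_invariant C) 0"
    and "has_valuation P (j_invariant C - 1728) 0"
    and "n \<ge> 1"
  shows "cong_mod_prime P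
    (fps_nth (eisenstein_over_j k (j_invariant C)) (n * prime_norm P))
    (of_int (frobenius_trace P C) ^ (k - 2) *
      fps_nth (eisenstein_over_j k (j_invariant C)) n)"
proof -
  interpret nf_place P by unfold_locales (rule assms(3))
  obtain p where p: "prime p" "(of_nat p :: 'a) \<in> P" using ex_prime_in_P by blast
  obtain r where r: "r > 0" "finite (carrier k\<^sub>P)" "prime_norm P = p ^ r" using card_residue[OF p] by blast
  interpret nf_residue P p r by unfold_locales (use p r in auto)
  \<comment> \<open>The same choice as in \<open>reduction\<close>, so that the point count in
    \<open>frobenius_trace\<close> is that of \<open>W\<close>.\<close>
  define W where "W = (SOME W. good_model P C W)"
  have "good_model P C W"
    unfolding W_def using assms(4) by (auto simp: good_reduction_def intro: someI_ex)
  hence W: "weierstrass_iso C W" "set_weierstrass W \<subseteq> A" "discriminant W \<in> A" "discriminant W \<notin> M"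
    using has_valuation_0 by (auto simp: good_model_def)
  have d0: "discriminant W \<noteq> 0" using W(4) by auto
  obtain u where u: "u \<noteq> 0" "u ^ 4 * c4 W = c4 C" "u ^ 12 * discriminant W = discriminant C"
    using weierstrass_iso_invariants[OF W(1)] by blast
  have j: "j_invariant C = j_invariant W"
    unfolding j_invariant_def u(2,3)[symmetric] using u(1)
    by (simp add: power_mult_distrib power_mult[symmetric])
  have jd4: "j_invariant W * discriminant W = c4 W ^ 3" using d0 by (simp add: j_invariant_def)
  have jd6: "(j_invariant W - 1728) * discriminant W = c6 W ^ 2"
    unfolding left_diff_distrib jd4 discriminant_c4_c6 by simp
  have j0: "j_invariant W \<in> A" "j_invariant W \<notin> M" "j_invariant W - 1728 \<in> A" "j_invariant W - 1728 \<notin> M"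
    using has_valuation_0[OF assms(6)] has_valuation_0[OF assms(7)] by (simp_all add: j)
  \<comment> \<open>c4^3 is the product of the units j and the discriminant; likewise c6^2 is the
    product of j - 1728 and the discriminant.\<close>
  have c4: "c4 W \<notin> M"
  proof
    assume "c4 W \<in> M"
    hence "c4 W ^ 2 * c4 W \<in> M" by (intro M_mult A_power M_A)
    hence "j_invariant W * discriminant W \<in> M" unfolding jd4 by (simp add: power2_eq_square power3_eq_cube)
    thus False using M_prime j0 W by blast
  qed
  have c6: "c6 W \<notin> M"
  proof
    assume "c6 W \<in> M"
    hence "c6 W * c6 W \<in> M" by (intro M_mult M_A)
    hence "(j_invariant W - 1728) * discriminant W \<in> M" unfolding jd6 by (simp add: power2_eq_square)
    thus False using M_prime j0 W by blast
  qed
  have tr: "frobenius_trace P C = int N + 1 - int (card (curve_points k\<^sub>P (map_weierstrass (reduce_mod P) W)))"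
    by (simp add: frobenius_trace_def reduction_def W_def)
  note main = eisenstein_over_j_eqv[OF assms(1) assms(5) W(2,4) c4 c6 j, folded tr]
  have eqv: "eisenstein_over_j k (j_invariant C) $ (n * N) \<approx>
      of_int (frobenius_trace P C) ^ (k - 2) * eisenstein_over_j k (j_invariant C) $ n"
    using main(2) by (simp add: fps_eqv_def del: of_int_power)
  thus ?thesis
    using main(1) unfolding cong_mod_prime_def eqv_def[symmetric]
    by (auto simp: fps_A_def intro!: A_mult A_power)
qed

end
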